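(* Let $n\ge 2$. A map $\mu:\mathcal{P}_o^n\to\mathbb{R}$ is an upper semicontinuous and $\operatorname{SL}(n)$-invariant valuation if and only if there exist constants $c_0,c_1,c_2\in\mathbb{R}$ such that \[\mu(P)=c_0V_0(P)+c_1V_n(P)+c_2V_n(P^* )\] for all $P\in\mathcal{P}_o^n$.
   Context: $\mathcal{P}_o^n$ is the set of convex polytopes in $\mathbb{R}^n$ containing the origin in their interiors, equipped with the Hausdorff distance. A map $\mu:\mathcal{P}_o^n\to\mathbb{R}$ is a valuation if $\mu(P\cup Q)+\mu(P\cap Q)=\mu(P)+\mu(Q)$ whenever $P,Q,P\cup Q,P\cap Q\in\mathcal{P}_o^n$. It is upper semicontinuous if $\limsup_{k\to\infty}\mu(P_k)\le\mu(P)$ for each sequence $P_k\in\mathcal{P}_o^n$ converging to $P\in\mathcal{P}_o^n$ in the Hausdorff distance. It is $\operatorname{SL}(n)$-invariant if $\mu(\phi P)=\mu(P)$ for all $\phi\in\operatorname{SL}(n)$ and $P\in\mathcal{P}_o^n$. $V_0$ is the Euler characteristic (so $V_0(P)=1$ for every $P\in\mathcal{P}_o^n$), $V_n$ is the $n$-dimensional volume, and $P^*=\{x\in\mathbb{R}^n:\langle x,y\rangle\le1\text{ for all }y\in P\}$ is the polar body of $P$. *)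

theory Defs
  imports "HOL-Analysis.Analysis" "HOL-Homology.Homology"
begin

text \<open>A dimension \<open>n\<close> is represented by a finite index type \<open>'n\<close> with \<open>n = CARD('n)\<close>.\<close>

definition polytopes_o :: "(real^'n) set set" where
  "polytopes_o = {P. polytope P \<and> 0 \<in> interior P}"

text \<open>Only meaningful for nonempty bounded sets; in general the suprema may fail to exist.\<close>

definition hausdorff_distance :: "'a::metric_space set \<Rightarrow> 'a set \<Rightarrow> real" where
  "hausdorff_distance A B = max (SUP x\<in>A. infdist x B) (SUP y\<in>B. infdist y A)"

definition hausdorff_converges :: "(nat \<Rightarrow> 'a::metric_space set) \<Rightarrow> 'a set \<Rightarrow> bool" where
  "hausdorff_converges X P \<longleftrightarrow> (\<lambda>k. hausdorff_distance (X k) P) \<longlonglongrightarrow> 0"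

text \<open>A map on \<^term>\<open>polytopes_o\<close> is represented by a total function on sets, of which the
  three predicates below only constrain the values on \<^term>\<open>polytopes_o\<close>.\<close>

definition valuation_o :: "((real^'n) set \<Rightarrow> real) \<Rightarrow> bool" where
  "valuation_o \<mu> \<longleftrightarrow>
    (\<forall>P Q. P \<in> polytopes_o \<and> Q \<in> polytopes_o \<and> P \<union> Q \<in> polytopes_o \<and> P \<inter> Q \<in> polytopes_o
       \<longrightarrow> \<mu> (P \<union> Q) + \<mu> (P \<inter> Q) = \<mu> P + \<mu> Q)"

definition upper_semicontinuous_o :: "((real^'n) set \<Rightarrow> real) \<Rightarrow> bool" where
  "upper_semicontinuous_o \<mu> \<longleftrightarrow>
    (\<forall>X P. (\<forall>k. X k \<in> polytopes_o) \<and> P \<in> polytopes_o \<and> hausdorff_converges X P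
       \<longrightarrow> limsup (\<lambda>k. ereal (\<mu> (X k))) \<le> ereal (\<mu> P))"

definition SL_invariant_o :: "((real^'n) set \<Rightarrow> real) \<Rightarrow> bool" where
  "SL_invariant_o \<mu> \<longleftrightarrow>
    (\<forall>A :: real^'n^'n. \<forall>P \<in> polytopes_o. det A = 1 \<longrightarrow> \<mu> ((\<lambda>x. A *v x) ` P) = \<mu> P)"

definition polar_body :: "'a::real_inner set \<Rightarrow> 'a set" where
  "polar_body P = {x. \<forall>y\<in>P. x \<bullet> y \<le> 1}"

definition vol_n :: "'a::euclidean_space set \<Rightarrow> real" where
  "vol_n P = measure lebesgue P"

text \<open>The rank of an abelian group (written multiplicatively) is the largest number of
  elements that are linearly independent over the integers.\<close>

definition Z_independent :: "('a, 'b) monoid_scheme \<Rightarrow> 'a set \<Rightarrow> bool" where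
  "Z_independent G B \<longleftrightarrow> finite B \<and> B \<subseteq> carrier G \<and>
     (\<forall>k :: 'a \<Rightarrow> int. finprod G (\<lambda>b. b [^]\<^bsub>G\<^esub> k b) B = \<one>\<^bsub>G\<^esub> \<longrightarrow> (\<forall>b\<in>B. k b = 0))"

definition abelian_rank :: "('a, 'b) monoid_scheme \<Rightarrow> nat" where
  "abelian_rank G = Sup (card ` {B. Z_independent G B})"

definition betti_number :: "nat \<Rightarrow> 'a topology \<Rightarrow> nat" where
  "betti_number p X = abelian_rank (homology_group (int p) X)"

text \<open>The alternating sum of the Betti numbers in singular homology, defined for spaces whose
  homology groups have finite rank, almost all of them zero.\<close>

definition euler_characteristic :: "'a::topological_space set \<Rightarrow> real" where
  "euler_characteristic S =
     (\<Sum>p | betti_number p (top_of_set S) \<noteq> 0. (-1) ^ p * real (betti_number p (top_of_set S)))"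

lemma abelian_rank_trivial:
  assumes "comm_group G" "trivial_group G"
  shows "abelian_rank G = 0"
proof -
  interpret comm_group G by fact
  have "B = {}" if "Z_independent G B" for B
  proof (rule ccontr)
    assume "B \<noteq> {}"
    with that assms(2) have B: "B = {\<one>\<^bsub>G\<^esub>}"
      by (auto simp: Z_independent_def trivial_group_def)
    have "finprod G (\<lambda>b. b [^]\<^bsub>G\<^esub> (\<lambda>_. 1::int) b) B = \<one>\<^bsub>G\<^esub>"
      by (rule finprod_one_eqI) (simp add: B)
    then show False
      using that[unfolded Z_independent_def, THEN conjunct2, THEN conjunct2, THEN spec, of "\<lambda>_. 1"] B
      by simp
  qed
  moreover have "Z_independent G {}" by (simp add: Z_independent_def)
  ultimately have "{B. Z_independent G B} = {{}}" by blast
  then show ?thesis by (simp add: abelian_rank_def)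
qed

lemma abelian_rank_integer:
  assumes "comm_group G" "G \<cong> integer_group"
  shows "abelian_rank G = 1"
proof -
  interpret comm_group G by fact
  obtain f where f: "f \<in> iso G integer_group" using assms(2) by (auto simp: is_iso_def)
  then interpret gh: group_hom G integer_group f
    by (intro group_hom.intro group_hom_axioms.intro) (auto simp: iso_def)
  have bij: "bij_betw f (carrier G) UNIV" using f by (simp add: iso_def)
  have pw: "f (x [^]\<^bsub>G\<^esub> (k::int)) = k * f x" if "x \<in> carrier G" for x k
    using gh.hom_int_pow[OF that, of k] by (simp add: that)
  have inj: "x = \<one>\<^bsub>G\<^esub>" if "x \<in> carrier G" "f x = 0" for x
    using bij that gh.hom_one by (auto simp: bij_betw_def inj_on_def)
  obtain g where g: "g \<in> carrier G" "f g = 1" using bij by (metis UNIV_I bij_betw_def imageE)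
  have "Z_independent G {g}"
    unfolding Z_independent_def
  proof (intro conjI allI impI)
    fix k :: "'a \<Rightarrow> int"
    assume "finprod G (\<lambda>b. b [^]\<^bsub>G\<^esub> k b) {g} = \<one>\<^bsub>G\<^esub>"
    then have "g [^]\<^bsub>G\<^esub> k g = \<one>\<^bsub>G\<^esub>" using g by simp
    then show "\<forall>b\<in>{g}. k b = 0" using pw[OF g(1), of "k g"] g gh.hom_one by simp
  qed (use g in auto)
  then have one: "1 \<in> card ` {B. Z_independent G B}" by force
  have le: "card B \<le> 1" if B: "Z_independent G B" for B
  proof (rule ccontr)
    assume "\<not> card B \<le> 1"
    then obtain a b where ab: "a \<in> B" "b \<in> B" "a \<noteq> b"
      by (metis B One_nat_def Z_independent_def card_le_Suc0_iff_eq)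
    have fin: "finite B" and sub: "B \<subseteq> carrier G"
      and ind: "\<And>k :: 'a \<Rightarrow> int. finprod G (\<lambda>b. b [^]\<^bsub>G\<^esub> k b) B = \<one>\<^bsub>G\<^esub> \<Longrightarrow> \<forall>b\<in>B. k b = 0"
      using B unfolding Z_independent_def by blast+
    have abc: "a \<in> carrier G" "b \<in> carrier G" using ab sub by auto
    define x y where "x = (if f a = 0 \<and> f b = 0 then 1 else f b)"
      and "y = (if f a = 0 \<and> f b = 0 then 1 else - f a)"
    define k where "k = (\<lambda>c. if c = a then x else if c = b then y else (0::int))"
    have "finprod G (\<lambda>c. c [^]\<^bsub>G\<^esub> k c) B = finprod G (\<lambda>c. c [^]\<^bsub>G\<^esub> k c) {a, b}"
      using ab fin sub
      by (intro finprod_mono_neutral_cong_right) (auto simp: k_def)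
    also have "\<dots> = a [^]\<^bsub>G\<^esub> x \<otimes>\<^bsub>G\<^esub> b [^]\<^bsub>G\<^esub> y"
      using ab abc by (subst finprod_insert) (auto simp: k_def)
    also have "\<dots> = \<one>\<^bsub>G\<^esub>"
      using abc by (intro inj) (auto simp: pw x_def y_def)
    finally have "k a = 0" "k b = 0" using ind ab by auto
    then show False using ab by (auto simp: k_def x_def y_def split: if_splits)
  qed
  have "Sup (card ` {B. Z_independent G B}) = 1"
    by (rule cSup_eq_maximum) (use one le in auto)
  then show ?thesis by (simp add: abelian_rank_def)
qed

lemma euler_characteristic_convex:
  fixes S :: "'a::real_normed_vector set"
  assumes "convex S" "S \<noteq> {}"
  shows "euler_characteristic S = 1"
proof -
  have con: "contractible_space (top_of_set S)"
    using assms by (simp add: convex_imp_contractible)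
  have "homology_group 0 (top_of_set S) \<cong> integer_group"
    using assms con
    by (intro isomorphic_integer_zeroth_homology_group)
       (auto simp: convex_imp_path_connected)
  then have b0: "betti_number 0 (top_of_set S) = 1"
    unfolding betti_number_def
    by (intro abelian_rank_integer) (simp_all add: abelian_homology_group)
  have bp: "betti_number p (top_of_set S) = 0" if "p \<noteq> 0" for p
  proof -
    have "trivial_group (reduced_homology_group (int p) (top_of_set S))"
      by (rule trivial_reduced_homology_group_contractible_space[OF con])
    then have "trivial_group (homology_group (int p) (top_of_set S))"
      using that by (simp add: un_reduced_homology_group)
    then show ?thesis
      by (simp add: betti_number_def abelian_rank_trivial abelian_homology_group)
  qed
  have "{p. betti_number p (top_of_set S) \<noteq> 0} = {0}"
  proof (intro equalityI subsetI)
    fix p assume "p \<in> {p. betti_number p (top_of_set S) \<noteq> 0}"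
    then show "p \<in> {0}" using bp[of p] by (cases "p = 0") simp_all
  qed (use b0 in auto)
  then show ?thesis by (simp add: euler_characteristic_def b0)
qed

end

theory Submission
  imports Defs
begin

text \<open>The functions on the right-hand side are valuations of the required kind: a union of two
  polytopes that is again convex is turned by polarity into an intersection and the intersection
  into a union, linear maps multiply volume by the absolute value of their determinant, and
  Hausdorff convergence to \<open>P\<close> means being squeezed between \<open>(1/c) P\<close>
  and \<open>c P\<close> for every \<open>c > 1\<close>, so that volume and polar volume are even
  continuous.

  The other direction compares an arbitrary \<open>\<mu>\<close> with these functions on boxes
  \<open>\<Prod>[-p k, q k]\<close> and then shows that boxes decide everything. It has two
  halves.

  First half, values on boxes (\<open>box_values\<close>): \<open>\<mu>\<close> of a box equals
  \<open>c0 + c1 * (\<Prod>k. p k + q k) + c2 * (\<Prod>k. 1/p k + 1/q k)\<close>. Letting only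
  two coordinates vary gives a shear-invariant valuation on planar polytopes
  (\<open>plane_valuation\<close>). A trapezoid over a fixed interval is an intersection of a
  region below its top edge and a region above its bottom edge, and these two edges contribute
  independently; a shear moves slope from one edge to the other. Hence the contribution of the
  slope is additive, and being bounded above near a point it is linear. A triangle can be read as
  a trapezoid over each of its sides; equating the resulting values yields a functional equation
  for rectangles (\<open>rectangle_equation\<close>), whose solutions are the three expected
  terms. Upper semicontinuity enters only through local boundedness from above, which forces
  additive functions to be linear.

  Second half, boxes suffice (\<open>null_on_boxes_vanish\<close>): an
  \<open>SL(n)\<close>-invariant valuation \<open>\<tau>\<close> that vanishes on boxes vanishes.
  Consider products of a polytope in some of the coordinates with a box in the others, and induct
  on the number of coordinates of the polytope. A cylinder between two parallel planes is a linear
  image of a product with a polytope in fewer coordinates, so \<open>\<tau>\<close> vanishes on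
  it. Modulo such prisms, a polytope is the sum of two roofs, one turned upside down, a roof being
  a vertical cylinder closed from above by some facets and from below by a horizontal floor whose
  height is immaterial (\<open>split_into_roofs\<close>). The plane through the intersection of
  two facets of a roof and parallel to the axis splits it, so that roofs reduce to roofs with a
  single sloping facet (\<open>bisector_exchange\<close>, \<open>top_recursion\<close>). For a
  single facet only the base and the direction of the facet matter. This gives in turn translation
  invariance of \<open>\<tau>\<close> in the polytope factor
  (\<open>translation_invariant\<close>); then the roof over a base \<open>K\<close> is a
  translation invariant valuation of \<open>K\<close>; invariance under shears shows that it
  doubles when the slope of the facet is doubled (\<open>roof_double\<close>), and invariance
  under the map that stretches the axis by \<open>2^(m-1)\<close> and halves the \<open>m -
  1\<close> orthogonal directions turns this into homogeneity of degree \<open>m\<close> in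
  \<open>K\<close>. But \<open>K\<close> has dimension \<open>m - 1\<close>, and a translation
  invariant valuation cannot be homogeneous of a degree above the dimension unless it is zero
  (\<open>homogeneous_vanish\<close>). So all roofs have value zero, and \<open>\<tau>\<close>
  vanishes.

  Finally, volume and polar volume of a box are non-zero multiples of the two products.
  Subtracting the right combination from \<open>\<mu>\<close> gives a valuation that is zero on
  boxes, hence zero.\<close>

section \<open>Polytopes around the origin\<close>

text \<open>The polar dual description: every facet hyperplane of a body around the origin can be written as
  \<open>n \<bullet> y = 1\<close>, so that a finite set of vectors \<open>n\<close> encodes the
  polytope.\<close>
definition halfs :: "'a::euclidean_space set \<Rightarrow> 'a set \<Rightarrow> 'a set" where
  "halfs U N = {y \<in> U. \<forall>n\<in>N. n \<bullet> y \<le> 1}"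

text \<open>The relative version, inside a subspace \<open>U\<close>, of containing the origin in the
  interior; the inductions below run over subspaces.\<close>
definition polytope_o :: "'a::euclidean_space set \<Rightarrow> 'a set \<Rightarrow> bool" where
  "polytope_o U P \<longleftrightarrow> polytope P \<and> P \<subseteq> U \<and> (\<exists>e>0. ball 0 e \<inter> U \<subseteq> P)"

definition valuation_on :: "'a::euclidean_space set \<Rightarrow> ('a set \<Rightarrow> real) \<Rightarrow> bool" where
  "valuation_on U f \<longleftrightarrow> (\<forall>P Q. polytope_o U P \<longrightarrow> polytope_o U Q \<longrightarrow> polytope_o U (P \<union> Q) \<longrightarrow> polytope_o U (P \<inter> Q) \<longrightarrow>
      f (P \<union> Q) + f (P \<inter> Q) = f P + f Q)"

lemma halfs_mono: "N \<subseteq> N' \<Longrightarrow> halfs U N' \<subseteq> halfs U N"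
  by (auto simp: halfs_def)

lemma polytope_o_halfs:
  assumes "subspace U" "finite N" "bounded (halfs U N)"
  shows "polytope_o U (halfs U N)"
proof -
  have eq: "halfs U N = U \<inter> \<Inter> ((\<lambda>n. {y. n \<bullet> y \<le> 1}) ` N)"
    by (auto simp: halfs_def)
  have "polyhedron (halfs U N)"
    unfolding eq using assms
    by (intro polyhedron_Int[OF affine_imp_polyhedron[OF subspace_imp_affine]] polyhedron_Inter)
       (auto simp: polyhedron_halfspace_le)
  then have "polytope (halfs U N)"
    using assms polytope_eq_bounded_polyhedron by blast
  moreover have "\<exists>e>0. ball 0 e \<inter> U \<subseteq> halfs U N"
  proof -
    have "open (\<Inter> ((\<lambda>n. {y. n \<bullet> y < 1}) ` N))"
      using assms by (intro open_INT) (auto simp: open_halfspace_lt)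
    moreover have "0 \<in> \<Inter> ((\<lambda>n. {y. n \<bullet> y < 1}) ` N)" by simp
    ultimately obtain e where "e > 0" "ball 0 e \<subseteq> \<Inter> ((\<lambda>n. {y. n \<bullet> y < 1}) ` N)"
      using open_contains_ball by blast
    then show ?thesis by (intro exI[of _ e]) (force simp: halfs_def)
  qed
  ultimately show ?thesis by (auto simp: polytope_o_def halfs_def)
qed

text \<open>The normals of an arbitrary half-space description are projected to \<open>U\<close>; since the
  origin is a relative interior point, the right-hand sides become positive and can be scaled to
  1.\<close>
lemma polytope_o_imp_halfs:
  assumes "subspace U" "polytope_o U P"
  obtains N where "finite N" "N \<subseteq> U" "P = halfs U N"
proof -
  obtain e where e: "e > 0" "ball 0 e \<inter> U \<subseteq> P" and PU: "P \<subseteq> U" and poly: "polytope P"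
    using assms by (auto simp: polytope_o_def)
  obtain F where F: "finite F" "P = \<Inter> F" "\<forall>h\<in>F. \<exists>a b. a \<noteq> 0 \<and> h = {x. a \<bullet> x \<le> b}"
    using polytope_imp_polyhedron[OF poly] unfolding polyhedron_def by blast
  have "\<exists>n\<in>U. U \<inter> h = halfs U {n}" if hF: "h \<in> F" for h
  proof -
    obtain a b where ab: "h = {x. a \<bullet> x \<le> b}" using bspec[OF F(3) hF] by blast
    \<comment> \<open>The component of the normal orthogonal to \<open>U\<close> is invisible inside
      \<open>U\<close>.\<close>
    obtain a1 a2 where a0: "a1 \<in> span U" "\<And>w. w \<in> span U \<Longrightarrow> orthogonal a2 w" "a = a1 + a2"
      by (rule orthogonal_subspace_decomp_exists[of U a]) (rule that)
    have sU: "span U = U" using assms(1) span_eq_iff by blast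
    have a: "a1 \<in> U" "\<And>w. w \<in> U \<Longrightarrow> a2 \<bullet> w = 0" "a = a1 + a2"
      using a0 unfolding sU orthogonal_def by blast+
    have dot: "a \<bullet> w = a1 \<bullet> w" if "w \<in> U" for w using a that by (simp add: inner_add_left)
    have Ph: "P \<subseteq> h" using F(2) hF by blast
    show ?thesis
    proof (cases "a1 = 0")
      case True
      have "0 \<in> P" using e subspace_0[OF assms(1)] by auto
      then have "b \<ge> 0" using Ph ab by auto
      then show ?thesis using dot True subspace_0[OF assms(1)]
        by (intro bexI[of _ 0]) (auto simp: ab halfs_def)
    next
      case False
      \<comment> \<open>A point of the polytope on the side to which the normal points; it witnesses \<open>b >
        0\<close>.\<close>
      let ?w = "(e / 2 / norm a1) *\<^sub>R a1"
      have w: "?w \<in> ball 0 e" "?w \<in> U" using False e a assms(1) by (auto simp: subspace_scale)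
      then have "?w \<in> h" using Ph e by blast
      then have "a1 \<bullet> ?w \<le> b" unfolding ab mem_Collect_eq dot[OF w(2)] .
      moreover have "a1 \<bullet> ?w > 0" using False e by simp
      ultimately have b: "b > 0" by linarith
      then show ?thesis using dot a assms(1)
        by (intro bexI[of _ "(1/b) *\<^sub>R a1"]) (auto simp: ab halfs_def subspace_scale field_simps)
    qed
  qed
  then have "\<forall>h\<in>F. \<exists>n. n \<in> U \<and> U \<inter> h = halfs U {n}" by blast
  from bchoice[OF this] obtain g
    where g: "\<And>h. h \<in> F \<Longrightarrow> g h \<in> U" "\<And>h. h \<in> F \<Longrightarrow> U \<inter> h = halfs U {g h}"
    by blast
  have "P = halfs U (g ` F)"
  proof (intro equalityI subsetI)
    fix y assume y: "y \<in> P"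
    then have "y \<in> U" using PU by auto
    moreover have "g h \<bullet> y \<le> 1" if "h \<in> F" for h
      using g(2)[OF that] y \<open>y \<in> U\<close> that F by (auto simp: halfs_def set_eq_iff)
    ultimately show "y \<in> halfs U (g ` F)" by (auto simp: halfs_def)
  next
    fix y assume y: "y \<in> halfs U (g ` F)"
    then have "y \<in> U \<inter> h" if "h \<in> F" for h using g(2)[OF that] that by (auto simp: halfs_def)
    then show "y \<in> P" using F by auto
  qed
  moreover have "finite (g ` F)" "g ` F \<subseteq> U" using F(1) g(1) by auto
  ultimately show ?thesis using that by blast
qed

lemma polytope_o_bounded: "polytope_o U P \<Longrightarrow> bounded P"
  by (simp add: polytope_o_def polytope_imp_bounded)

lemma polytope_o_convex: "polytope_o U P \<Longrightarrow> convex P"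
  by (simp add: polytope_o_def polytope_imp_convex)

lemma polytope_o_compact: "polytope_o U P \<Longrightarrow> compact P"
  by (simp add: polytope_o_def polytope_imp_compact)

lemma polytope_o_zero: "subspace U \<Longrightarrow> polytope_o U P \<Longrightarrow> 0 \<in> P"
  using subspace_0 by (fastforce simp: polytope_o_def)

lemma polytope_o_Int: "polytope_o U P \<Longrightarrow> polytope_o U Q \<Longrightarrow> polytope_o U (P \<inter> Q)"
  unfolding polytope_o_def
proof (elim conjE exE, intro conjI)
  fix e e' :: real
  assume "e > 0" "e' > 0" "ball 0 e \<inter> U \<subseteq> P" "ball 0 e' \<inter> U \<subseteq> Q"
  then show "\<exists>e>0. ball 0 e \<inter> U \<subseteq> P \<inter> Q" by (intro exI[of _ "min e e'"]) auto
qed (auto simp: polytope_Int)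

lemma valuation_on_split:
  assumes "valuation_on U f" "polytope_o U P" "polytope_o U Q" "polytope_o U R" "P \<union> Q = R" "P \<inter> Q = S"
  shows "f R + f S = f P + f Q"
  using assms polytope_o_Int unfolding valuation_on_def by blast

lemma valuation_on_halfs:
  assumes "subspace U" "valuation_on U f" "finite N1" "finite N2" "finite N3" "bounded (halfs U N3)"
    "halfs U N1 \<union> halfs U N2 = halfs U N3" "halfs U N1 \<inter> halfs U N2 = halfs U N4"
  shows "f (halfs U N3) + f (halfs U N4) = f (halfs U N1) + f (halfs U N2)"
proof (rule valuation_on_split[OF assms(2)])
  have "bounded (halfs U N1)" "bounded (halfs U N2)"
    using assms(6,7) bounded_subset by blast+
  then show "polytope_o U (halfs U N1)" "polytope_o U (halfs U N2)" "polytope_o U (halfs U N3)"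
    using assms polytope_o_halfs by blast+
qed (use assms in auto)

section \<open>Exchanging two facets of a roof\<close>

text \<open>The normals in \<open>A\<close> are orthogonal to \<open>e\<close>, so \<open>halfs U A\<close>
  is a cylinder in direction \<open>e\<close>, and it is required to have a bounded cross-section.\<close>
definition prism_base :: "'a::euclidean_space set \<Rightarrow> 'a \<Rightarrow> 'a set \<Rightarrow> bool" where
  "prism_base U e A \<longleftrightarrow> finite A \<and> (\<forall>a\<in>A. a \<bullet> e = 0) \<and> bounded (halfs U A \<inter> {y. y \<bullet> e = 0})"

lemma prism_base_insert: "prism_base U e A \<Longrightarrow> m \<bullet> e = 0 \<Longrightarrow> prism_base U e (insert m A)"
  unfolding prism_base_def by (auto intro: bounded_subset simp: halfs_def)

lemma prism_base_split:
  assumes "prism_base U e A" "subspace U" "e \<in> U" "e \<noteq> 0" "y \<in> halfs U A"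
  obtains x t where "y = x + t *\<^sub>R e" "x \<in> halfs U A" "x \<bullet> e = 0"
proof -
  let ?t = "(y \<bullet> e) / (e \<bullet> e)"
  have "y - ?t *\<^sub>R e \<in> halfs U A"
    using assms by (auto simp: halfs_def prism_base_def subspace_diff subspace_scale inner_diff_right)
  moreover have "(y - ?t *\<^sub>R e) \<bullet> e = 0" using assms by (simp add: inner_diff_left)
  ultimately show ?thesis using that[of "y - ?t *\<^sub>R e" ?t] by auto
qed

text \<open>On a cylinder with bounded cross-section, a single constraint whose normal has a positive
  component along \<open>e\<close> bounds the height.\<close>
lemma prism_base_bounded_above:
  assumes "prism_base U e A" "subspace U" "e \<in> U" "e \<noteq> 0" "n \<bullet> e > 0"
  obtains C where "C > 0" "\<And>y. y \<in> halfs U A \<Longrightarrow> n \<bullet> y \<le> 1 \<Longrightarrow> e \<bullet> y \<le> C"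
proof -
  obtain R where R: "\<And>x. x \<in> halfs U A \<Longrightarrow> x \<bullet> e = 0 \<Longrightarrow> norm x \<le> R"
    using assms(1) unfolding prism_base_def bounded_iff by auto
  let ?C = "(1 + norm n * \<bar>R\<bar>) / (n \<bullet> e) * (e \<bullet> e) + 1"
  have pos: "(1 + norm n * \<bar>R\<bar>) / (n \<bullet> e) * (e \<bullet> e) \<ge> 0" using assms by simp
  show ?thesis
  proof (rule that[of ?C])
    show "?C > 0" using pos by linarith
    fix y assume y: "y \<in> halfs U A" "n \<bullet> y \<le> 1"
    obtain x t where xt: "y = x + t *\<^sub>R e" "x \<in> halfs U A" "x \<bullet> e = 0"
      using prism_base_split assms y by metis
    have "norm x \<le> \<bar>R\<bar>" using R[OF xt(2,3)] by linarith
    then have "norm n * norm x \<le> norm n * \<bar>R\<bar>" by (intro mult_left_mono) auto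
    then have "n \<bullet> x \<ge> - (norm n * \<bar>R\<bar>)" using Cauchy_Schwarz_ineq2[of n x] by linarith
    moreover have "n \<bullet> x + t * (n \<bullet> e) \<le> 1" using y xt by (simp add: inner_add_right)
    ultimately have "t * (n \<bullet> e) \<le> 1 + norm n * \<bar>R\<bar>" by linarith
    then have "t \<le> (1 + norm n * \<bar>R\<bar>) / (n \<bullet> e)" using assms(5) by (simp add: field_simps)
    then have "t * (e \<bullet> e) \<le> (1 + norm n * \<bar>R\<bar>) / (n \<bullet> e) * (e \<bullet> e)"
      by (intro mult_right_mono) auto
    moreover have "e \<bullet> y = t * (e \<bullet> e)" using xt by (simp add: inner_add_right inner_commute)
    ultimately show "e \<bullet> y \<le> ?C" by linarith
  qed
qed

text \<open>One constraint from above and one from below close the cylinder.\<close>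
lemma prism_base_bounded:
  assumes "prism_base U e A" "subspace U" "e \<in> U" "e \<noteq> 0" "n \<bullet> e > 0" "n' \<bullet> e < 0"
    "n \<in> N" "n' \<in> N" "A \<subseteq> N"
  shows "bounded (halfs U N)"
proof -
  obtain R where R: "\<And>x. x \<in> halfs U A \<Longrightarrow> x \<bullet> e = 0 \<Longrightarrow> norm x \<le> R"
    using assms(1) unfolding prism_base_def bounded_iff by auto
  obtain C where C: "C > 0" "\<And>y. y \<in> halfs U A \<Longrightarrow> n \<bullet> y \<le> 1 \<Longrightarrow> e \<bullet> y \<le> C"
    using prism_base_bounded_above[OF assms(1-5)] by blast
  have b': "prism_base U (-e) A" using assms(1) by (simp add: prism_base_def)
  obtain C' where C': "C' > 0" "\<And>y. y \<in> halfs U A \<Longrightarrow> n' \<bullet> y \<le> 1 \<Longrightarrow> -e \<bullet> y \<le> C'"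
    using prism_base_bounded_above[OF b', of n'] assms by (auto simp: subspace_neg)
  show ?thesis unfolding bounded_iff
  proof (intro exI ballI)
    fix y assume y: "y \<in> halfs U N"
    then have yA: "y \<in> halfs U A" using assms halfs_mono by blast
    have "e \<bullet> y \<le> C" "-e \<bullet> y \<le> C'" using C C' yA y assms by (auto simp: halfs_def)
    then have ey: "\<bar>e \<bullet> y\<bar> \<le> C + C'" using C C' by auto
    obtain x t where xt: "y = x + t *\<^sub>R e" "x \<in> halfs U A" "x \<bullet> e = 0"
      using prism_base_split assms yA by metis
    have "e \<bullet> y = t * (e \<bullet> e)" using xt by (simp add: inner_add_right inner_commute)
    then have "\<bar>t\<bar> * (e \<bullet> e) \<le> C + C'" using ey by (simp add: abs_mult)
    then have "\<bar>t\<bar> \<le> (C + C') / (e \<bullet> e)" using assms by (simp add: field_simps)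
    from mult_right_mono[OF this, of "norm e"]
    have "norm (t *\<^sub>R e) \<le> (C + C') / (e \<bullet> e) * norm e" by simp
    moreover have "norm y \<le> norm x + norm (t *\<^sub>R e)" using xt(1) norm_triangle_ineq by blast
    ultimately show "norm y \<le> R + (C + C') / (e \<bullet> e) * norm e"
      using add_mono[OF R[OF xt(2,3)]] order_trans by blast
  qed
qed

text \<open>The half-space with this normal is parallel to \<open>e\<close> and its boundary contains the
  intersection of the two hyperplanes \<open>i \<bullet> y = 1\<close> and \<open>j \<bullet> y =
  1\<close>: the combination of \<open>i\<close> and \<open>j\<close> is the one that cancels the
  component along \<open>e\<close>, normalised to have value 1 on that intersection.\<close>
definition bisector :: "'a::euclidean_space \<Rightarrow> 'a \<Rightarrow> 'a \<Rightarrow> 'a" where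
  "bisector e i j = (1 / (1 / (j \<bullet> e) - 1 / (i \<bullet> e))) *\<^sub>R ((1 / (j \<bullet> e)) *\<^sub>R j - (1 / (i \<bullet> e)) *\<^sub>R i)"

lemma bisector_orth: "i \<bullet> e \<noteq> 0 \<Longrightarrow> j \<bullet> e \<noteq> 0 \<Longrightarrow> bisector e i j \<bullet> e = 0"
  by (simp add: bisector_def inner_diff_left)

text \<open>The quantity \<open>(1 - n \<bullet> y) / (n \<bullet> e)\<close> is the distance, in multiples
  of \<open>e\<close>, from \<open>y\<close> up to the hyperplane \<open>n \<bullet> y =
  1\<close>. On one side of the bisector the facet \<open>i\<close> lies lower and on the other
  side \<open>j\<close>.\<close>
lemma bisector_le_iff:
  assumes "0 < j \<bullet> e" "j \<bullet> e < i \<bullet> e"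
  shows "bisector e i j \<bullet> y \<le> 1 \<longleftrightarrow> (1 - i \<bullet> y) / (i \<bullet> e) \<le> (1 - j \<bullet> y) / (j \<bullet> e)"
proof -
  define a b where "a = i \<bullet> e" and "b = j \<bullet> e"
  have ab: "0 < b" "b < a" using assms by (auto simp: a_def b_def)
  have p: "1 / b - 1 / a > 0" using ab by (simp add: field_simps)
  have "bisector e i j \<bullet> y = ((j \<bullet> y) / b - (i \<bullet> y) / a) / (1 / b - 1 / a)"
    by (simp add: bisector_def inner_diff_left a_def b_def)
  then have "bisector e i j \<bullet> y \<le> 1 \<longleftrightarrow> (j \<bullet> y) / b - (i \<bullet> y) / a \<le> 1 / b - 1 / a"
    using p by (simp only: pos_divide_le_eq[OF p] mult_1)
  then show ?thesis unfolding a_def[symmetric] b_def[symmetric] diff_divide_distrib by linarith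
qed

lemma bisector_lower:
  assumes "0 < j \<bullet> e" "j \<bullet> e < i \<bullet> e" "bisector e i j \<bullet> y \<le> 1" "i \<bullet> y \<le> 1"
  shows "j \<bullet> y \<le> 1"
proof -
  have "0 \<le> (1 - i \<bullet> y) / (i \<bullet> e)" using assms by auto
  also have "\<dots> \<le> (1 - j \<bullet> y) / (j \<bullet> e)" using bisector_le_iff assms by blast
  finally show ?thesis using assms(1) by (simp add: zero_le_divide_iff)
qed

lemma bisector_upper:
  assumes "0 < j \<bullet> e" "j \<bullet> e < i \<bullet> e" "\<not> bisector e i j \<bullet> y \<le> 1" "j \<bullet> y \<le> 1"
  shows "i \<bullet> y \<le> 1"
proof -
  have "0 \<le> (1 - j \<bullet> y) / (j \<bullet> e)" using assms by auto
  also have "\<dots> \<le> (1 - i \<bullet> y) / (i \<bullet> e)" using bisector_le_iff[of j e i y] assms by linarith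
  finally show ?thesis using assms(1,2) by (simp add: zero_le_divide_iff)
qed

text \<open>Inside the bisecting half-space the facet \<open>i\<close> hides \<open>j\<close>, outside it
  \<open>j\<close> hides \<open>i\<close>. So the roof without \<open>i\<close> is the union of
  the full roof and of its own part in the half-space, and these two meet in the part without
  \<open>j\<close>. Thus the full roof is expressed by three roofs with one facet less, two of
  them over a cylinder narrowed by the bisector.\<close>
lemma bisector_exchange:
  assumes U: "subspace U" "e \<in> U" "e \<noteq> 0" and f: "valuation_on U f"
    and b: "prism_base U e A" and fin: "finite S" "finite B"
    and ij: "i \<in> S" "j \<in> S" "0 < j \<bullet> e" "j \<bullet> e < i \<bullet> e" and B: "n \<in> B" "n \<bullet> e < 0"
  shows "f (halfs U (A \<union> (S - {i}) \<union> B)) + f (halfs U (insert (bisector e i j) A \<union> (S - {j}) \<union> B))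
       = f (halfs U (A \<union> S \<union> B)) + f (halfs U (insert (bisector e i j) A \<union> (S - {i}) \<union> B))"
proof (rule valuation_on_halfs[OF U(1) f])
  let ?m = "bisector e i j"
  have "i \<noteq> j" using ij less_irrefl by metis
  show "bounded (halfs U (A \<union> (S - {i}) \<union> B))"
    by (rule prism_base_bounded[OF b U ij(3) B(2)]) (use ij B \<open>i \<noteq> j\<close> in auto)
  show "halfs U (A \<union> S \<union> B) \<union> halfs U (insert ?m A \<union> (S - {i}) \<union> B) = halfs U (A \<union> (S - {i}) \<union> B)"
  proof (intro equalityI subsetI)
    fix y assume y: "y \<in> halfs U (A \<union> (S - {i}) \<union> B)"
    show "y \<in> halfs U (A \<union> S \<union> B) \<union> halfs U (insert ?m A \<union> (S - {i}) \<union> B)"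
    proof (cases "?m \<bullet> y \<le> 1")
      case True then show ?thesis using y by (auto simp: halfs_def)
    next
      case False
      have "j \<bullet> y \<le> 1" using y ij \<open>i \<noteq> j\<close> by (auto simp: halfs_def)
      then have "i \<bullet> y \<le> 1" using bisector_upper[OF ij(3,4) False] by auto
      then show ?thesis using y by (auto simp: halfs_def)
    qed
  qed (auto simp: halfs_def)
  show "halfs U (A \<union> S \<union> B) \<inter> halfs U (insert ?m A \<union> (S - {i}) \<union> B)
      = halfs U (insert ?m A \<union> (S - {j}) \<union> B)"
  proof (intro equalityI subsetI)
    fix y assume y: "y \<in> halfs U (insert ?m A \<union> (S - {j}) \<union> B)"
    then have "j \<bullet> y \<le> 1" using bisector_lower[OF ij(3,4), of y] ij \<open>i \<noteq> j\<close> by (auto simp: halfs_def)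
    then show "y \<in> halfs U (A \<union> S \<union> B) \<inter> halfs U (insert ?m A \<union> (S - {i}) \<union> B)"
      using y by (auto simp: halfs_def)
  qed (auto simp: halfs_def)
qed (use fin b in \<open>auto simp: prism_base_def\<close>)

text \<open>The exchange relation expresses a quantity with facet set \<open>S\<close> by quantities with
  strictly smaller facet sets over possibly narrower cylinders, so it is enough to know the single
  facets. The function \<open>D\<close> is kept abstract because the relation is applied both to a
  valuation and to the difference of its values on a roof and a translated roof. Injectivity of
  \<open>n \<mapsto> n \<bullet> e\<close> guarantees that no two facets have the same steepness,
  in which case the bisector would not exist.\<close>
lemma top_recursion:
  fixes D :: "'a::euclidean_space set \<Rightarrow> 'a set \<Rightarrow> real"
  assumes rec: "\<And>A S i j. prism_base U e A \<Longrightarrow> A0 \<subseteq> A \<Longrightarrow> S \<subseteq> S0 \<Longrightarrow> i \<in> S \<Longrightarrow> j \<in> S \<Longrightarrow>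
        j \<bullet> e < i \<bullet> e \<Longrightarrow>
        D A (S - {i}) + D (insert (bisector e i j) A) (S - {j}) = D A S + D (insert (bisector e i j) A) (S - {i})"
    and single: "\<And>A n. prism_base U e A \<Longrightarrow> A0 \<subseteq> A \<Longrightarrow> n \<in> S0 \<Longrightarrow> D A {n} = 0"
    and S0: "finite S0" "inj_on (\<lambda>n. n \<bullet> e) S0" "\<And>n. n \<in> S0 \<Longrightarrow> 0 < n \<bullet> e"
    and A: "prism_base U e A" "A0 \<subseteq> A" and S: "S \<subseteq> S0" "S \<noteq> {}"
  shows "D A S = 0"
  using A S
proof (induction "card S" arbitrary: A S rule: less_induct)
  case less
  have finS: "finite S" using less.prems S0 finite_subset by blast
  show ?case
  proof (cases "card S = 1")
    case True
    then obtain n where "S = {n}" by (rule card_1_singletonE)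
    then show ?thesis using single[OF less.prems(1,2), of n] less.prems(3) by simp
  next
    case False
    obtain a where a: "a \<in> S" using less.prems by auto
    have "S \<noteq> {a}" using False by auto
    then obtain b where b: "b \<in> S" "a \<noteq> b" using a by blast
    then have "a \<bullet> e \<noteq> b \<bullet> e" using S0(2) a less.prems unfolding inj_on_def by blast
    then obtain i j where ij: "i \<in> S" "j \<in> S" "j \<bullet> e < i \<bullet> e"
      using a b that[of b a] that[of a b] by linarith
    have "i \<noteq> j" using ij less_irrefl by metis
    have b': "prism_base U e (insert (bisector e i j) A)"
    proof (rule prism_base_insert[OF less.prems(1) bisector_orth])
      have "0 < i \<bullet> e" "0 < j \<bullet> e"
        by (rule S0(3)[OF subsetD[OF less.prems(3)]], rule ij)+
      then show "i \<bullet> e \<noteq> 0" "j \<bullet> e \<noteq> 0" by simp_all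
    qed
    have c: "card (S - {i}) < card S" "card (S - {j}) < card S"
      by (rule card_Diff1_less[OF finS ij(1)], rule card_Diff1_less[OF finS ij(2)])
    have sub: "S - {i} \<subseteq> S0" "S - {i} \<noteq> {}" "S - {j} \<subseteq> S0" "S - {j} \<noteq> {}"
      using less.prems ij \<open>i \<noteq> j\<close> by auto
    have A': "A0 \<subseteq> insert (bisector e i j) A" using less.prems by auto
    have "D A (S - {i}) = 0"
      by (rule less.hyps[OF c(1) less.prems(1,2) sub(1,2)])
    moreover have "D (insert (bisector e i j) A) (S - {i}) = 0"
      by (rule less.hyps[OF c(1) b' A' sub(1,2)])
    moreover have "D (insert (bisector e i j) A) (S - {j}) = 0"
      by (rule less.hyps[OF c(2) b' A' sub(3,4)])
    ultimately show ?thesis using rec[OF less.prems(1,2,3) ij] by linarith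
  qed
qed

section \<open>Roofs over a cylinder\<close>

text \<open>A prism here is a cylinder cut off by two parallel planes, which need not be orthogonal to its
  axis.\<close>
definition vanishes_on_prisms :: "'a::euclidean_space set \<Rightarrow> ('a set \<Rightarrow> real) \<Rightarrow> bool" where
  "vanishes_on_prisms U f \<longleftrightarrow> (\<forall>e A n c. e \<in> U \<longrightarrow> e \<noteq> 0 \<longrightarrow> prism_base U e A \<longrightarrow> 0 < n \<bullet> e \<longrightarrow> 0 < c \<longrightarrow>
      f (halfs U (A \<union> {n, - (c *\<^sub>R n)})) = 0)"

lemma vanishes_on_prismsD:
  assumes "vanishes_on_prisms U f" "e \<in> U" "e \<noteq> 0" "prism_base U e A" "0 < n \<bullet> e" "0 < c" "m = - (c *\<^sub>R n)"
  shows "f (halfs U (A \<union> {n, m})) = 0"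
  using assms unfolding vanishes_on_prisms_def by blast

text \<open>A floor at height \<open>-M\<close>, in the sense of \<open>e \<bullet> y = -M\<close>, is deep
  if inside \<open>Z\<close> it lies entirely below the plane \<open>n \<bullet> y = -1\<close>,
  the mirror image of the facet \<open>n \<bullet> y = 1\<close>.\<close>
definition deep :: "'a::euclidean_space set \<Rightarrow> 'a \<Rightarrow> 'a \<Rightarrow> real \<Rightarrow> bool" where
  "deep Z e n M \<longleftrightarrow> 0 < M \<and> (\<forall>y\<in>Z. - (n \<bullet> y) \<le> 1 \<longrightarrow> - (e \<bullet> y) \<le> M)"

definition floor_normal :: "'a::euclidean_space \<Rightarrow> real \<Rightarrow> 'a" where
  "floor_normal e M = - ((1 / M) *\<^sub>R e)"

lemma floor_normal_iff: "0 < M \<Longrightarrow> floor_normal e M \<bullet> y \<le> 1 \<longleftrightarrow> - (e \<bullet> y) \<le> M"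
  unfolding floor_normal_def inner_minus_left inner_scaleR_left
  by (simp add: minus_divide_left pos_divide_le_eq del: minus_divide_left[symmetric])

lemma floor_normal_neg: "0 < M \<Longrightarrow> e \<noteq> 0 \<Longrightarrow> floor_normal e M \<bullet> e < 0"
  by (simp add: floor_normal_def)

lemma deep_mono: "deep Z e n M \<Longrightarrow> Z' \<subseteq> Z \<Longrightarrow> deep Z' e n M"
  by (auto simp: deep_def)

lemma deep_eventually:
  assumes "prism_base U e A" "subspace U" "e \<in> U" "e \<noteq> 0" "0 < n \<bullet> e"
  shows "eventually (\<lambda>M. deep (halfs U A) e n M) at_top"
proof -
  have "prism_base U (-e) A" using assms(1) by (simp add: prism_base_def)
  from prism_base_bounded_above[OF this assms(2), of "-n"] obtain C
    where C: "C > 0" "\<And>y. y \<in> halfs U A \<Longrightarrow> (-n) \<bullet> y \<le> 1 \<Longrightarrow> (-e) \<bullet> y \<le> C"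
    using assms by (auto simp: subspace_neg)
  have "deep (halfs U A) e n M" if "M \<ge> C" for M
    using C that by (fastforce simp: deep_def)
  then show ?thesis by (auto simp: eventually_at_top_linorder)
qed

text \<open>Moving the facet away from the origin, parallel to itself, adds a slab between two parallel
  planes, that is, the difference of two prisms.\<close>
lemma roof_halfs_scale_le:
  assumes U: "subspace U" "e \<in> U" "e \<noteq> 0" and f: "valuation_on U f" "vanishes_on_prisms U f"
    and b: "prism_base U e A" and n: "0 < n \<bullet> e" "0 < c" "c \<le> 1" and M: "deep (halfs U A) e n M"
  shows "f (halfs U (A \<union> {n, floor_normal e M})) = f (halfs U (A \<union> {c *\<^sub>R n, floor_normal e M}))"
proof -
  have M0: "0 < M" using M by (simp add: deep_def)
  have cn: "0 < (c *\<^sub>R n) \<bullet> e" using n by simp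
  have le: "c * (n \<bullet> y) \<le> 1" if "n \<bullet> y \<le> 1" for y
  proof (cases "n \<bullet> y \<ge> 0")
    case True
    then have "c * (n \<bullet> y) \<le> 1 * (n \<bullet> y)" using n by (intro mult_right_mono) auto
    then show ?thesis using that by simp
  next
    case False
    then have "c * (n \<bullet> y) \<le> 0" using n by (intro mult_nonneg_nonpos) auto
    then show ?thesis by simp
  qed
  \<comment> \<open>Both roofs contain the plane \<open>n \<bullet> y = -1\<close> in their cylinder because the
    floor is deep, so cutting there separates the moved facet from the floor.\<close>
  have "f (halfs U (A \<union> {c *\<^sub>R n, floor_normal e M})) + f (halfs U (A \<union> {n, -n}))
      = f (halfs U (A \<union> {c *\<^sub>R n, -n})) + f (halfs U (A \<union> {n, floor_normal e M}))"
  proof (rule valuation_on_halfs[OF U(1) f(1)])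
    show "bounded (halfs U (A \<union> {c *\<^sub>R n, floor_normal e M}))"
      by (rule prism_base_bounded[OF b U cn floor_normal_neg[OF M0 U(3)]]) auto
    show "halfs U (A \<union> {c *\<^sub>R n, -n}) \<union> halfs U (A \<union> {n, floor_normal e M}) = halfs U (A \<union> {c *\<^sub>R n, floor_normal e M})"
      using M le by (auto simp: halfs_def deep_def floor_normal_iff[OF M0])
    show "halfs U (A \<union> {c *\<^sub>R n, -n}) \<inter> halfs U (A \<union> {n, floor_normal e M}) = halfs U (A \<union> {n, -n})"
      using M le by (auto simp: halfs_def deep_def floor_normal_iff[OF M0])
  qed (use b in \<open>auto simp: prism_base_def\<close>)
  moreover have "f (halfs U (A \<union> {n, -n})) = 0"
    by (rule vanishes_on_prismsD[OF f(2) U(2,3) b n(1), of 1]) auto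
  moreover have "f (halfs U (A \<union> {c *\<^sub>R n, -n})) = 0"
    by (rule vanishes_on_prismsD[OF f(2) U(2,3) b cn, of "1/c"]) (use n in auto)
  ultimately show ?thesis by simp
qed

lemma roof_halfs_scale:
  assumes U: "subspace U" "e \<in> U" "e \<noteq> 0" and f: "valuation_on U f" "vanishes_on_prisms U f"
    and b: "prism_base U e A" and n: "0 < n \<bullet> e" "0 < c"
    and M: "deep (halfs U A) e n M" "deep (halfs U A) e (c *\<^sub>R n) M"
  shows "f (halfs U (A \<union> {n, floor_normal e M})) = f (halfs U (A \<union> {c *\<^sub>R n, floor_normal e M}))"
proof (cases "c \<le> 1")
  case True
  then show ?thesis using roof_halfs_scale_le[OF U f b n True M(1)] by simp
next
  case False
  have "f (halfs U (A \<union> {c *\<^sub>R n, floor_normal e M})) = f (halfs U (A \<union> {(1/c) *\<^sub>R (c *\<^sub>R n), floor_normal e M}))"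
    by (rule roof_halfs_scale_le[OF U f b _ _ _ M(2)]) (use n False in auto)
  then show ?thesis using n by simp
qed

text \<open>Lowering a deep floor changes the roof by the difference of two prisms with horizontal ends; the
  auxiliary horizontal lid \<open>e \<bullet> y = L\<close> above the facet closes these prisms.\<close>
lemma roof_halfs_floor_le:
  assumes U: "subspace U" "e \<in> U" "e \<noteq> 0" and f: "valuation_on U f" "vanishes_on_prisms U f"
    and b: "prism_base U e A" and n: "0 < n \<bullet> e"
    and M: "deep (halfs U A) e n M" "deep (halfs U A) e n M'" "M \<le> M'"
  shows "f (halfs U (A \<union> {n, floor_normal e M})) = f (halfs U (A \<union> {n, floor_normal e M'}))"
proof -
  have M0: "0 < M" "0 < M'" using M by (auto simp: deep_def)
  obtain L where L: "L > 0" "\<And>y. y \<in> halfs U A \<Longrightarrow> n \<bullet> y \<le> 1 \<Longrightarrow> e \<bullet> y \<le> L"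
    using prism_base_bounded_above[OF b U n] by blast
  let ?t = "(1 / L) *\<^sub>R e"
  have t: "0 < ?t \<bullet> e" using L U by simp
  have tle: "?t \<bullet> y \<le> 1 \<longleftrightarrow> e \<bullet> y \<le> L"
    "e \<bullet> y / L \<le> 1 \<longleftrightarrow> e \<bullet> y \<le> L" for y
    using L(1) by (simp_all add: pos_divide_le_eq)
  \<comment> \<open>Below the higher of the two floors the facet is no constraint.\<close>
  have far: "n \<bullet> y \<le> 1" if "y \<in> halfs U A" "\<not> - (e \<bullet> y) \<le> M" for y
    using that M(1) unfolding deep_def by force
  have "f (halfs U (A \<union> {?t, floor_normal e M'})) + f (halfs U (A \<union> {n, floor_normal e M}))
      = f (halfs U (A \<union> {?t, floor_normal e M})) + f (halfs U (A \<union> {n, floor_normal e M'}))"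
  proof (rule valuation_on_halfs[OF U(1) f(1)])
    show "bounded (halfs U (A \<union> {?t, floor_normal e M'}))"
      by (rule prism_base_bounded[OF b U t floor_normal_neg[OF M0(2) U(3)]]) auto
    show "halfs U (A \<union> {?t, floor_normal e M}) \<union> halfs U (A \<union> {n, floor_normal e M'}) = halfs U (A \<union> {?t, floor_normal e M'})"
    proof (intro equalityI subsetI)
      fix y assume y: "y \<in> halfs U (A \<union> {?t, floor_normal e M'})"
      then have "y \<in> halfs U A" by (auto simp: halfs_def)
      then show "y \<in> halfs U (A \<union> {?t, floor_normal e M}) \<union> halfs U (A \<union> {n, floor_normal e M'})"
        using far[of y] y by (auto simp: halfs_def floor_normal_iff[OF M0(1)])
    next
      fix y assume y: "y \<in> halfs U (A \<union> {?t, floor_normal e M}) \<union> halfs U (A \<union> {n, floor_normal e M'})"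
      then have A: "y \<in> halfs U A" by (auto simp: halfs_def)
      show "y \<in> halfs U (A \<union> {?t, floor_normal e M'})"
        using y L(2)[OF A] A M(3)
        unfolding halfs_def by (auto simp: floor_normal_iff[OF M0(1)] floor_normal_iff[OF M0(2)] tle)
    qed
    show "halfs U (A \<union> {?t, floor_normal e M}) \<inter> halfs U (A \<union> {n, floor_normal e M'}) = halfs U (A \<union> {n, floor_normal e M})"
    proof (intro equalityI subsetI)
      fix y assume y: "y \<in> halfs U (A \<union> {n, floor_normal e M})"
      then have A: "y \<in> halfs U A" by (auto simp: halfs_def)
      show "y \<in> halfs U (A \<union> {?t, floor_normal e M}) \<inter> halfs U (A \<union> {n, floor_normal e M'})"
        using y L(2)[OF A] A M(3)
        unfolding halfs_def by (auto simp: floor_normal_iff[OF M0(1)] floor_normal_iff[OF M0(2)] tle)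
    qed (auto simp: halfs_def)
  qed (use b in \<open>auto simp: prism_base_def\<close>)
  moreover have "f (halfs U (A \<union> {?t, floor_normal e M})) = 0"
    by (rule vanishes_on_prismsD[OF f(2) U(2,3) b t, of "L/M"]) (use L M0 in \<open>auto simp: floor_normal_def\<close>)
  moreover have "f (halfs U (A \<union> {?t, floor_normal e M'})) = 0"
    by (rule vanishes_on_prismsD[OF f(2) U(2,3) b t, of "L/M'"]) (use L M0 in \<open>auto simp: floor_normal_def\<close>)
  ultimately show ?thesis by simp
qed

lemma roof_halfs_floor:
  assumes U: "subspace U" "e \<in> U" "e \<noteq> 0" and f: "valuation_on U f" "vanishes_on_prisms U f"
    and b: "prism_base U e A" and n: "0 < n \<bullet> e"
    and M: "deep (halfs U A) e n M" "deep (halfs U A) e n M'"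
  shows "f (halfs U (A \<union> {n, floor_normal e M})) = f (halfs U (A \<union> {n, floor_normal e M'}))"
  using roof_halfs_floor_le[OF U f b n M] roof_halfs_floor_le[OF U f b n M(2,1)] by linarith

text \<open>The cross-section through the origin in which the bases of cylinders live.\<close>
definition perp :: "'a::euclidean_space set \<Rightarrow> 'a \<Rightarrow> 'a set" where
  "perp U e = U \<inter> {y. y \<bullet> e = 0}"

definition cylinder :: "'a::euclidean_space \<Rightarrow> 'a set \<Rightarrow> 'a set" where
  "cylinder e K = {x + t *\<^sub>R e | x t. x \<in> K}"

lemma subspace_perp: "subspace U \<Longrightarrow> subspace (perp U e)"
  unfolding perp_def subspace_def by (auto simp: inner_add_left)

lemma cylinder_halfs:
  assumes "subspace U" "e \<in> U" "e \<noteq> 0" "\<And>a. a \<in> A \<Longrightarrow> a \<bullet> e = 0"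
  shows "cylinder e (halfs (perp U e) A) = halfs U A"
proof (intro equalityI subsetI)
  fix y assume "y \<in> cylinder e (halfs (perp U e) A)"
  then show "y \<in> halfs U A" using assms
    by (auto simp: cylinder_def halfs_def perp_def inner_add_right subspace_add subspace_scale)
next
  fix y assume y: "y \<in> halfs U A"
  let ?t = "(y \<bullet> e) / (e \<bullet> e)"
  have "y - ?t *\<^sub>R e \<in> halfs (perp U e) A"
    using assms y by (auto simp: halfs_def perp_def subspace_diff subspace_scale inner_diff_right inner_diff_left)
  then show "y \<in> cylinder e (halfs (perp U e) A)" unfolding cylinder_def
    by (intro CollectI exI[of _ "y - ?t *\<^sub>R e"] exI[of _ ?t]) auto
qed

lemma prism_baseI:
  assumes "finite A" "\<And>a. a \<in> A \<Longrightarrow> a \<bullet> e = 0" "bounded (halfs (perp U e) A)"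
  shows "prism_base U e A"
proof -
  have "halfs U A \<inter> {y. y \<bullet> e = 0} = halfs (perp U e) A" by (auto simp: halfs_def perp_def)
  then show ?thesis using assms by (auto simp: prism_base_def)
qed

lemma polytope_o_perp_cylinder:
  assumes "subspace U" "e \<in> U" "e \<noteq> 0" "polytope_o (perp U e) K"
  obtains A where "prism_base U e A" "halfs U A = cylinder e K" "K = halfs (perp U e) A"
proof -
  obtain A where A: "finite A" "A \<subseteq> perp U e" "K = halfs (perp U e) A"
    using polytope_o_imp_halfs[OF subspace_perp[OF assms(1)] assms(4)] by blast
  have o: "a \<bullet> e = 0" if "a \<in> A" for a using A(2) that by (auto simp: perp_def)
  show ?thesis
    using that[of A] prism_baseI[OF A(1) o] cylinder_halfs[OF assms(1-3) o] A(3) polytope_o_bounded[OF assms(4)] by simp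
qed

lemma prism_base_perp:
  assumes "subspace U" "prism_base U e A"
  shows "polytope_o (perp U e) (halfs (perp U e) A)"
proof (rule polytope_o_halfs[OF subspace_perp[OF assms(1)]])
  have "halfs U A \<inter> {y. y \<bullet> e = 0} = halfs (perp U e) A" by (auto simp: halfs_def perp_def)
  then show "bounded (halfs (perp U e) A)" using assms by (auto simp: prism_base_def)
qed (use assms in \<open>auto simp: prism_base_def\<close>)

text \<open>The cylinder circumscribed about a polytope in direction \<open>e\<close> is the cylinder over
  its orthogonal projection.\<close>
lemma shadow_cylinder:
  assumes U: "subspace U" "e \<in> U" "e \<noteq> 0" and P: "polytope_o U P"
  obtains A where "prism_base U e A" "halfs U A = cylinder e P"
proof -
  define p where "p = (\<lambda>y. y - ((y \<bullet> e) / (e \<bullet> e)) *\<^sub>R e)"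
  have lin: "linear p" unfolding p_def
    by (rule linearI) (simp_all add: algebra_simps inner_add_left add_divide_distrib)
  have fix_p: "p y = y" if "y \<bullet> e = 0" for y using that by (simp add: p_def)
  obtain d where d: "d > 0" "ball 0 d \<inter> U \<subseteq> P" "P \<subseteq> U" "polytope P" using P by (auto simp: polytope_o_def)
  have "polytope_o (perp U e) (p ` P)"
    unfolding polytope_o_def
  proof (intro conjI)
    show "polytope (p ` P)" using polytope_linear_image[OF lin d(4)] .
    show "p ` P \<subseteq> perp U e" using d(3) U
      by (auto simp: perp_def p_def subspace_diff subspace_scale inner_diff_left)
    show "\<exists>d>0. ball 0 d \<inter> perp U e \<subseteq> p ` P"
    proof (intro exI conjI subsetI)
      fix y assume "y \<in> ball 0 d \<inter> perp U e"
      then have y: "y \<in> P" "p y = y" using d(2) fix_p by (auto simp: perp_def)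
      show "y \<in> p ` P" using imageI[OF y(1), of p] unfolding y(2) .
    qed (use d in auto)
  qed
  then obtain A where A: "prism_base U e A" "halfs U A = cylinder e (p ` P)"
    by (rule polytope_o_perp_cylinder[OF U])
  have "cylinder e (p ` P) = cylinder e P"
  proof (intro equalityI subsetI)
    fix y assume "y \<in> cylinder e (p ` P)"
    then obtain q t where q: "q \<in> P" "y = p q + t *\<^sub>R e" by (auto simp: cylinder_def)
    have "y = q + (t - (q \<bullet> e) / (e \<bullet> e)) *\<^sub>R e" unfolding q(2) p_def by (simp add: algebra_simps)
    then show "y \<in> cylinder e P" using q by (auto simp: cylinder_def)
  next
    fix y assume "y \<in> cylinder e P"
    then obtain q t where q: "q \<in> P" "y = q + t *\<^sub>R e" by (auto simp: cylinder_def)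
    have "y = p q + (t + (q \<bullet> e) / (e \<bullet> e)) *\<^sub>R e" unfolding q(2) p_def by (simp add: algebra_simps)
    then show "y \<in> cylinder e (p ` P)" using q by (auto simp: cylinder_def)
  qed
  then show ?thesis using that A by simp
qed

text \<open>Otherwise the ray in direction \<open>e\<close> would stay inside the body.\<close>
lemma upper_facet_exists:
  assumes U: "subspace U" "e \<in> U" "e \<noteq> 0" and P: "bounded (halfs U N)"
  obtains n where "n \<in> N" "0 < n \<bullet> e"
proof (rule ccontr)
  assume "\<not> thesis"
  then have "\<forall>n\<in>N. \<not> 0 < n \<bullet> e" using that by blast
  then have le: "n \<bullet> e \<le> 0" if "n \<in> N" for n using that by force
  obtain R where R: "\<And>y. y \<in> halfs U N \<Longrightarrow> norm y \<le> R" using P by (auto simp: bounded_iff)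
  let ?t = "(\<bar>R\<bar> + 1) / norm e"
  have t: "?t \<ge> 0" by simp
  have "?t *\<^sub>R e \<in> halfs U N" unfolding halfs_def
  proof (intro CollectI conjI ballI)
    show "?t *\<^sub>R e \<in> U" using U by (simp add: subspace_scale)
    fix n assume "n \<in> N"
    then have "?t * (n \<bullet> e) \<le> 0" using le t by (intro mult_nonneg_nonpos) auto
    then show "n \<bullet> (?t *\<^sub>R e) \<le> 1" by simp
  qed
  then have "norm (?t *\<^sub>R e) \<le> R" by (rule R)
  moreover have "norm (?t *\<^sub>R e) = \<bar>R\<bar> + 1" using U by simp
  ultimately show False by linarith
qed

text \<open>The upper roof of \<open>P\<close> extends \<open>P\<close> down to a floor below
  \<open>P\<close>, and the lower roof extends it up to a ceiling above \<open>P\<close>; both lie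
  in the cylinder circumscribed about \<open>P\<close>. They meet in \<open>P\<close> and together
  fill a box-like prism, which has value zero.\<close>
lemma split_into_roofs:
  assumes U: "subspace U" "e \<in> U" "e \<noteq> 0" and f: "valuation_on U f" "vanishes_on_prisms U f"
    and N: "finite N" "bounded (halfs U N)"
    and A: "prism_base U e A" "halfs U A = cylinder e (halfs U N)"
    and M: "0 < M" "\<And>y. y \<in> halfs U N \<Longrightarrow> \<bar>e \<bullet> y\<bar> \<le> M"
  shows "f (halfs U N) = f (halfs U (A \<union> {n\<in>N. 0 < n \<bullet> e} \<union> {floor_normal e M}))
       + f (halfs U (A \<union> {n\<in>N. 0 < n \<bullet> (-e)} \<union> {floor_normal (-e) M}))"
proof -
  let ?T = "{n\<in>N. 0 < n \<bullet> e}" and ?B = "{n\<in>N. 0 < n \<bullet> (-e)}"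
  have NA: "halfs U N \<subseteq> halfs U A"
    unfolding A(2) by (force simp: cylinder_def intro: exI[of _ 0])
  have t: "0 < floor_normal (-e) M \<bullet> e" using floor_normal_neg[OF M(1), of "-e"] U by simp
  have "f (halfs U (A \<union> {floor_normal (-e) M, floor_normal e M})) + f (halfs U (A \<union> ?T \<union> ?B \<union> {floor_normal e M, floor_normal (-e) M}))
      = f (halfs U (A \<union> ?T \<union> {floor_normal e M})) + f (halfs U (A \<union> ?B \<union> {floor_normal (-e) M}))"
  proof (rule valuation_on_halfs[OF U(1) f(1)])
    show "bounded (halfs U (A \<union> {floor_normal (-e) M, floor_normal e M}))"
      by (rule prism_base_bounded[OF A(1) U t floor_normal_neg[OF M(1) U(3)]]) auto
    show "halfs U (A \<union> ?T \<union> {floor_normal e M}) \<inter> halfs U (A \<union> ?B \<union> {floor_normal (-e) M}) =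
          halfs U (A \<union> ?T \<union> ?B \<union> {floor_normal e M, floor_normal (-e) M})" by (auto simp: halfs_def)
    show "halfs U (A \<union> ?T \<union> {floor_normal e M}) \<union> halfs U (A \<union> ?B \<union> {floor_normal (-e) M}) = halfs U (A \<union> {floor_normal (-e) M, floor_normal e M})"
    proof (intro equalityI subsetI)
      fix y assume y: "y \<in> halfs U (A \<union> {floor_normal (-e) M, floor_normal e M})"
      then have "y \<in> cylinder e (halfs U N)" using A(2) by (auto simp: halfs_def)
      then obtain q t where q: "q \<in> halfs U N" "y = q + t *\<^sub>R e" by (auto simp: cylinder_def)
      show "y \<in> halfs U (A \<union> ?T \<union> {floor_normal e M}) \<union> halfs U (A \<union> ?B \<union> {floor_normal (-e) M})"
      proof (cases "t \<ge> 0")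
        case True
        have "n \<bullet> y \<le> 1" if "n \<in> ?B" for n
        proof -
          have "t * (n \<bullet> e) \<le> 0" using that True by (intro mult_nonneg_nonpos) auto
          moreover have "n \<bullet> q \<le> 1" using q that by (auto simp: halfs_def)
          ultimately show ?thesis using q by (simp add: inner_add_right)
        qed
        then show ?thesis using y by (auto simp: halfs_def)
      next
        case False
        have "n \<bullet> y \<le> 1" if "n \<in> ?T" for n
        proof -
          have "t * (n \<bullet> e) \<le> 0" using that False by (intro mult_nonpos_nonneg) auto
          moreover have "n \<bullet> q \<le> 1" using q that by (auto simp: halfs_def)
          ultimately show ?thesis using q by (simp add: inner_add_right)
        qed
        then show ?thesis using y by (auto simp: halfs_def)
      qed
    next
      fix y assume y: "y \<in> halfs U (A \<union> ?T \<union> {floor_normal e M}) \<union> halfs U (A \<union> ?B \<union> {floor_normal (-e) M})"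
      have yA: "y \<in> halfs U A" using y by (auto simp: halfs_def)
      then obtain q t where q: "q \<in> halfs U N" "y = q + t *\<^sub>R e" unfolding A(2) by (auto simp: cylinder_def)
      have ey: "e \<bullet> y = e \<bullet> q + t * (e \<bullet> e)" using q by (simp add: inner_add_right)
      show "y \<in> halfs U (A \<union> {floor_normal (-e) M, floor_normal e M})"
        using y
      proof
        assume y: "y \<in> halfs U (A \<union> ?T \<union> {floor_normal e M})"
        have "e \<bullet> y \<le> M"
        proof (cases "t \<le> 0")
          case True
          then have "t * (e \<bullet> e) \<le> 0" by (intro mult_nonpos_nonneg) auto
          then show ?thesis using ey M(2)[OF q(1)] by linarith
        next
          case False
          have "n \<bullet> y \<le> 1" if "n \<in> N" for n
          proof (cases "0 < n \<bullet> e")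
            case True then show ?thesis using y that by (auto simp: halfs_def)
          next
            case nF: False
            have "t * (n \<bullet> e) \<le> 0" using nF False by (intro mult_nonneg_nonpos) auto
            moreover have "n \<bullet> q \<le> 1" using q that by (auto simp: halfs_def)
            ultimately show ?thesis using q by (simp add: inner_add_right)
          qed
          then have "y \<in> halfs U N" using yA by (auto simp: halfs_def)
          from M(2)[OF this] show ?thesis by linarith
        qed
        then show ?thesis using y by (auto simp: halfs_def floor_normal_iff[OF M(1)])
      next
        assume y: "y \<in> halfs U (A \<union> ?B \<union> {floor_normal (-e) M})"
        have "- (e \<bullet> y) \<le> M"
        proof (cases "t \<ge> 0")
          case True
          then have "t * (e \<bullet> e) \<ge> 0" by auto
          then show ?thesis using ey M(2)[OF q(1)] by linarith
        next
          case False
          have "n \<bullet> y \<le> 1" if "n \<in> N" for n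
          proof (cases "0 < n \<bullet> (-e)")
            case True then show ?thesis using y that by (auto simp: halfs_def)
          next
            case nF: False
            have "t * (n \<bullet> e) \<le> 0" using nF False by (intro mult_nonpos_nonneg) auto
            moreover have "n \<bullet> q \<le> 1" using q that by (auto simp: halfs_def)
            ultimately show ?thesis using q by (simp add: inner_add_right)
          qed
          then have "y \<in> halfs U N" using yA by (auto simp: halfs_def)
          from M(2)[OF this] show ?thesis by linarith
        qed
        then show ?thesis using y by (auto simp: halfs_def floor_normal_iff[OF M(1)])
      qed
    qed
  qed (use A N in \<open>auto simp: prism_base_def\<close>)
  moreover have "f (halfs U (A \<union> {floor_normal (-e) M, floor_normal e M})) = 0"
    by (rule vanishes_on_prismsD[OF f(2) U(2,3) A(1) t, of 1]) (auto simp: floor_normal_def)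
  moreover have "halfs U (A \<union> ?T \<union> ?B \<union> {floor_normal e M, floor_normal (-e) M}) = halfs U N"
  proof (intro equalityI subsetI)
    fix y assume y: "y \<in> halfs U N"
    then show "y \<in> halfs U (A \<union> ?T \<union> ?B \<union> {floor_normal e M, floor_normal (-e) M})"
      using M(2)[OF y] subsetD[OF NA y] by (auto simp: halfs_def floor_normal_iff[OF M(1)])
  next
    fix y assume y: "y \<in> halfs U (A \<union> ?T \<union> ?B \<union> {floor_normal e M, floor_normal (-e) M})"
    then have "y \<in> cylinder e (halfs U N)" using A(2) by (auto simp: halfs_def)
    then obtain q t where q: "q \<in> halfs U N" "y = q + t *\<^sub>R e" by (auto simp: cylinder_def)
    have "n \<bullet> y \<le> 1" if "n \<in> N" for n
    proof (cases "n \<bullet> e = 0")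
      case True
      then show ?thesis using q that by (auto simp: halfs_def inner_add_right)
    next
      case False
      then have "n \<in> ?T \<union> ?B" using that by auto
      then show ?thesis using y unfolding halfs_def by blast
    qed
    then show "y \<in> halfs U N" using y by (auto simp: halfs_def)
  qed
  ultimately show ?thesis by simp
qed

section \<open>Translation invariance\<close>

text \<open>Translating the half-space \<open>n \<bullet> y \<le> 1\<close> by \<open>v\<close> gives
  \<open>n \<bullet> y \<le> 1 + n \<bullet> v\<close>, which is renormalised.\<close>
definition translated_normal :: "'a::euclidean_space \<Rightarrow> 'a \<Rightarrow> 'a" where
  "translated_normal v n = (1 / (1 + n \<bullet> v)) *\<^sub>R n"

lemma translated_normal_halfs:
  assumes "subspace U" "v \<in> U" "\<And>n. n \<in> N \<Longrightarrow> 0 < 1 + n \<bullet> v"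
  shows "halfs U (translated_normal v ` N) = (+) v ` halfs U N"
proof -
  have iff: "translated_normal v n \<bullet> y \<le> 1 \<longleftrightarrow> n \<bullet> (y - v) \<le> 1" if "n \<in> N" for n y
    using assms(3)[OF that] by (simp add: translated_normal_def inner_diff_right pos_divide_le_eq) linarith
  show ?thesis
  proof (intro equalityI subsetI)
    fix y assume "y \<in> halfs U (translated_normal v ` N)"
    then have "y - v \<in> halfs U N" using iff assms by (auto simp: halfs_def subspace_diff)
    then have "v + (y - v) \<in> (+) v ` halfs U N" by (rule imageI)
    then show "y \<in> (+) v ` halfs U N" by simp
  next
    fix y assume "y \<in> (+) v ` halfs U N"
    then obtain x where "x \<in> halfs U N" "y = v + x" by auto
    then show "y \<in> halfs U (translated_normal v ` N)" using iff assms by (auto simp: halfs_def subspace_add)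
  qed
qed

text \<open>The translated body still has the origin in its interior, so every facet still has positive
  distance from it.\<close>
lemma translated_normal_pos:
  assumes "subspace U" "v \<in> U" "polytope_o U ((+) v ` halfs U N)" "n \<in> N"
  shows "0 < 1 + n \<bullet> v"
proof -
  obtain d where d: "d > 0" "ball 0 d \<inter> U \<subseteq> (+) v ` halfs U N" using assms by (auto simp: polytope_o_def)
  define s where "s = d / (2 * (norm v + 1))"
  have nv: "norm v + 1 > 0" using norm_ge_zero[of v] by linarith
  have s: "s > 0" using d nv by (simp add: s_def)
  have "s * norm v \<le> s * (norm v + 1)" using s by (intro mult_left_mono) auto
  also have "\<dots> = d / 2" unfolding s_def using nv by (simp add: field_simps)
  finally have "norm (- (s *\<^sub>R v)) < d" using s d by simp
  then have "- (s *\<^sub>R v) \<in> ball 0 d \<inter> U" using assms by (simp add: subspace_neg subspace_scale)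
  then obtain x where x: "x \<in> halfs U N" "- (s *\<^sub>R v) = v + x" using d(2) by blast
  have "x = - ((1 + s) *\<^sub>R v)" using x(2) by (simp add: algebra_simps eq_neg_iff_add_eq_0)
  then have "- ((1 + s) * (n \<bullet> v)) \<le> 1" using x(1) assms(4) by (auto simp: halfs_def)
  then have "- (n \<bullet> v) \<le> 1 / (1 + s)" using s by (simp add: field_simps)
  also have "\<dots> < 1" using s by simp
  finally show ?thesis by simp
qed

text \<open>Translation along the axis rescales each facet normal and fixes all bisectors, since it
  preserves the vertical planes through intersections of facets. So the difference of the two
  values obeys the recursion of \<open>top_recursion\<close>, and for a single facet it is zero by
  \<open>roof_halfs_scale\<close>.\<close>
lemma translate_roof:
  assumes U: "subspace U" "e \<in> U" "e \<noteq> 0" and f: "valuation_on U f" "vanishes_on_prisms U f"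
    and A: "prism_base U e A" and S0: "finite S0" "S0 \<noteq> {}" "inj_on (\<lambda>n. n \<bullet> e) S0" "\<And>n. n \<in> S0 \<Longrightarrow> 0 < n \<bullet> e"
    and v: "v = t *\<^sub>R e" and sh: "\<And>n. n \<in> S0 \<Longrightarrow> 0 < 1 + n \<bullet> v"
    and M: "\<And>n. n \<in> S0 \<Longrightarrow> deep (halfs U A) e n M" "\<And>n. n \<in> S0 \<Longrightarrow> deep (halfs U A) e (translated_normal v n) M"
  shows "f (halfs U (A \<union> S0 \<union> {floor_normal e M})) = f (halfs U (A \<union> translated_normal v ` S0 \<union> {floor_normal e M}))"
proof -
  let ?D = "\<lambda>A S. f (halfs U (A \<union> S \<union> {floor_normal e M})) - f (halfs U (A \<union> translated_normal v ` S \<union> {floor_normal e M}))"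
  obtain n0 where "n0 \<in> S0" using S0 by blast
  then have M0: "0 < M" using M by (auto simp: deep_def)
  have she: "translated_normal v n \<bullet> e = n \<bullet> e / (1 + t * (n \<bullet> e))" for n by (simp add: translated_normal_def v)
  have sh': "0 < 1 + t * (n \<bullet> e)" if "n \<in> S0" for n using sh[OF that] by (simp add: v)
  \<comment> \<open>In the coordinate \<open>1 / (n \<bullet> e)\<close>, the height of the facet above the
    origin, the translation is an addition; in particular the order of steepness is preserved.\<close>
  have inv: "1 / (translated_normal v n \<bullet> e) = 1 / (n \<bullet> e) + t" if "n \<in> S0" for n
    using sh'[OF that] S0(4)[OF that] by (simp add: she field_simps)
  have pos: "0 < translated_normal v n \<bullet> e" if "n \<in> S0" for n
    using sh'[OF that] S0(4)[OF that] by (simp add: she)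
  have less: "translated_normal v j \<bullet> e < translated_normal v i \<bullet> e" if "i \<in> S0" "j \<in> S0" "j \<bullet> e < i \<bullet> e" for i j
  proof -
    have "1 / (i \<bullet> e) < 1 / (j \<bullet> e)" using that S0(4)[OF that(2)] by (simp add: frac_less2)
    then have "1 / (translated_normal v i \<bullet> e) < 1 / (translated_normal v j \<bullet> e)" using inv that by simp
    then show ?thesis using pos that by (simp add: field_simps)
  qed
  have inj: "inj_on (translated_normal v) S0"
  proof (rule inj_onI)
    fix i j assume ij: "i \<in> S0" "j \<in> S0" "translated_normal v i = translated_normal v j"
    then have "i \<bullet> e = j \<bullet> e" using less[of i j] less[of j i] by force
    then show "i = j" using inj_onD[OF S0(3)] ij by blast
  qed
  have bis: "bisector e (translated_normal v i) (translated_normal v j) = bisector e i j" if "i \<in> S0" "j \<in> S0" for i j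
  proof -
    have *: "(1 / (translated_normal v n \<bullet> e)) *\<^sub>R translated_normal v n = (1 / (n \<bullet> e)) *\<^sub>R n" if "n \<in> S0" for n
      using sh'[OF that] S0(4)[OF that] by (simp add: she) (simp add: translated_normal_def v)
    show ?thesis unfolding bisector_def unfolding *[OF that(1)] *[OF that(2)] unfolding inv[OF that(1)] inv[OF that(2)] by simp
  qed
  have bneg: "floor_normal e M \<bullet> e < 0" using floor_normal_neg[OF M0 U(3)] .
  have "?D A S0 = 0"
  proof (rule top_recursion[where D = ?D and U = U and e = e and ?A0.0 = A and ?S0.0 = S0])
    fix A' S i j
    assume *: "prism_base U e A'" "A \<subseteq> A'" "S \<subseteq> S0" "i \<in> S" "j \<in> S" "j \<bullet> e < i \<bullet> e"
    have ij: "i \<in> S0" "j \<in> S0" using * by auto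
    have fin: "finite S" "finite (translated_normal v ` S)" using finite_subset[OF *(3) S0(1)] by auto
    have im: "translated_normal v ` (S - {k}) = translated_normal v ` S - {translated_normal v k}" if "k \<in> S" for k
      using inj_on_image_set_diff[OF inj, of S "{k}"] * that by auto
    have "f (halfs U (A' \<union> (S - {i}) \<union> {floor_normal e M})) + f (halfs U (insert (bisector e i j) A' \<union> (S - {j}) \<union> {floor_normal e M}))
       = f (halfs U (A' \<union> S \<union> {floor_normal e M})) + f (halfs U (insert (bisector e i j) A' \<union> (S - {i}) \<union> {floor_normal e M}))"
      by (rule bisector_exchange[OF U f(1) *(1) fin(1) _ *(4,5) S0(4)[OF ij(2)] *(6) _ bneg]) auto
    moreover have "f (halfs U (A' \<union> (translated_normal v ` S - {translated_normal v i}) \<union> {floor_normal e M}))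
         + f (halfs U (insert (bisector e (translated_normal v i) (translated_normal v j)) A' \<union> (translated_normal v ` S - {translated_normal v j}) \<union> {floor_normal e M}))
       = f (halfs U (A' \<union> translated_normal v ` S \<union> {floor_normal e M}))
         + f (halfs U (insert (bisector e (translated_normal v i) (translated_normal v j)) A' \<union> (translated_normal v ` S - {translated_normal v i}) \<union> {floor_normal e M}))"
      by (rule bisector_exchange[OF U f(1) *(1) fin(2) _ imageI[OF *(4)] imageI[OF *(5)] pos[OF ij(2)] less[OF ij *(6)] _ bneg]) auto
    ultimately show "?D A' (S - {i}) + ?D (insert (bisector e i j) A') (S - {j})
        = ?D A' S + ?D (insert (bisector e i j) A') (S - {i})"
      unfolding im[OF *(4)] im[OF *(5)] bis[OF ij] by linarith
  next
    fix A' n assume *: "prism_base U e A'" "A \<subseteq> A'" "n \<in> S0"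
    have sub: "halfs U A' \<subseteq> halfs U A" using halfs_mono[OF *(2)] .
    have "f (halfs U (A' \<union> {n, floor_normal e M})) = f (halfs U (A' \<union> {(1 / (1 + n \<bullet> v)) *\<^sub>R n, floor_normal e M}))"
      by (rule roof_halfs_scale[OF U f *(1) S0(4)[OF *(3)] _ deep_mono[OF M(1)[OF *(3)] sub]])
         (use sh[OF *(3)] deep_mono[OF M(2)[OF *(3)] sub] in \<open>auto simp: translated_normal_def\<close>)
    then show "?D A' {n} = 0" by (simp add: translated_normal_def insert_commute)
  qed (use S0 A in auto)
  then show ?thesis by simp
qed

text \<open>If the direction of translation separates the facets, both roofs of the polytope are translated
  along their common axis.\<close>
lemma translation_invariant_generic:
  assumes U: "subspace U" "e \<in> U" "e \<noteq> 0" and f: "valuation_on U f" "vanishes_on_prisms U f"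
    and N: "finite N" "inj_on (\<lambda>n. n \<bullet> e) N" "polytope_o U (halfs U N)" "polytope_o U ((+) e ` halfs U N)"
  shows "f ((+) e ` halfs U N) = f (halfs U N)"
proof -
  let ?N' = "translated_normal e ` N"
  have pos: "0 < 1 + n \<bullet> e" if "n \<in> N" for n using translated_normal_pos[OF U(1,2) N(4) that] .
  have N': "halfs U ?N' = (+) e ` halfs U N" using translated_normal_halfs[OF U(1,2) pos] .
  obtain A where A: "prism_base U e A" "halfs U A = cylinder e (halfs U N)"
    using shadow_cylinder[OF U N(3)] by metis
  have cyl': "cylinder e ((+) e ` halfs U N) = cylinder e (halfs U N)"
  proof (intro equalityI subsetI)
    fix y assume "y \<in> cylinder e ((+) e ` halfs U N)"
    then obtain x t where "x \<in> halfs U N" "y = e + x + t *\<^sub>R e" by (auto simp: cylinder_def)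
    moreover then have "y = x + (t + 1) *\<^sub>R e" by (simp add: algebra_simps)
    ultimately show "y \<in> cylinder e (halfs U N)" unfolding cylinder_def by blast
  next
    fix y assume "y \<in> cylinder e (halfs U N)"
    then obtain x t where "x \<in> halfs U N" "y = x + t *\<^sub>R e" by (auto simp: cylinder_def)
    moreover then have "y = (e + x) + (t - 1) *\<^sub>R e" by (simp add: algebra_simps)
    ultimately show "y \<in> cylinder e ((+) e ` halfs U N)" unfolding cylinder_def by blast
  qed
  define T where "T = {n\<in>N. 0 < n \<bullet> e}"
  define B where "B = {n\<in>N. 0 < n \<bullet> (-e)}"
  have she: "translated_normal e n \<bullet> e = n \<bullet> e / (1 + n \<bullet> e)" for n by (simp add: translated_normal_def)
  have T': "{n\<in>?N'. 0 < n \<bullet> e} = translated_normal e ` T"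
    using pos by (force simp: T_def she zero_less_divide_iff)
  have B': "{n\<in>?N'. 0 < n \<bullet> (-e)} = translated_normal e ` B"
    using pos by (force simp: B_def she divide_less_0_iff)
  have U': "subspace U" "-e \<in> U" "-e \<noteq> 0" using U by (auto simp: subspace_neg)
  have A': "prism_base U (-e) A" using A(1) by (simp add: prism_base_def)
  have fin: "finite T" "finite B" using N(1) by (auto simp: T_def B_def)
  obtain R where R: "\<And>y. y \<in> halfs U N \<Longrightarrow> norm y \<le> R" "\<And>y. y \<in> halfs U ?N' \<Longrightarrow> norm y \<le> R"
  proof -
    have "bounded (halfs U N \<union> halfs U ?N')" using polytope_o_bounded[OF N(3)] polytope_o_bounded[OF N(4)] N' by simp
    then show ?thesis using that unfolding bounded_iff by blast
  qed
  \<comment> \<open>A single floor and ceiling serving all four roofs.\<close>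
  have "eventually (\<lambda>M. (\<forall>n\<in>T. deep (halfs U A) e n M) \<and> (\<forall>n\<in>T. deep (halfs U A) e (translated_normal e n) M) \<and>
          (\<forall>n\<in>B. deep (halfs U A) (-e) n M) \<and> (\<forall>n\<in>B. deep (halfs U A) (-e) (translated_normal e n) M) \<and>
          M > 0 \<and> M \<ge> norm e * R) at_top"
  proof (intro eventually_conj eventually_gt_at_top eventually_ge_at_top eventually_ball_finite fin ballI)
    fix n assume n: "n \<in> T"
    then have "0 < n \<bullet> e" "0 < translated_normal e n \<bullet> e" using pos by (auto simp: T_def she)
    then show "eventually (\<lambda>M. deep (halfs U A) e n M) at_top"
      "eventually (\<lambda>M. deep (halfs U A) e (translated_normal e n) M) at_top"
      using deep_eventually[OF A(1) U] by blast+
  next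
    fix n assume n: "n \<in> B"
    then have "0 < n \<bullet> -e" "0 < translated_normal e n \<bullet> -e" using pos by (auto simp: B_def she divide_less_0_iff)
    then show "eventually (\<lambda>M. deep (halfs U A) (-e) n M) at_top"
      "eventually (\<lambda>M. deep (halfs U A) (-e) (translated_normal e n) M) at_top"
      using deep_eventually[OF A' U'] by blast+
  qed
  then obtain M where M: "\<And>n. n \<in> T \<Longrightarrow> deep (halfs U A) e n M" "\<And>n. n \<in> T \<Longrightarrow> deep (halfs U A) e (translated_normal e n) M"
     "\<And>n. n \<in> B \<Longrightarrow> deep (halfs U A) (-e) n M" "\<And>n. n \<in> B \<Longrightarrow> deep (halfs U A) (-e) (translated_normal e n) M"
     "M > 0" "M \<ge> norm e * R"
    using eventually_happens'[OF trivial_limit_at_top_linorder] by (smt (verit, best))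
  have bd: "\<bar>e \<bullet> y\<bar> \<le> M" if "norm y \<le> R" for y
  proof -
    have "\<bar>e \<bullet> y\<bar> \<le> norm e * norm y" by (rule Cauchy_Schwarz_ineq2)
    also have "\<dots> \<le> norm e * R" using that by (intro mult_left_mono) auto
    finally show ?thesis using M by linarith
  qed
  have "T \<noteq> {}" using upper_facet_exists[OF U polytope_o_bounded[OF N(3)]] unfolding T_def by blast
  have "B \<noteq> {}" using upper_facet_exists[OF U' polytope_o_bounded[OF N(3)]] unfolding B_def by blast
  have 1: "f (halfs U N) = f (halfs U (A \<union> T \<union> {floor_normal e M})) + f (halfs U (A \<union> B \<union> {floor_normal (-e) M}))"
    unfolding T_def B_def
    by (rule split_into_roofs[OF U f N(1) polytope_o_bounded[OF N(3)] A M(5) bd[OF R(1)]])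
  have 2: "f (halfs U ?N') = f (halfs U (A \<union> translated_normal e ` T \<union> {floor_normal e M})) + f (halfs U (A \<union> translated_normal e ` B \<union> {floor_normal (-e) M}))"
    unfolding T'[symmetric] B'[symmetric]
  proof (rule split_into_roofs[OF U f _ _ A(1) _ M(5) bd[OF R(2)]])
    show "finite ?N'" using N by simp
    show "bounded (halfs U ?N')" using polytope_o_bounded[OF N(4)] N' by simp
    show "halfs U A = cylinder e (halfs U ?N')" using A(2) N' cyl' by simp
  qed
  have 3: "f (halfs U (A \<union> T \<union> {floor_normal e M})) = f (halfs U (A \<union> translated_normal e ` T \<union> {floor_normal e M}))"
  proof (rule translate_roof[where t = 1, OF U f A(1) fin(1) \<open>T \<noteq> {}\<close>])
    show "inj_on (\<lambda>n. n \<bullet> e) T" using N(2) by (rule inj_on_subset) (auto simp: T_def)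
  qed (use M pos in \<open>auto simp: T_def\<close>)
  have 4: "f (halfs U (A \<union> B \<union> {floor_normal (-e) M})) = f (halfs U (A \<union> translated_normal e ` B \<union> {floor_normal (-e) M}))"
  proof (rule translate_roof[OF U' f A' fin(2) \<open>B \<noteq> {}\<close>])
    show "inj_on (\<lambda>n. n \<bullet> - e) B" using N(2) by (auto simp: inj_on_def B_def)
    show "e = (-1) *\<^sub>R (-e)" by simp
  qed (use M pos in \<open>auto simp: B_def\<close>)
  show ?thesis using 1 2 3 4 N' by simp
qed

text \<open>A small vector off finitely many affine hyperplanes: starting from any small vector, a
  hyperplane through it is left by moving slightly along its normal, and the hyperplanes already
  avoided stay avoided.\<close>
lemma avoid_hyperplanes:
  fixes U :: "'a::euclidean_space set"
  assumes U: "subspace U" and F: "finite F" "\<And>d c. (d, c) \<in> F \<Longrightarrow> d \<in> U \<and> d \<noteq> 0" and "e > 0"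
  obtains z where "z \<in> U" "norm z < e" "\<And>d c. (d, c) \<in> F \<Longrightarrow> d \<bullet> z \<noteq> (c::real)"
proof -
  have "\<exists>z. z \<in> U \<and> norm z < e \<and> (\<forall>(d, c)\<in>F. d \<bullet> z \<noteq> c)"
    using F
  proof (induction F rule: finite_induct)
    case empty
    then show ?case using U \<open>e > 0\<close> by (intro exI[of _ 0]) (auto simp: subspace_0)
  next
    case (insert x F)
    obtain d c where x: "x = (d, c)" by fastforce
    have d: "d \<in> U" "d \<noteq> 0" using insert.prems[of d c] x by auto
    obtain z where z: "z \<in> U" "norm z < e" "\<forall>(d, c)\<in>F. d \<bullet> z \<noteq> c" using insert by blast
    show ?case
    proof (cases "d \<bullet> z = c")
      case False
      then show ?thesis using z x by auto
    next
      case True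
      have tend: "((\<lambda>s. z + s *\<^sub>R d) \<longlongrightarrow> z) (at_right (0::real))"
        by (auto intro!: tendsto_eq_intros)
      have "eventually (\<lambda>s. norm (z + s *\<^sub>R d) < e) (at_right 0)"
        using tendsto_norm[OF tend] z(2) by (rule order_tendstoD)
      moreover have "eventually (\<lambda>s. \<forall>p\<in>F. fst p \<bullet> (z + s *\<^sub>R d) \<noteq> snd p) (at_right 0)"
      proof (intro eventually_ball_finite insert ballI)
        fix p assume "p \<in> F"
        then have "fst p \<bullet> z \<noteq> snd p" using z(3) by (cases p) auto
        then show "eventually (\<lambda>s. fst p \<bullet> (z + s *\<^sub>R d) \<noteq> snd p) (at_right 0)"
          using tendsto_imp_eventually_ne[OF tendsto_inner[OF tendsto_const tend]] by blast
      qed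
      moreover have "eventually (\<lambda>s::real. s > 0) (at_right 0)" by (simp add: eventually_at_right_less)
      ultimately have "eventually (\<lambda>s. norm (z + s *\<^sub>R d) < e \<and> (\<forall>p\<in>F. fst p \<bullet> (z + s *\<^sub>R d) \<noteq> snd p) \<and> s > 0) (at_right 0)"
        by eventually_elim auto
      then obtain s where s: "norm (z + s *\<^sub>R d) < e" "\<forall>p\<in>F. fst p \<bullet> (z + s *\<^sub>R d) \<noteq> snd p" "s > 0"
        using eventually_happens'[OF trivial_limit_at_right_real] by blast
      have "d \<bullet> (z + s *\<^sub>R d) \<noteq> c" using True d s by (simp add: inner_add_right)
      moreover have "z + s *\<^sub>R d \<in> U" using z d U by (simp add: subspace_add subspace_scale)
      ultimately show ?thesis using s x by (intro exI[of _ "z + s *\<^sub>R d"]) auto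
    qed
  qed
  then show ?thesis using that by blast
qed

lemma polytope_o_translate_small:
  assumes U: "subspace U" and P: "polytope_o U P"
  obtains d where "d > 0" "\<And>z. z \<in> U \<Longrightarrow> norm z < d \<Longrightarrow> polytope_o U ((+) z ` P)"
proof -
  obtain d where d: "d > 0" "ball 0 d \<inter> U \<subseteq> P" "P \<subseteq> U" "polytope P" using P by (auto simp: polytope_o_def)
  have "polytope_o U ((+) z ` P)" if z: "z \<in> U" "norm z < d / 2" for z
    unfolding polytope_o_def
  proof (intro conjI exI[of _ "d/2"] subsetI)
    show "polytope ((+) z ` P)" using d(4) by (simp add: polytope_translation_eq)
    fix y
    show "y \<in> (+) z ` P \<Longrightarrow> y \<in> U" using d(3) z U by (auto simp: subspace_add)
    assume y: "y \<in> ball 0 (d/2) \<inter> U"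
    then have "norm (y - z) < d" using z norm_triangle_ineq4[of y z] by simp
    then have "y - z \<in> ball 0 d \<inter> U" using y z U by (auto simp: subspace_diff)
    then have "z + (y - z) \<in> (+) z ` P" using d by blast
    then show "y \<in> (+) z ` P" by simp
  qed (use d in auto)
  then show ?thesis using that[of "d/2"] d by auto
qed

text \<open>An arbitrary translation by \<open>x\<close> is replaced by a small generic translation
  \<open>z\<close> of the first body, reached from the second body by the translation \<open>z -
  x\<close>, which is generic as well.\<close>
lemma translation_invariant:
  assumes U: "subspace U" and f: "valuation_on U f" "vanishes_on_prisms U f"
    and P: "polytope_o U P" "polytope_o U ((+) x ` P)" and x: "x \<in> U"
  shows "f ((+) x ` P) = f P"
proof (cases "x = 0")
  case False
  obtain N where N: "finite N" "N \<subseteq> U" "P = halfs U N" using polytope_o_imp_halfs[OF U P(1)] by metis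
  obtain N' where N': "finite N'" "N' \<subseteq> U" "(+) x ` P = halfs U N'" using polytope_o_imp_halfs[OF U P(2)] by metis
  obtain d where d: "d > 0" "\<And>z. z \<in> U \<Longrightarrow> norm z < d \<Longrightarrow> polytope_o U ((+) z ` P)"
    using polytope_o_translate_small[OF U P(1)] by metis
  \<comment> \<open>The hyperplanes to avoid: \<open>z\<close> has to separate the facets of the first body,
    \<open>z - x\<close> those of the second, and neither may be zero.\<close>
  define F where "F = (\<lambda>(n, m). (n - m, 0)) ` {p \<in> N \<times> N. fst p \<noteq> snd p}
     \<union> (\<lambda>(n, m). (n - m, (n - m) \<bullet> x)) ` {p \<in> N' \<times> N'. fst p \<noteq> snd p} \<union> {(x, 0), (x, x \<bullet> x)}"
  have "finite F" using N(1) N'(1) by (auto simp: F_def)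
  moreover have "d \<in> U \<and> d \<noteq> 0" if "(d, c) \<in> F" for d c
    using that N(2) N'(2) x False U by (auto simp: F_def subspace_diff subset_eq)
  ultimately obtain z where z: "z \<in> U" "norm z < d" "\<And>d c. (d, c) \<in> F \<Longrightarrow> d \<bullet> z \<noteq> c"
    using avoid_hyperplanes[OF U _ _ d(1)] by metis
  have "x \<bullet> z \<noteq> 0" "x \<bullet> z \<noteq> x \<bullet> x" using z(3) by (auto simp: F_def)
  then have z0: "z \<noteq> 0" "z - x \<noteq> 0" by auto
  have Pz: "polytope_o U ((+) z ` P)" using d z by blast
  have inj: "inj_on (\<lambda>n. n \<bullet> z) N"
  proof (rule inj_onI, rule ccontr)
    fix n m assume *: "n \<in> N" "m \<in> N" "n \<bullet> z = m \<bullet> z" "n \<noteq> m"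
    then have "(n - m, 0) \<in> F" by (force simp: F_def)
    from z(3)[OF this] * show False by (simp add: inner_diff_left)
  qed
  have inj': "inj_on (\<lambda>n. n \<bullet> (z - x)) N'"
  proof (rule inj_onI, rule ccontr)
    fix n m assume *: "n \<in> N'" "m \<in> N'" "n \<bullet> (z - x) = m \<bullet> (z - x)" "n \<noteq> m"
    then have "(n - m, (n - m) \<bullet> x) \<in> F" by (force simp: F_def)
    from z(3)[OF this] * show False by (simp add: inner_diff_left inner_diff_right)
  qed
  have "f ((+) z ` P) = f P"
    using translation_invariant_generic[OF U z(1) z0(1) f N(1) inj] P Pz N(3) by simp
  moreover have eq: "(+) (z - x) ` ((+) x ` P) = (+) z ` P" by (simp add: image_image)
  have "f ((+) (z - x) ` ((+) x ` P)) = f ((+) x ` P)"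
    unfolding N'(3)
    by (rule translation_invariant_generic[OF U _ z0(2) f N'(1) inj'])
       (use P Pz N'(3) eq z x U in \<open>auto simp: subspace_diff\<close>)
  ultimately show ?thesis using eq by simp
qed simp

text \<open>Split along a direction that separates the facets, then reduce both roofs to single facets.\<close>
lemma vanish_if_facet_roofs_vanish:
  assumes U: "subspace U" "U \<noteq> {0}" and f: "valuation_on U f" "vanishes_on_prisms U f"
    and T: "\<And>e A n M. e \<in> U \<Longrightarrow> e \<noteq> 0 \<Longrightarrow> prism_base U e A \<Longrightarrow> 0 < n \<bullet> e \<Longrightarrow> deep (halfs U A) e n M \<Longrightarrow>
       f (halfs U (A \<union> {n, floor_normal e M})) = 0"
    and P: "polytope_o U P"
  shows "f P = 0"
proof -
  obtain u where u: "u \<in> U" "u \<noteq> 0" using U subspace_0 by blast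
  obtain N where N: "finite N" "N \<subseteq> U" "P = halfs U N" using polytope_o_imp_halfs[OF U(1) P] by metis
  \<comment> \<open>The extra hyperplane normal to \<open>u\<close> only ensures that the direction found is not
    zero.\<close>
  define F where "F = (\<lambda>(n, m). (n - m, 0::real)) ` {p \<in> N \<times> N. fst p \<noteq> snd p} \<union> {(u, 0)}"
  have "finite F" using N(1) by (auto simp: F_def)
  moreover have "d \<in> U \<and> d \<noteq> 0" if "(d, c) \<in> F" for d c
    using that N(2) u U by (auto simp: F_def subspace_diff subset_eq)
  ultimately obtain e where e: "e \<in> U" "\<And>d c. (d, c) \<in> F \<Longrightarrow> d \<bullet> e \<noteq> c"
    using avoid_hyperplanes[OF U(1) _ _ zero_less_one] by metis
  have "u \<bullet> e \<noteq> 0" using e(2) by (auto simp: F_def)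
  then have e0: "e \<noteq> 0" by auto
  have inj: "inj_on (\<lambda>n. n \<bullet> e) N"
  proof (rule inj_onI, rule ccontr)
    fix n m assume *: "n \<in> N" "m \<in> N" "n \<bullet> e = m \<bullet> e" "n \<noteq> m"
    then have "(n - m, 0) \<in> F" by (force simp: F_def)
    from e(2)[OF this] * show False by (simp add: inner_diff_left)
  qed
  have main: "f (halfs U (A \<union> {n\<in>N. 0 < n \<bullet> e} \<union> {floor_normal e M})) = 0"
    if e: "e \<in> U" "e \<noteq> 0" and inj: "inj_on (\<lambda>n. n \<bullet> e) N" and A: "prism_base U e A"
      and M: "\<And>n. n \<in> N \<Longrightarrow> 0 < n \<bullet> e \<Longrightarrow> deep (halfs U A) e n M" and "M > 0" for e A M
  proof -
    let ?D = "\<lambda>A S. f (halfs U (A \<union> S \<union> {floor_normal e M}))"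
    let ?S0 = "{n\<in>N. 0 < n \<bullet> e}"
    have fin: "finite ?S0" using N by auto
    have ne: "?S0 \<noteq> {}" using upper_facet_exists[OF U(1) e, of N] polytope_o_bounded[OF P] N(3) by blast
    show "?D A ?S0 = 0"
    proof (rule top_recursion[where D = ?D and U = U and e = e and ?A0.0 = A and ?S0.0 = ?S0])
      fix A' S i j
      assume *: "prism_base U e A'" "A \<subseteq> A'" "S \<subseteq> ?S0" "i \<in> S" "j \<in> S" "j \<bullet> e < i \<bullet> e"
      have "finite S" using * fin finite_subset by blast
      moreover have "0 < j \<bullet> e" using * by auto
      ultimately show "?D A' (S - {i}) + ?D (insert (bisector e i j) A') (S - {j})
          = ?D A' S + ?D (insert (bisector e i j) A') (S - {i})"
        by (intro bisector_exchange[OF U(1) e f(1) *(1) _ _ *(4,5) _ *(6) _ floor_normal_neg[OF \<open>M > 0\<close> e(2)]]) auto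
    next
      fix A' n assume *: "prism_base U e A'" "A \<subseteq> A'" "n \<in> ?S0"
      then show "?D A' {n} = 0"
        using T[OF e *(1), of n M] deep_mono[OF M halfs_mono[OF *(2)], of n] by (simp add: insert_commute)
    next
      show "inj_on (\<lambda>n. n \<bullet> e) ?S0" using inj by (rule inj_on_subset) auto
    qed (use fin ne A in auto)
  qed
  obtain A where A: "prism_base U e A" "halfs U A = cylinder e (halfs U N)"
    using shadow_cylinder[OF U(1) e(1) e0] P N(3) by metis
  have A': "prism_base U (-e) A" using A(1) by (simp add: prism_base_def)
  have e': "-e \<in> U" "-e \<noteq> 0" using e e0 U by (auto simp: subspace_neg)
  obtain R where R: "\<And>y. y \<in> halfs U N \<Longrightarrow> norm y \<le> R"
    using polytope_o_bounded[OF P] unfolding N(3) bounded_iff by blast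
  have "eventually (\<lambda>M. (\<forall>n\<in>{n\<in>N. 0 < n \<bullet> e}. deep (halfs U A) e n M) \<and>
          (\<forall>n\<in>{n\<in>N. 0 < n \<bullet> -e}. deep (halfs U A) (-e) n M) \<and> M > 0 \<and> M \<ge> norm e * R) at_top"
    by (intro eventually_conj eventually_gt_at_top eventually_ge_at_top eventually_ball_finite ballI)
       (use N(1) deep_eventually[OF A(1) U(1) e(1) e0] deep_eventually[OF A' U(1) e'] in auto)
  then obtain M where M: "\<forall>n\<in>{n\<in>N. 0 < n \<bullet> e}. deep (halfs U A) e n M"
     "\<forall>n\<in>{n\<in>N. 0 < n \<bullet> -e}. deep (halfs U A) (-e) n M" "M > 0" "M \<ge> norm e * R"
    using eventually_happens'[OF trivial_limit_at_top_linorder] by (smt (verit, best))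
  have bd: "\<bar>e \<bullet> y\<bar> \<le> M" if "y \<in> halfs U N" for y
  proof -
    have "\<bar>e \<bullet> y\<bar> \<le> norm e * norm y" by (rule Cauchy_Schwarz_ineq2)
    also have "\<dots> \<le> norm e * R" using R[OF that] by (intro mult_left_mono) auto
    finally show ?thesis using M by linarith
  qed
  have "f (halfs U N) = f (halfs U (A \<union> {n\<in>N. 0 < n \<bullet> e} \<union> {floor_normal e M}))
       + f (halfs U (A \<union> {n\<in>N. 0 < n \<bullet> (-e)} \<union> {floor_normal (-e) M}))"
    by (rule split_into_roofs[OF U(1) e(1) e0 f N(1) _ A M(3) bd]) (use polytope_o_bounded[OF P] N(3) in auto)
  moreover have "f (halfs U (A \<union> {n\<in>N. 0 < n \<bullet> e} \<union> {floor_normal e M})) = 0"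
    by (rule main[OF e(1) e0 inj A(1)]) (use M in auto)
  moreover have "f (halfs U (A \<union> {n\<in>N. 0 < n \<bullet> (-e)} \<union> {floor_normal (-e) M})) = 0"
    by (rule main[OF e' _ A']) (use M inj in \<open>auto simp: inj_on_def\<close>)
  ultimately show ?thesis using N(3) by simp
qed

section \<open>Homogeneous translation-invariant valuations\<close>

definition translation_inv :: "'a::euclidean_space set \<Rightarrow> ('a set \<Rightarrow> real) \<Rightarrow> bool" where
  "translation_inv U f \<longleftrightarrow> (\<forall>P x. polytope_o U P \<longrightarrow> x \<in> U \<longrightarrow> polytope_o U ((+) x ` P) \<longrightarrow> f ((+) x ` P) = f P)"

definition cut_cylinder :: "'a::euclidean_space \<Rightarrow> 'a \<Rightarrow> real \<Rightarrow> 'a set \<Rightarrow> 'a set" where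
  "cut_cylinder e n M K = cylinder e K \<inter> {y. n \<bullet> y \<le> 1 \<and> - (e \<bullet> y) \<le> M}"

text \<open>The value of the roof with one facet, as a function of its base \<open>K\<close>. Which deep
  floor is chosen does not matter (\<open>roof_eq\<close>).\<close>
definition roof :: "('a::euclidean_space set \<Rightarrow> real) \<Rightarrow> 'a \<Rightarrow> 'a \<Rightarrow> 'a set \<Rightarrow> real" where
  "roof f e n K = f (cut_cylinder e n (SOME M. deep (cylinder e K) e n M) K)"

lemma cut_cylinder_halfs: "halfs U A = cylinder e K \<Longrightarrow> 0 < M \<Longrightarrow> cut_cylinder e n M K = halfs U (A \<union> {n, floor_normal e M})"
  by (auto simp: cut_cylinder_def halfs_def floor_normal_iff set_eq_iff)

lemma polytope_o_cut_cylinder: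
  assumes U: "subspace U" "e \<in> U" "e \<noteq> 0" and K: "polytope_o (perp U e) K" and "0 < n \<bullet> e" "0 < M"
  shows "polytope_o U (cut_cylinder e n M K)"
proof -
  obtain A where A: "prism_base U e A" "halfs U A = cylinder e K" using polytope_o_perp_cylinder[OF U K] by metis
  have "bounded (halfs U (A \<union> {n, floor_normal e M}))"
    by (rule prism_base_bounded[OF A(1) U assms(5) floor_normal_neg[OF assms(6) U(3)]]) auto
  then show ?thesis unfolding cut_cylinder_halfs[OF A(2) assms(6)]
    using A(1) by (intro polytope_o_halfs U) (auto simp: prism_base_def)
qed

lemma deep_cylinder_eventually:
  assumes U: "subspace U" "e \<in> U" "e \<noteq> 0" and K: "polytope_o (perp U e) K" and "0 < n \<bullet> e"
  shows "eventually (\<lambda>M. deep (cylinder e K) e n M) at_top"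
proof -
  obtain A where A: "prism_base U e A" "halfs U A = cylinder e K" using polytope_o_perp_cylinder[OF U K] by metis
  show ?thesis using deep_eventually[OF A(1) U assms(5)] A(2) by simp
qed

lemma ev_at_top_happens: "eventually P (at_top :: real filter) \<Longrightarrow> \<exists>M. P M"
  using eventually_happens'[OF trivial_limit_at_top_linorder] by blast

lemma roof_eq:
  assumes U: "subspace U" "e \<in> U" "e \<noteq> 0" and f: "valuation_on U f" "vanishes_on_prisms U f"
    and K: "polytope_o (perp U e) K" and n: "0 < n \<bullet> e" and M: "deep (cylinder e K) e n M"
  shows "roof f e n K = f (cut_cylinder e n M K)"
proof -
  obtain A where A: "prism_base U e A" "halfs U A = cylinder e K" using polytope_o_perp_cylinder[OF U K] by metis
  let ?M = "SOME M. deep (cylinder e K) e n M"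
  have M': "deep (cylinder e K) e n ?M" using M by (rule someI)
  have "0 < M" "0 < ?M" using M M' by (auto simp: deep_def)
  then show ?thesis unfolding roof_def
    using roof_halfs_floor[OF U f A(1) n, of M ?M] M M' A(2) cut_cylinder_halfs[OF A(2)] by simp
qed

lemma cylI: "x \<in> K \<Longrightarrow> y = x + t *\<^sub>R e \<Longrightarrow> y \<in> cylinder e K"
  by (auto simp: cylinder_def)

lemma cylE: "y \<in> cylinder e K \<Longrightarrow> (\<And>x t. x \<in> K \<Longrightarrow> y = x + t *\<^sub>R e \<Longrightarrow> thesis) \<Longrightarrow> thesis"
  by (auto simp: cylinder_def)

lemma cylinder_mono: "K \<subseteq> L \<Longrightarrow> cylinder e K \<subseteq> cylinder e L"
  by (auto simp: cylinder_def)

lemma cylinder_Un: "cylinder e (K \<union> L) = cylinder e K \<union> cylinder e L"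
  by (auto simp: cylinder_def)

lemma cylinder_Int:
  assumes "e \<noteq> 0" "K \<subseteq> perp U e" "L \<subseteq> perp U e"
  shows "cylinder e (K \<inter> L) = cylinder e K \<inter> cylinder e L"
proof (intro equalityI subsetI)
  fix y assume "y \<in> cylinder e K \<inter> cylinder e L"
  then obtain x t x' t' where *: "x \<in> K" "y = x + t *\<^sub>R e" "x' \<in> L" "y = x' + t' *\<^sub>R e"
    by (elim IntE cylE)
  have o: "x \<bullet> e = 0" "x' \<bullet> e = 0" using * assms by (auto simp: perp_def)
  have "y \<bullet> e = t * (e \<bullet> e)" using *(2) o(1) by (simp add: inner_add_left)
  moreover have "y \<bullet> e = t' * (e \<bullet> e)" using *(4) o(2) by (simp add: inner_add_left)
  ultimately have "t * (e \<bullet> e) = t' * (e \<bullet> e)" by metis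
  then have "t = t'" using assms(1) by auto
  then have "x = x'" using * by simp
  then show "y \<in> cylinder e (K \<inter> L)" using * by (auto simp: cylinder_def)
qed (auto simp: cylinder_def)

lemma polytope_o_sub: "polytope_o U P \<Longrightarrow> P \<subseteq> U"
  by (simp add: polytope_o_def)

lemma roof_valuation_on:
  assumes U: "subspace U" "e \<in> U" "e \<noteq> 0" and f: "valuation_on U f" "vanishes_on_prisms U f" and n: "0 < n \<bullet> e"
  shows "valuation_on (perp U e) (roof f e n)"
  unfolding valuation_on_def
proof (intro allI impI)
  fix P Q assume po: "polytope_o (perp U e) P" "polytope_o (perp U e) Q" "polytope_o (perp U e) (P \<union> Q)" "polytope_o (perp U e) (P \<inter> Q)"
  obtain M where M: "deep (cylinder e (P \<union> Q)) e n M"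
    using ev_at_top_happens[OF deep_cylinder_eventually[OF U po(3) n]] by blast
  have M': "deep (cylinder e P) e n M" "deep (cylinder e Q) e n M" "deep (cylinder e (P \<inter> Q)) e n M"
    by (rule deep_mono[OF M], rule cylinder_mono, blast)+
  have M0: "0 < M" using M by (simp add: deep_def)
  have "f (cut_cylinder e n M (P \<union> Q)) + f (cut_cylinder e n M (P \<inter> Q)) = f (cut_cylinder e n M P) + f (cut_cylinder e n M Q)"
  proof (rule valuation_on_split[OF f(1)])
    show "cut_cylinder e n M P \<union> cut_cylinder e n M Q = cut_cylinder e n M (P \<union> Q)" by (auto simp: cut_cylinder_def cylinder_Un)
    show "cut_cylinder e n M P \<inter> cut_cylinder e n M Q = cut_cylinder e n M (P \<inter> Q)"
      using cylinder_Int[OF U(3) polytope_o_sub[OF po(1)] polytope_o_sub[OF po(2)]] by (auto simp: cut_cylinder_def)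
  qed (use polytope_o_cut_cylinder[OF U _ n M0] po in auto)
  then show "roof f e n (P \<union> Q) + roof f e n (P \<inter> Q) = roof f e n P + roof f e n Q"
    using roof_eq[OF U f _ n] po M M' by simp
qed

lemma cylinder_translate:
  assumes "z' = z + s *\<^sub>R e"
  shows "cylinder e ((+) z ` K) = (+) z' ` cylinder e K"
proof (intro equalityI subsetI)
  fix y assume "y \<in> cylinder e ((+) z ` K)"
  then obtain x t where x: "x \<in> K" "y = z + x + t *\<^sub>R e" by (auto simp: cylinder_def)
  then have y: "y = z' + (x + (t - s) *\<^sub>R e)" using assms by (simp add: algebra_simps)
  show "y \<in> (+) z' ` cylinder e K" unfolding y using x(1) by (intro imageI cylI[of x]) auto
next
  fix y assume "y \<in> (+) z' ` cylinder e K"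
  then obtain x t where x: "x \<in> K" "y = z' + (x + t *\<^sub>R e)" by (auto simp: cylinder_def)
  then have "y = (z + x) + (t + s) *\<^sub>R e" using assms by (simp add: algebra_simps)
  then show "y \<in> cylinder e ((+) z ` K)" using x(1) by (intro cylI[of "z + x"]) auto
qed

text \<open>A translation of the base is compensated by a translation along the axis, chosen so that the
  facet stays in its plane; only the floor moves.\<close>
lemma roof_translation_inv:
  assumes U: "subspace U" "e \<in> U" "e \<noteq> 0" and f: "valuation_on U f" "vanishes_on_prisms U f" and n: "0 < n \<bullet> e"
  shows "translation_inv (perp U e) (roof f e n)"
  unfolding translation_inv_def
proof (intro allI impI)
  fix K z assume po: "polytope_o (perp U e) K" "z \<in> perp U e" "polytope_o (perp U e) ((+) z ` K)"
  define z' where "z' = z + (- (n \<bullet> z) / (n \<bullet> e)) *\<^sub>R e"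
  have nz: "n \<bullet> z' = 0" using n by (simp add: z'_def inner_diff_right)
  have zU: "z' \<in> U" using po U by (simp add: z'_def perp_def subspace_add subspace_scale subspace_diff)
  have "eventually (\<lambda>M. deep (cylinder e K) e n M) at_top" using deep_cylinder_eventually[OF U po(1) n] .
  then obtain M1 where M1: "\<And>M. M \<ge> M1 \<Longrightarrow> deep (cylinder e K) e n M" unfolding eventually_at_top_linorder by blast
  have "eventually (\<lambda>M. deep (cylinder e ((+) z ` K)) e n M \<and> M \<ge> M1 - e \<bullet> z') at_top"
    by (intro eventually_conj deep_cylinder_eventually[OF U po(3) n] eventually_ge_at_top)
  then obtain M where M: "deep (cylinder e ((+) z ` K)) e n M" "M \<ge> M1 - e \<bullet> z'"
    using ev_at_top_happens by blast
  have M': "deep (cylinder e K) e n (M + e \<bullet> z')" using M1 M(2) by simp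
  have eq: "cut_cylinder e n M ((+) z ` K) = (+) z' ` cut_cylinder e n (M + e \<bullet> z') K"
    unfolding cut_cylinder_def cylinder_translate[OF z'_def] by (auto simp: inner_add_right nz)
  have "0 < M" "0 < M + e \<bullet> z'" using M M' by (auto simp: deep_def)
  then have "polytope_o U (cut_cylinder e n (M + e \<bullet> z') K)" "polytope_o U ((+) z' ` cut_cylinder e n (M + e \<bullet> z') K)"
    using polytope_o_cut_cylinder[OF U po(1) n] polytope_o_cut_cylinder[OF U po(3) n] unfolding eq[symmetric] by blast+
  then have "f ((+) z' ` cut_cylinder e n (M + e \<bullet> z') K) = f (cut_cylinder e n (M + e \<bullet> z') K)"
    using translation_invariant[OF U(1) f _ _ zU] by blast
  then show "roof f e n ((+) z ` K) = roof f e n K"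
    using roof_eq[OF U f po(3) n M(1)] roof_eq[OF U f po(1) n M'] eq by simp
qed

lemma roof_scale:
  assumes U: "subspace U" "e \<in> U" "e \<noteq> 0" and f: "valuation_on U f" "vanishes_on_prisms U f" and n: "0 < n \<bullet> e" "0 < c"
    and K: "polytope_o (perp U e) K"
  shows "roof f e (c *\<^sub>R n) K = roof f e n K"
proof -
  obtain A where A: "prism_base U e A" "halfs U A = cylinder e K" using polytope_o_perp_cylinder[OF U K] by metis
  have cn: "0 < (c *\<^sub>R n) \<bullet> e" using n by simp
  have "eventually (\<lambda>M. deep (cylinder e K) e n M \<and> deep (cylinder e K) e (c *\<^sub>R n) M) at_top"
    by (intro eventually_conj deep_cylinder_eventually[OF U K n(1)] deep_cylinder_eventually[OF U K cn])
  then obtain M where M: "deep (cylinder e K) e n M" "deep (cylinder e K) e (c *\<^sub>R n) M"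
    using ev_at_top_happens by blast
  have M0: "0 < M" using M by (auto simp: deep_def)
  show ?thesis
    unfolding roof_eq[OF U f K n(1) M(1)] roof_eq[OF U f K cn M(2)] cut_cylinder_halfs[OF A(2) M0]
    using roof_halfs_scale[OF U f A(1) n] M A(2) by simp
qed

text \<open>The reduction to single facets, restated in terms of \<open>roof\<close>.\<close>
lemma vanish_if_roofs_vanish:
  assumes U: "subspace U" "U \<noteq> {0}" and f: "valuation_on U f" "vanishes_on_prisms U f"
    and T: "\<And>e n K. e \<in> U \<Longrightarrow> e \<noteq> 0 \<Longrightarrow> 0 < n \<bullet> e \<Longrightarrow> polytope_o (perp U e) K \<Longrightarrow> roof f e n K = 0"
    and P: "polytope_o U P"
  shows "f P = 0"
proof (rule vanish_if_facet_roofs_vanish[OF U f _ P])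
  fix e A n M assume *: "e \<in> U" "e \<noteq> 0" "prism_base U e A" "0 < n \<bullet> e" "deep (halfs U A) e n M"
  have c: "halfs U A = cylinder e (halfs (perp U e) A)"
    using cylinder_halfs[OF U(1) *(1,2), of A] *(3) by (auto simp: prism_base_def)
  have K: "polytope_o (perp U e) (halfs (perp U e) A)" using prism_base_perp[OF U(1) *(3)] .
  have "f (halfs U (A \<union> {n, floor_normal e M})) = roof f e n (halfs (perp U e) A)"
    using roof_eq[OF U(1) *(1,2) f K *(4), of M] *(5) c cut_cylinder_halfs[OF c] by (simp add: deep_def)
  then show "f (halfs U (A \<union> {n, floor_normal e M})) = 0" using T *(1,2,4) K by simp
qed

lemma polytope_o_scale:
  assumes U: "subspace U" and P: "polytope_o U P" and c: "0 < c"
  shows "polytope_o U ((*\<^sub>R) c ` P)"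
  unfolding polytope_o_def
proof (intro conjI)
  obtain d where d: "d > 0" "ball 0 d \<inter> U \<subseteq> P" "P \<subseteq> U" "polytope P" using P by (auto simp: polytope_o_def)
  show "polytope ((*\<^sub>R) c ` P)" by (rule polytope_linear_image[OF _ d(4)]) (simp add: linear_scale_self)
  show "(*\<^sub>R) c ` P \<subseteq> U" using d U by (auto simp: subspace_scale)
  show "\<exists>e>0. ball 0 e \<inter> U \<subseteq> (*\<^sub>R) c ` P"
  proof (intro exI[of _ "c * d"] conjI subsetI)
    fix y assume y: "y \<in> ball 0 (c * d) \<inter> U"
    then have "(1/c) *\<^sub>R y \<in> ball 0 d \<inter> U" using c U by (auto simp: field_simps subspace_scale)
    then have "c *\<^sub>R ((1/c) *\<^sub>R y) \<in> (*\<^sub>R) c ` P" using d by blast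
    then show "y \<in> (*\<^sub>R) c ` P" using c by simp
  qed (use c d in auto)
qed

lemma cylinder_scale: "c \<noteq> 0 \<Longrightarrow> cylinder e ((*\<^sub>R) c ` K) = (*\<^sub>R) c ` cylinder e K"
proof (intro equalityI subsetI)
  fix y assume c: "c \<noteq> 0" and "y \<in> cylinder e ((*\<^sub>R) c ` K)"
  then obtain x t where x: "x \<in> K" "y = c *\<^sub>R x + t *\<^sub>R e" by (auto simp: cylinder_def)
  then have "y = c *\<^sub>R (x + (t / c) *\<^sub>R e)" using c by (simp add: algebra_simps)
  then show "y \<in> (*\<^sub>R) c ` cylinder e K" using x by (auto simp: cylinder_def)
next
  fix y assume "c \<noteq> 0" "y \<in> (*\<^sub>R) c ` cylinder e K"
  then obtain x t where x: "x \<in> K" "y = c *\<^sub>R (x + t *\<^sub>R e)" by (auto simp: cylinder_def)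
  then have "y = c *\<^sub>R x + (c * t) *\<^sub>R e" by (simp add: algebra_simps)
  then show "y \<in> cylinder e ((*\<^sub>R) c ` K)" using x by (auto simp: cylinder_def)
qed

definition prism :: "'a::euclidean_space \<Rightarrow> 'a \<Rightarrow> real \<Rightarrow> real \<Rightarrow> 'a set \<Rightarrow> 'a set" where
  "prism e n a b K = cylinder e K \<inter> {y. n \<bullet> y \<le> a \<and> - (n \<bullet> y) \<le> b}"

lemma prism_halfs:
  assumes "halfs U A = cylinder e K" "0 < a" "0 < b"
  shows "prism e n a b K = halfs U (A \<union> {(1/a) *\<^sub>R n, - ((1/b) *\<^sub>R n)})"
proof -
  have "((1/a) *\<^sub>R n) \<bullet> y \<le> 1 \<longleftrightarrow> n \<bullet> y \<le> a" "(- ((1/b) *\<^sub>R n)) \<bullet> y \<le> 1 \<longleftrightarrow> - (n \<bullet> y) \<le> b" for y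
    using assms(2,3) by (simp_all add: pos_divide_le_eq minus_le_iff) (auto simp: field_simps)
  then show ?thesis using assms(1) by (auto simp: prism_def halfs_def set_eq_iff)
qed

lemma polytope_o_prism:
  assumes U: "subspace U" "e \<in> U" "e \<noteq> 0" and K: "polytope_o (perp U e) K" and "0 < n \<bullet> e" "0 < a" "0 < b"
  shows "polytope_o U (prism e n a b K)"
proof -
  obtain A where A: "prism_base U e A" "halfs U A = cylinder e K" using polytope_o_perp_cylinder[OF U K] by metis
  have "bounded (halfs U (A \<union> {(1/a) *\<^sub>R n, - ((1/b) *\<^sub>R n)}))"
    by (rule prism_base_bounded[OF A(1) U, of "(1/a) *\<^sub>R n" "- ((1/b) *\<^sub>R n)"]) (use assms in auto)
  then show ?thesis unfolding prism_halfs[OF A(2) assms(6,7)]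
    using A(1) by (intro polytope_o_halfs U) (auto simp: prism_base_def)
qed

lemma valuation_on_linear_combination: "valuation_on U f \<Longrightarrow> valuation_on U g \<Longrightarrow> valuation_on U (\<lambda>K. a * f K + b * g K)"
  unfolding valuation_on_def
proof (intro allI impI)
  fix P Q
  assume *: "\<forall>P Q. polytope_o U P \<longrightarrow> polytope_o U Q \<longrightarrow> polytope_o U (P \<union> Q) \<longrightarrow> polytope_o U (P \<inter> Q) \<longrightarrow> f (P \<union> Q) + f (P \<inter> Q) = f P + f Q"
    "\<forall>P Q. polytope_o U P \<longrightarrow> polytope_o U Q \<longrightarrow> polytope_o U (P \<union> Q) \<longrightarrow> polytope_o U (P \<inter> Q) \<longrightarrow> g (P \<union> Q) + g (P \<inter> Q) = g P + g Q"
    "polytope_o U P" "polytope_o U Q" "polytope_o U (P \<union> Q)" "polytope_o U (P \<inter> Q)"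
  then have "f (P \<union> Q) + f (P \<inter> Q) = f P + f Q" "g (P \<union> Q) + g (P \<inter> Q) = g P + g Q" by auto
  then have "a * (f (P \<union> Q) + f (P \<inter> Q)) + b * (g (P \<union> Q) + g (P \<inter> Q)) = a * (f P + f Q) + b * (g P + g Q)"
    by simp
  then show "a * f (P \<union> Q) + b * g (P \<union> Q) + (a * f (P \<inter> Q) + b * g (P \<inter> Q)) =
       a * f P + b * g P + (a * f Q + b * g Q)" by (simp add: algebra_simps)
qed

lemma dim_perp:
  assumes "subspace U" "e \<in> U" "e \<noteq> 0"
  shows "dim (perp U e) < dim U"
proof -
  have "perp U e \<subseteq> U" "e \<notin> perp U e" using assms by (auto simp: perp_def)
  then have "perp U e \<subset> U" using assms by blast
  then show ?thesis
    using assms(1) subspace_perp[OF assms(1)] by (metis dim_psubset span_eq_iff)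
qed

text \<open>By induction on the dimension. The value of a prism depends only on the base and on its total
  height \<open>L\<close>, because the prism can be slid along its axis; call it \<open>\<phi> L
  K\<close>. Overlapping prisms show that \<open>\<phi>\<close> is affine in \<open>L\<close> at
  integer multiples. Its constant part \<open>2 \<phi> L - \<phi> (2 L)\<close> is homogeneous of
  degree \<open>j\<close> on a space of smaller dimension and so vanishes; the remaining linear
  part is homogeneous of degree \<open>j - 1\<close> in the base and vanishes too. Hence prisms
  have value zero, the roofs over them are again homogeneous of degree \<open>j\<close> in their
  bases, and \<open>vanish_if_roofs_vanish\<close> applies.\<close>
theorem homogeneous_vanish:
  fixes G :: "'a::euclidean_space set"
  assumes "subspace G" "valuation_on G l" "translation_inv G l" "\<And>K. polytope_o G K \<Longrightarrow> l ((*\<^sub>R) 2 ` K) = 2 ^ j * l K"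
    "dim G < j" "polytope_o G K"
  shows "l K = 0"
  using assms
proof (induction "dim G" arbitrary: G l j K rule: less_induct)
  case less
  note G = less.prems(1) and l = less.prems(2,3) and hom = less.prems(4)
  show ?case
  proof (cases "G = {0}")
    case True
    have "0 \<in> K" "K \<subseteq> {0}" using polytope_o_zero[OF G less.prems(6)] polytope_o_sub[OF less.prems(6)] True by auto
    then have "K = {0}" by auto
    then have "(*\<^sub>R) 2 ` K = K" by simp
    then have "l K = 2 ^ j * l K" using hom[OF less.prems(6)] by simp
    moreover have "(1::real) < 2 ^ j" using less.prems(5) by (intro one_less_power) auto
    ultimately show ?thesis by simp
  next
    case G0: False
    have pv: "l (prism e n a b K) = 0"
      if e: "e \<in> G" "e \<noteq> 0" and n: "0 < n \<bullet> e" and K: "polytope_o (perp G e) K" and ab: "0 < a" "0 < b" for e n a b K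
    proof -
      have d: "dim (perp G e) < dim G" using dim_perp[OF G e] .
      note H = subspace_perp[OF G, of e]
      have slide: "l (prism e n (a + t) (b - t) K) = l (prism e n a b K)"
        if K: "polytope_o (perp G e) K" and ab: "0 < a" "0 < b" "0 < a + t" "0 < b - t" for a b t K
      proof -
        let ?x = "(t / (n \<bullet> e)) *\<^sub>R e"
        have nx: "n \<bullet> ?x = t" using n by simp
        have "prism e n (a + t) (b - t) K = (+) ?x ` prism e n a b K"
        proof -
          have "cylinder e K = (+) ?x ` cylinder e K" using cylinder_translate[of ?x 0 "t / (n \<bullet> e)" e K] by simp
          then have "prism e n (a + t) (b - t) K = (+) ?x ` cylinder e K \<inter> {y. n \<bullet> y \<le> a + t \<and> - (n \<bullet> y) \<le> b - t}"
            unfolding prism_def by simp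
          also have "\<dots> = (+) ?x ` prism e n a b K" unfolding prism_def
            by (auto simp: inner_add_right nx simp del: inner_scaleR_right)
          finally show ?thesis .
        qed
        moreover have "?x \<in> G" using e G by (simp add: subspace_scale)
        ultimately show ?thesis
          using l(2) polytope_o_prism[OF G e K n ab(1,2)] polytope_o_prism[OF G e K n ab(3,4)] unfolding translation_inv_def by metis
      qed
      define \<phi> where "\<phi> = (\<lambda>L K. l (prism e n (L/2) (L/2) K))"
      have \<phi>: "l (prism e n a b K) = \<phi> (a + b) K" if "polytope_o (perp G e) K" "0 < a" "0 < b" for a b K
        using slide[OF that, of "(b - a)/2"] that unfolding \<phi>_def by (simp add: field_simps)
      have jensen: "\<phi> (a + b) K + \<phi> (a' + b') K = \<phi> (a + b') K + \<phi> (a' + b) K"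
        if K: "polytope_o (perp G e) K" and ab: "0 < a" "0 < b" "a \<le> a'" "b \<le> b'" for a b a' b' K
      proof -
        have pos: "0 < a'" "0 < b'" using ab by auto
        have "l (prism e n a' b' K) + l (prism e n a b K) = l (prism e n a b' K) + l (prism e n a' b K)"
          by (rule valuation_on_split[OF l(1)])
             (use polytope_o_prism[OF G e K n] ab pos in \<open>auto simp: prism_def\<close>)
        then show ?thesis using \<phi>[OF K] ab pos by simp
      qed
      have j3: "\<phi> L K + \<phi> (3 * L) K = 2 * \<phi> (2 * L) K" "\<phi> (2 * L) K + \<phi> (4 * L) K = 2 * \<phi> (3 * L) K"
        if "polytope_o (perp G e) K" "0 < L" for L K
        using jensen[OF that(1), of "L/2" "L/2" "3*L/2" "3*L/2"] jensen[OF that(1), of L L "2*L" "2*L"] that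
        by simp_all
      have v\<phi>: "valuation_on (perp G e) (\<phi> L)" if "L > 0" for L
        unfolding valuation_on_def \<phi>_def
      proof (intro allI impI valuation_on_split[OF l(1)])
        fix P Q assume po: "polytope_o (perp G e) P" "polytope_o (perp G e) Q" "polytope_o (perp G e) (P \<union> Q)" "polytope_o (perp G e) (P \<inter> Q)"
        show "polytope_o G (prism e n (L/2) (L/2) P)" "polytope_o G (prism e n (L/2) (L/2) Q)" "polytope_o G (prism e n (L/2) (L/2) (P \<union> Q))"
          using polytope_o_prism[OF G e _ n] po that by auto
        show "prism e n (L/2) (L/2) P \<union> prism e n (L/2) (L/2) Q = prism e n (L/2) (L/2) (P \<union> Q)"
          by (auto simp: prism_def cylinder_Un)
        show "prism e n (L/2) (L/2) P \<inter> prism e n (L/2) (L/2) Q = prism e n (L/2) (L/2) (P \<inter> Q)"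
          using cylinder_Int[OF e(2) polytope_o_sub[OF po(1)] polytope_o_sub[OF po(2)]] by (auto simp: prism_def)
      qed
      have t\<phi>: "translation_inv (perp G e) (\<phi> L)" if L: "L > 0" for L
        unfolding translation_inv_def \<phi>_def
      proof (intro allI impI)
        fix K z assume po: "polytope_o (perp G e) K" "z \<in> perp G e" "polytope_o (perp G e) ((+) z ` K)"
        define z' where "z' = z + (- (n \<bullet> z) / (n \<bullet> e)) *\<^sub>R e"
        have nz: "n \<bullet> z' = 0" using n by (simp add: z'_def inner_diff_right)
        have zU: "z' \<in> G" using po G e by (simp add: z'_def perp_def subspace_add subspace_scale subspace_diff)
        have eq: "prism e n (L/2) (L/2) ((+) z ` K) = (+) z' ` prism e n (L/2) (L/2) K"
          unfolding prism_def cylinder_translate[OF z'_def] by (auto simp: inner_add_right nz)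
        have "polytope_o G (prism e n (L/2) (L/2) K)" "polytope_o G (prism e n (L/2) (L/2) ((+) z ` K))"
          using polytope_o_prism[OF G e _ n] po L by auto
        then show "l (prism e n (L/2) (L/2) ((+) z ` K)) = l (prism e n (L/2) (L/2) K)"
          using l(2) zU eq unfolding translation_inv_def by metis
      qed
      have h\<phi>: "\<phi> (2 * L) ((*\<^sub>R) 2 ` K) = 2 ^ j * \<phi> L K" if K: "polytope_o (perp G e) K" and L: "L > 0" for K L
      proof -
        have "prism e n L L ((*\<^sub>R) 2 ` K) = (*\<^sub>R) 2 ` prism e n (L/2) (L/2) K"
          unfolding prism_def using cylinder_scale[of 2 e K] by auto
        then show ?thesis using hom[OF polytope_o_prism[OF G e K n, of "L/2" "L/2"]] L by (simp add: \<phi>_def)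
      qed
      have hp: "polytope_o (perp G e) ((*\<^sub>R) 2 ` K)" if "polytope_o (perp G e) K" for K using polytope_o_scale[OF H that, of 2] by simp
      have c0: "\<phi> (2 * L) K = 2 * \<phi> L K" if K: "polytope_o (perp G e) K" and L: "L > 0" for K L
      proof -
        \<comment> \<open>Doubling \<open>K\<close> relates this to height \<open>2 L\<close> and \<open>4
          L\<close>; the constant part at both heights is the same because \<open>\<phi>\<close>
          is affine in the height.\<close>
        let ?c = "\<lambda>K. 2 * \<phi> L K + (-1) * \<phi> (2 * L) K"
        have "?c K = 0"
        proof (rule less.hyps[OF d H])
          show "valuation_on (perp G e) ?c" using valuation_on_linear_combination[OF v\<phi> v\<phi>, of L "2*L" 2 "-1"] L by simp
          show "translation_inv (perp G e) ?c" using t\<phi>[of L] t\<phi>[of "2*L"] L unfolding translation_inv_def by simp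
          show "?c ((*\<^sub>R) 2 ` K) = 2 ^ j * ?c K" if K: "polytope_o (perp G e) K" for K
          proof -
            have "?c ((*\<^sub>R) 2 ` K) = 2 * \<phi> (2 * L) ((*\<^sub>R) 2 ` K) - \<phi> (2 * (2 * L)) ((*\<^sub>R) 2 ` K)"
              using j3[OF hp[OF K] L] by simp
            moreover have "\<phi> (2 * (2 * L)) ((*\<^sub>R) 2 ` K) = 2 ^ j * \<phi> (2 * L) K"
              by (rule h\<phi>[OF K]) (use L in simp)
            ultimately show ?thesis using h\<phi>[OF K L] by (simp only: right_diff_distrib mult.left_commute mult_minus1 distrib_left)
          qed
        qed (use less.prems d K in auto)
        then show ?thesis by simp
      qed
      have "\<phi> L K = 0" if L: "L > 0" for L
      proof (rule less.hyps[OF d H v\<phi>[OF L] t\<phi>[OF L], of "j - 1"])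
        show "\<phi> L ((*\<^sub>R) 2 ` K) = 2 ^ (j - 1) * \<phi> L K" if K: "polytope_o (perp G e) K" for K
        proof -
          have "2 * \<phi> L ((*\<^sub>R) 2 ` K) = 2 ^ j * \<phi> L K" using c0[OF hp[OF K] L] h\<phi>[OF K L] by simp
          moreover have "(2::real) ^ j = 2 * 2 ^ (j - 1)" using less.prems(5) by (cases j) auto
          ultimately show ?thesis by simp
        qed
      qed (use less.prems d K in auto)
      then show ?thesis using \<phi>[OF K ab] ab by simp
    qed
    have PV: "vanishes_on_prisms G l"
      unfolding vanishes_on_prisms_def
    proof (intro allI impI)
      fix e A n and c :: real
      assume *: "e \<in> G" "e \<noteq> 0" "prism_base G e A" "0 < n \<bullet> e" "0 < c"
      have c: "halfs G A = cylinder e (halfs (perp G e) A)"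
        using cylinder_halfs[OF G *(1,2), of A] *(3) by (auto simp: prism_base_def)
      have "l (prism e n 1 (1/c) (halfs (perp G e) A)) = 0"
        using pv[OF *(1,2,4) prism_base_perp[OF G *(3)]] * by simp
      then show "l (halfs G (A \<union> {n, - (c *\<^sub>R n)})) = 0"
        using prism_halfs[OF c, of 1 "1/c" n] * by simp
    qed
    show ?thesis
    proof (rule vanish_if_roofs_vanish[OF G G0 l(1) PV _ less.prems(6)])
      fix e n K assume e: "e \<in> G" "e \<noteq> 0" and n: "0 < n \<bullet> e" and K: "polytope_o (perp G e) K"
      have d: "dim (perp G e) < dim G" using dim_perp[OF G e] .
      note H = subspace_perp[OF G, of e]
      show "roof l e n K = 0"
      proof (rule less.hyps[OF d H roof_valuation_on[OF G e l(1) PV n] roof_translation_inv[OF G e l(1) PV n]])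
        fix K assume K: "polytope_o (perp G e) K"
        have hp: "polytope_o (perp G e) ((*\<^sub>R) 2 ` K)" using polytope_o_scale[OF H K, of 2] by simp
        obtain M where M: "deep (cylinder e ((*\<^sub>R) 2 ` K)) e n M"
          using ev_at_top_happens[OF deep_cylinder_eventually[OF G e hp n]] by blast
        have c: "cylinder e ((*\<^sub>R) 2 ` K) = (*\<^sub>R) 2 ` cylinder e K" by (simp add: cylinder_scale)
        \<comment> \<open>Halving the roof over \<open>2 K\<close> moves its facet to half the distance, hence the
          factor 2 at the normal; \<open>roof_scale\<close> removes it again.\<close>
        have M': "deep (cylinder e K) e (2 *\<^sub>R n) (M / 2)"
          using M unfolding deep_def c by auto
        have n2: "0 < (2 *\<^sub>R n) \<bullet> e" using n by simp
        have "cut_cylinder e n M ((*\<^sub>R) 2 ` K) = (*\<^sub>R) 2 ` cut_cylinder e (2 *\<^sub>R n) (M / 2) K"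
          unfolding cut_cylinder_def c by auto
        moreover have "polytope_o G (cut_cylinder e (2 *\<^sub>R n) (M / 2) K)"
          using M' by (intro polytope_o_cut_cylinder[OF G e K n2]) (auto simp: deep_def)
        ultimately have "roof l e n ((*\<^sub>R) 2 ` K) = 2 ^ j * roof l e (2 *\<^sub>R n) K"
          using roof_eq[OF G e l(1) PV hp n M] roof_eq[OF G e l(1) PV K n2 M'] hom by simp
        then show "roof l e n ((*\<^sub>R) 2 ` K) = 2 ^ j * roof l e n K"
          using roof_scale[OF G e l(1) PV n _ K, of 2] by simp
      qed (use less.prems d K in auto)
    qed
  qed
qed

section \<open>Linear maps of determinant one\<close>

lemma det_comp:
  fixes f g :: "real^'n \<Rightarrow> real^'n"
  assumes "linear f" "linear g"
  shows "det (matrix (g \<circ> f)) = det (matrix g) * det (matrix f)"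
  using matrix_compose[OF assms] by (simp add: det_mul)

lemma linear_rank_one_update: "linear (\<lambda>x. x + (w \<bullet> x) *\<^sub>R (e :: 'a::real_inner))"
  by (rule linearI) (simp_all add: inner_add_right algebra_simps)

text \<open>A shear \<open>S\<close> is conjugate to its square, by the map that doubles the direction
  \<open>e\<close>. So \<open>det S = (det S)^2\<close>, and \<open>det S\<close> is not zero.\<close>
lemma det_shear:
  fixes e w :: "real^'n"
  assumes we: "w \<bullet> e = 0"
  shows "det (matrix (\<lambda>x. x + (w \<bullet> x) *\<^sub>R e)) = 1"
proof (cases "e = 0")
  case True
  then have "(\<lambda>x. x + (w \<bullet> x) *\<^sub>R e) = id" by auto
  then show ?thesis by (simp add: matrix_id_mat_1)
next
  case False
  let ?S = "\<lambda>x. x + (w \<bullet> x) *\<^sub>R e"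
  let ?S2 = "\<lambda>x. x + ((2 *\<^sub>R w) \<bullet> x) *\<^sub>R e"
  let ?B = "\<lambda>x. x + (((1 / (e \<bullet> e)) *\<^sub>R e) \<bullet> x) *\<^sub>R e"
  note lin = linear_rank_one_update[of w e] linear_rank_one_update[of "2 *\<^sub>R w" e] linear_rank_one_update[of "(1 / (e \<bullet> e)) *\<^sub>R e" e]
  have inj: "inj ?B"
    unfolding linear_injective_0[OF lin(3)]
  proof (intro allI impI)
    fix x assume x: "?B x = 0"
    have "e \<bullet> ?B x = 2 * (e \<bullet> x)" using False by (simp add: inner_add_right)
    then have "e \<bullet> x = 0" using x by simp
    then show "x = 0" using x by simp
  qed
  have dbl: "((2 *\<^sub>R w) \<bullet> x) *\<^sub>R e = (w \<bullet> x) *\<^sub>R e + (w \<bullet> x) *\<^sub>R e" for x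
    by (simp add: scaleR_left_distrib[symmetric])
  have wS: "w \<bullet> (x + c *\<^sub>R e) = w \<bullet> x" for x c using we by (simp add: inner_add_right)
  have "?S2 = ?S \<circ> ?S" unfolding dbl by (simp add: fun_eq_iff wS)
  then have 1: "det (matrix ?S2) = det (matrix ?S) * det (matrix ?S)"
    using det_comp[OF lin(1) lin(1)] by simp
  have eS: "((1 / (e \<bullet> e)) *\<^sub>R e) \<bullet> (x + c *\<^sub>R e) = ((1 / (e \<bullet> e)) *\<^sub>R e) \<bullet> x + c" for x c
    using False by (simp add: inner_add_right)
  have "?S2 \<circ> ?B = ?B \<circ> ?S"
    unfolding dbl by (simp only: fun_eq_iff o_def wS eS) (simp add: scaleR_left_distrib)
  then have "det (matrix ?S2) * det (matrix ?B) = det (matrix ?B) * det (matrix ?S)"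
    using det_comp[OF lin(3) lin(2)] det_comp[OF lin(1) lin(3)] by simp
  then have 2: "det (matrix ?S2) = det (matrix ?S)"
    using inj det_nz_iff_inj[OF lin(3)] by simp
  have "inj ?S"
    unfolding linear_injective_0[OF lin(1)]
  proof (intro allI impI)
    fix x assume x: "?S x = 0"
    have "w \<bullet> ?S x = w \<bullet> x" using we by (simp add: inner_add_right)
    then show "x = 0" using x by simp
  qed
  then have "det (matrix ?S) \<noteq> 0" using det_nz_iff_inj[OF lin(1)] by blast
  then show ?thesis using 1 2 by simp
qed

definition diag_map :: "('n \<Rightarrow> real) \<Rightarrow> real^'n \<Rightarrow> real^'n" where
  "diag_map d x = (\<chi> k. d k * x $ k)"

lemma linear_diag_map: "linear (diag_map d)"
  by (rule linearI) (simp_all add: diag_map_def vec_eq_iff algebra_simps)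

lemma det_diag_map: "det (matrix (diag_map d)) = prod d UNIV"
proof -
  have "det (matrix (diag_map d)) = (\<Prod>i\<in>UNIV. matrix (diag_map d) $ i $ i)"
    by (rule det_diagonal) (simp add: matrix_def diag_map_def axis_def)
  then show ?thesis by (simp add: matrix_def diag_map_def axis_def)
qed

text \<open>The coordinates outside \<open>I\<close> are set to zero, so the image lies in the same space
  \<open>real^'n\<close> and no change of dimension is needed.\<close>
definition coord_proj :: "'n set \<Rightarrow> real^'n \<Rightarrow> real^'n" where
  "coord_proj I x = (\<chi> k. if k \<in> I then x $ k else 0)"

definition coord_space :: "'n set \<Rightarrow> (real^'n) set" where
  "coord_space I = {x. \<forall>k. k \<notin> I \<longrightarrow> x $ k = 0}"

lemma subspace_coord_space: "subspace (coord_space I)"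
  by (auto simp: subspace_def coord_space_def)

lemma dim_coord_space: "dim (coord_space I :: (real^'n) set) = card I"
  using dim_substandard_cart[where 'a = real and 'n = 'n and d = I] unfolding coord_space_def dim_vec_eq .

lemma linear_coord_proj: "linear (coord_proj I)"
  by (rule linearI) (auto simp: coord_proj_def vec_eq_iff)

lemma coord_proj_in [simp]: "coord_proj I x \<in> coord_space I"
  by (simp add: coord_proj_def coord_space_def)

lemma coord_proj_id: "x \<in> coord_space I \<Longrightarrow> coord_proj I x = x"
  by (auto simp: coord_proj_def coord_space_def vec_eq_iff)

lemma coord_proj_inner: "n \<in> coord_space I \<Longrightarrow> n \<bullet> coord_proj I x = n \<bullet> x"
  unfolding inner_vec_def by (rule sum.cong) (auto simp: coord_proj_def coord_space_def)

lemma coord_proj_inner': "x \<in> coord_space I \<Longrightarrow> coord_proj I n \<bullet> x = n \<bullet> x"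
  using coord_proj_inner[of x I n] by (simp add: inner_commute)

text \<open>Stretches the axis \<open>e\<close> by \<open>2^(card I - 1)\<close>, halves the orthogonal
  complement of \<open>e\<close> in \<open>coord_space I\<close>, which has dimension \<open>card
  I - 1\<close>, and fixes the other coordinates.\<close>
definition unimod_stretch :: "'n set \<Rightarrow> real^'n \<Rightarrow> real^'n \<Rightarrow> real^'n" where
  "unimod_stretch I e x = coord_proj (-I) x + (1/2) *\<^sub>R (coord_proj I x - ((e \<bullet> x) / (e \<bullet> e)) *\<^sub>R e)
     + (2 ^ (card I - 1) * ((e \<bullet> x) / (e \<bullet> e))) *\<^sub>R e"

lemma linear_unimod_stretch: "linear (unimod_stretch I e)"
  by (rule linearI)
     (simp_all add: unimod_stretch_def linear_add[OF linear_coord_proj] linear_scale[OF linear_coord_proj]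
       inner_add_right add_divide_distrib algebra_simps)

text \<open>The map \<open>R\<close> below carries one coordinate axis in \<open>I\<close> to
  \<open>e\<close> and the others into the orthogonal complement of \<open>e\<close>; it
  conjugates the stretch to a diagonal matrix.\<close>
lemma det_unimod_stretch:
  fixes e :: "real^'n"
  assumes e: "e \<in> coord_space I" "e \<noteq> 0"
  shows "det (matrix (unimod_stretch I e)) = 1"
proof -
  obtain k where k: "e $ k \<noteq> 0" using e(2) by (auto simp: vec_eq_iff)
  then have kI: "k \<in> I" using e(1) by (auto simp: coord_space_def)
  let ?m = "card I"
  define d where "d = (\<lambda>j. if j = k then 2 ^ (?m - 1) else if j \<in> I then 1/2 else (1::real))"
  define z where "z = (\<lambda>y::real^'n. y - (y $ k) *\<^sub>R axis k 1)"
  define R where "R = (\<lambda>y. z y - ((e \<bullet> z y) / (e \<bullet> e)) *\<^sub>R e + (y $ k) *\<^sub>R e)"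
  have lz: "linear z" unfolding z_def by (rule linearI) (simp_all add: algebra_simps)
  have lR: "linear R" unfolding R_def
    by (rule linearI)
       (simp_all add: linear_add[OF lz] linear_scale[OF lz] inner_add_right add_divide_distrib algebra_simps)
  have ee: "e \<bullet> e \<noteq> 0" using e by simp
  have Re: "e \<bullet> R y = y $ k * (e \<bullet> e)" for y
    using ee by (simp add: R_def inner_add_right inner_diff_right)
  have rI: "coord_proj I (R y) = coord_proj I (z y) - ((e \<bullet> z y) / (e \<bullet> e)) *\<^sub>R e + (y $ k) *\<^sub>R e" for y
    unfolding R_def using coord_proj_id[OF e(1)]
    by (simp add: linear_add[OF linear_coord_proj] linear_diff[OF linear_coord_proj] linear_scale[OF linear_coord_proj])
  have re: "coord_proj (-I) e = 0" using e(1) by (auto simp: coord_proj_def coord_space_def vec_eq_iff)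
  have rN: "coord_proj (-I) (R y) = coord_proj (-I) (z y)" for y
    unfolding R_def
    by (simp add: linear_add[OF linear_coord_proj] linear_diff[OF linear_coord_proj] linear_scale[OF linear_coord_proj] re)
  have zd: "z (diag_map d y) = coord_proj (-I) (z y) + (1/2) *\<^sub>R coord_proj I (z y)" for y
    using kI by (auto simp: z_def diag_map_def d_def coord_proj_def vec_eq_iff axis_def)
  have ez: "e \<bullet> coord_proj (-I) x = 0" for x
    unfolding inner_vec_def by (rule sum.neutral) (use e(1) in \<open>auto simp: coord_proj_def coord_space_def\<close>)
  have "unimod_stretch I e \<circ> R = R \<circ> diag_map d"
  proof
    fix y
    have "unimod_stretch I e (R y) = coord_proj (-I) (z y) + (1/2) *\<^sub>R (coord_proj I (z y) - ((e \<bullet> z y) / (e \<bullet> e)) *\<^sub>R e)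
        + (2 ^ (?m - 1) * (y $ k)) *\<^sub>R e"
      unfolding unimod_stretch_def rI rN Re using ee by (simp add: algebra_simps)
    moreover have "R (diag_map d y) = coord_proj (-I) (z y) + (1/2) *\<^sub>R coord_proj I (z y)
        - ((e \<bullet> ((1/2) *\<^sub>R coord_proj I (z y))) / (e \<bullet> e)) *\<^sub>R e + (2 ^ (?m - 1) * (y $ k)) *\<^sub>R e"
      unfolding R_def zd inner_add_right ez by (simp add: diag_map_def d_def)
    ultimately show "(unimod_stretch I e \<circ> R) y = (R \<circ> diag_map d) y"
      unfolding coord_proj_inner[OF e(1)] inner_scaleR_right o_def by (simp add: scaleR_right_diff_distrib)
  qed
  then have "det (matrix (unimod_stretch I e)) * det (matrix R) = det (matrix R) * det (matrix (diag_map d))"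
    by (simp only: det_comp[OF lR linear_unimod_stretch, symmetric] det_comp[OF linear_diag_map lR, symmetric])
  moreover have "inj R"
    unfolding linear_injective_0[OF lR]
  proof (intro allI impI)
    fix y assume y: "R y = 0"
    then have yk: "y $ k = 0" using Re[of y] ee by simp
    then have zy: "z y = ((e \<bullet> z y) / (e \<bullet> e)) *\<^sub>R e" using y by (simp add: R_def)
    have "(z y) $ k = (((e \<bullet> z y) / (e \<bullet> e)) *\<^sub>R e) $ k" by (rule arg_cong[OF zy])
    also have "\<dots> = ((e \<bullet> z y) / (e \<bullet> e)) * e $ k" by simp
    finally have "(z y) $ k = ((e \<bullet> z y) / (e \<bullet> e)) * e $ k" .
    moreover have "(z y) $ k = 0" using yk by (simp add: z_def)
    ultimately have c0: "(e \<bullet> z y) / (e \<bullet> e) = 0" using k by simp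
    have "z y = 0" using zy unfolding c0 by simp
    then show "y = 0" using yk by (simp add: z_def)
  qed
  then have "det (matrix R) \<noteq> 0" using det_nz_iff_inj[OF lR] by blast
  moreover have "prod d UNIV = 1"
  proof -
    have "prod d UNIV = prod d I"
      by (rule prod.mono_neutral_right) (use kI in \<open>auto simp: d_def\<close>)
    also have "\<dots> = d k * prod d (I - {k})" using kI by (simp add: prod.remove)
    also have "prod d (I - {k}) = (\<Prod>j\<in>I - {k}. 1/2)" by (rule prod.cong) (auto simp: d_def)
    also have "d k * \<dots> = 2 ^ (?m - 1) * (1/2) ^ (?m - 1)" using kI by (simp add: d_def)
    also have "\<dots> = 1" by (simp add: power_mult_distrib[symmetric])
    finally show ?thesis .
  qed
  ultimately show ?thesis using det_diag_map[of d] by simp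
qed

section \<open>Invariant valuations that vanish on boxes\<close>

definition SL_invariant :: "((real^'n) set \<Rightarrow> real) \<Rightarrow> bool" where
  "SL_invariant \<tau> \<longleftrightarrow> (\<forall>g P. linear g \<longrightarrow> det (matrix g) = 1 \<longrightarrow> polytope_o UNIV P \<longrightarrow> \<tau> (g ` P) = \<tau> P)"

definition axis_box :: "('n \<Rightarrow> real) \<Rightarrow> ('n \<Rightarrow> real) \<Rightarrow> (real^'n) set" where
  "axis_box p q = {x. \<forall>k. - p k \<le> x $ k \<and> x $ k \<le> q k}"

text \<open>The class of valuations to be shown trivial. It is closed under composition with arbitrary
  invertible linear maps, which the induction uses.\<close>
definition null_on_boxes :: "((real^'n) set \<Rightarrow> real) \<Rightarrow> bool" where
  "null_on_boxes \<tau> \<longleftrightarrow> valuation_on UNIV \<tau> \<and> SL_invariant \<tau> \<and> (\<forall>p q. (\<forall>k. 0 < p k) \<longrightarrow> (\<forall>k. 0 < q k) \<longrightarrow> \<tau> (axis_box p q) = 0)"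

lemma axis_box_cbox: "axis_box p q = cbox (\<chi> k. - p k) (\<chi> k. q k)"
  by (simp add: axis_box_def cbox_def Basis_vec_def inner_axis)

lemma polytope_o_axis_box:
  fixes p q :: "'n::finite \<Rightarrow> real"
  assumes "\<And>k. 0 < p k" "\<And>k. 0 < q k"
  shows "polytope_o UNIV (axis_box p q)"
proof -
  have "0 \<in> interior (axis_box p q)" using assms by (simp add: axis_box_cbox interior_cbox mem_box_cart)
  then show ?thesis unfolding mem_interior polytope_o_def by (simp add: axis_box_cbox polytope_interval)
qed

lemma polytope_o_linear_image:
  fixes g :: "'a::euclidean_space \<Rightarrow> 'a"
  assumes "linear g" "inj g" "polytope_o UNIV P"
  shows "polytope_o UNIV (g ` P)"
proof -
  obtain d where d: "d > 0" "ball 0 d \<subseteq> P" "polytope P" using assms(3) by (auto simp: polytope_o_def)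
  have "polytope (g ` P)" using polytope_linear_image[OF assms(1) d(3)] .
  moreover have "open (g ` ball 0 d)"
    using assms by (intro open_surjective_linear_image linear_injective_imp_surjective) auto
  moreover have "0 \<in> g ` ball 0 d" using linear_0[OF assms(1)] d by force
  ultimately obtain e where "e > 0" "ball 0 e \<subseteq> g ` ball 0 d" by (meson open_contains_ball)
  then have "ball 0 e \<inter> UNIV \<subseteq> g ` P" using d by blast
  then show ?thesis using \<open>polytope (g ` P)\<close> \<open>e > 0\<close> by (auto simp: polytope_o_def)
qed

lemma diag_map_box:
  assumes "\<And>k. d k \<noteq> 0" "\<And>k. 0 < p k" "\<And>k. 0 < q k"
  shows "\<exists>p' q'. (\<forall>k. 0 < p' k) \<and> (\<forall>k. 0 < q' k) \<and> diag_map d ` axis_box p q = axis_box p' q'"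
proof -
  define p' where "p' = (\<lambda>k. if d k > 0 then d k * p k else - d k * q k)"
  define q' where "q' = (\<lambda>k. if d k > 0 then d k * q k else - d k * p k)"
  have pos: "0 < p' k" "0 < q' k" for k
    using assms[of k] by (auto simp: p'_def q'_def mult_neg_pos)
  have iff: "- p k \<le> x \<and> x \<le> q k \<longleftrightarrow> - p' k \<le> d k * x \<and> d k * x \<le> q' k" for k x
  proof (cases "d k > 0")
    case True
    then have "- p' k \<le> d k * x \<longleftrightarrow> - p k \<le> x" "d k * x \<le> q' k \<longleftrightarrow> x \<le> q k"
      using mult_le_cancel_left_pos[OF True, of "- p k" x] mult_le_cancel_left_pos[OF True, of x "q k"]
      by (simp_all add: p'_def q'_def)
    then show ?thesis by simp
  next
    case False
    then have neg: "d k < 0" using assms(1)[of k] by simp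
    then have "- p' k \<le> d k * x \<longleftrightarrow> x \<le> q k" "d k * x \<le> q' k \<longleftrightarrow> - p k \<le> x"
      using mult_le_cancel_left_neg[OF neg, of "q k" x] mult_le_cancel_left_neg[OF neg, of x "- p k"]
      by (simp_all add: p'_def q'_def)
    then show ?thesis by auto
  qed
  have "diag_map d ` axis_box p q = axis_box p' q'"
  proof (intro equalityI subsetI)
    fix y assume y: "y \<in> axis_box p' q'"
    have y': "y = diag_map d (\<chi> k. y $ k / d k)" using assms(1) by (simp add: diag_map_def vec_eq_iff)
    have "(\<chi> k. y $ k / d k) \<in> axis_box p q"
      unfolding axis_box_def using iff y assms(1) by (auto simp: axis_box_def)
    then show "y \<in> diag_map d ` axis_box p q" using y' by blast
  qed (use iff in \<open>auto simp: axis_box_def diag_map_def\<close>)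
  then show ?thesis using pos by blast
qed

text \<open>Determinant one of a conjugated map is preserved. For boxes, \<open>g\<close> factors into a map
  of determinant one and a diagonal map, and diagonal maps send boxes to boxes.\<close>
lemma null_on_boxes_linear:
  fixes g :: "real^'n \<Rightarrow> real^'n"
  assumes c: "null_on_boxes \<tau>" and g: "linear g" "inj g"
  shows "null_on_boxes (\<lambda>P. \<tau> (g ` P))"
  unfolding null_on_boxes_def
proof (intro conjI allI impI)
  have v: "valuation_on UNIV \<tau>" and s: "SL_invariant \<tau>"
    and b: "\<And>p q. (\<forall>k. 0 < p k) \<Longrightarrow> (\<forall>k. 0 < q k) \<Longrightarrow> \<tau> (axis_box p q) = 0" using c by (auto simp: null_on_boxes_def)
  show "valuation_on UNIV (\<lambda>P. \<tau> (g ` P))"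
    unfolding valuation_on_def
  proof (intro allI impI)
    fix P Q :: "(real^'n) set" assume po: "polytope_o UNIV P" "polytope_o UNIV Q" "polytope_o UNIV (P \<union> Q)" "polytope_o UNIV (P \<inter> Q)"
    show "\<tau> (g ` (P \<union> Q)) + \<tau> (g ` (P \<inter> Q)) = \<tau> (g ` P) + \<tau> (g ` Q)"
      by (rule valuation_on_split[OF v polytope_o_linear_image[OF g po(1)] polytope_o_linear_image[OF g po(2)] polytope_o_linear_image[OF g po(3)]])
         (simp_all only: image_Un image_Int[OF g(2)])
  qed
  obtain h where h: "linear h" "h \<circ> g = id" "g \<circ> h = id"
    using linear_injective_isomorphism[OF g] by (auto simp: fun_eq_iff)
  have dgh: "det (matrix g) * det (matrix h) = 1"
    using det_comp[OF h(1) g(1)] h(3) by (simp add: matrix_id_mat_1)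
  show "SL_invariant (\<lambda>P. \<tau> (g ` P))"
    unfolding SL_invariant_def
  proof (intro allI impI)
    fix f :: "real^'n \<Rightarrow> real^'n" and P :: "(real^'n) set" assume f: "linear f" "det (matrix f) = 1" and P: "polytope_o UNIV P"
    have l: "linear (g \<circ> f)" "linear (g \<circ> f \<circ> h)" using f g h by (auto intro: linear_compose)
    have "det (matrix (g \<circ> f \<circ> h)) = 1"
      unfolding det_comp[OF h(1) l(1)] det_comp[OF f(1) g(1)] f(2) using dgh by (simp only: mult_1_right)
    then have "\<tau> ((g \<circ> f \<circ> h) ` (g ` P)) = \<tau> (g ` P)"
      using s l(2) polytope_o_linear_image[OF g P] unfolding SL_invariant_def by blast
    moreover have "(g \<circ> f \<circ> h) ` (g ` P) = g ` f ` P"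
      using h(2) by (auto simp: image_image fun_eq_iff)
    ultimately show "\<tau> (g ` f ` P) = \<tau> (g ` P)" by simp
  qed
  fix p q :: "'n \<Rightarrow> real" assume pq: "\<forall>k. 0 < p k" "\<forall>k. 0 < q k"
  \<comment> \<open>Any coordinate can absorb the determinant.\<close>
  define k0 :: 'n where "k0 = undefined"
  define d where "d = (\<lambda>k. if k = k0 then det (matrix g) else 1)"
  define d' where "d' = (\<lambda>k. if k = k0 then 1 / det (matrix g) else 1)"
  have dz: "det (matrix g) \<noteq> 0" using det_nz_iff_inj[OF g(1)] g(2) by blast
  have dd: "diag_map d' (diag_map d x) = x" for x using dz by (simp add: diag_map_def d_def d'_def vec_eq_iff)
  have pd: "prod d' UNIV = 1 / det (matrix g)"
    unfolding d'_def by simp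
  have l: "linear (g \<circ> diag_map d')" using g linear_diag_map linear_compose by blast
  have dt: "det (matrix (g \<circ> diag_map d')) = 1"
    using det_comp[OF linear_diag_map g(1), of d'] det_diag_map[of d'] pd dz by simp
  have dn: "d k \<noteq> 0" for k using dz by (simp add: d_def)
  obtain p' q' where pq': "\<And>k. 0 < p' k" "\<And>k. 0 < q' k" "diag_map d ` axis_box p q = axis_box p' q'"
    using diag_map_box[of d p q] dn pq by auto
  have poB: "polytope_o UNIV (axis_box p' q')" by (rule polytope_o_axis_box; rule pq')
  have "\<tau> (g ` axis_box p q) = \<tau> ((g \<circ> diag_map d') ` axis_box p' q')"
    unfolding pq'(3)[symmetric] by (simp add: image_image dd)
  also have "\<dots> = \<tau> (axis_box p' q')" using s l dt poB unfolding SL_invariant_def by blast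
  also have "\<dots> = 0" using b pq' by blast
  finally show "\<tau> (g ` axis_box p q) = 0" .
qed

text \<open>The product of \<open>P\<close>, a polytope in the coordinates \<open>I\<close>, with the box
  \<open>p\<close>, \<open>q\<close> in the remaining coordinates.\<close>
definition box_join :: "'n set \<Rightarrow> ('n \<Rightarrow> real) \<Rightarrow> ('n \<Rightarrow> real) \<Rightarrow> (real^'n) set \<Rightarrow> (real^'n) set" where
  "box_join I p q P = {x. coord_proj I x \<in> P \<and> (\<forall>k. k \<notin> I \<longrightarrow> - p k \<le> x $ k \<and> x $ k \<le> q k)}"

lemma polytope_o_box_join:
  fixes P :: "(real^'n) set"
  assumes P: "polytope_o (coord_space I) P" and pq: "\<And>k. 0 < p k" "\<And>k. 0 < q k"
  shows "polytope_o UNIV (box_join I p q P)"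
proof -
  obtain N where N: "finite N" "N \<subseteq> coord_space I" "P = halfs (coord_space I) N"
    using polytope_o_imp_halfs[OF subspace_coord_space P] by metis
  let ?N = "N \<union> (\<lambda>k. axis k (1 / q k)) ` (-I) \<union> (\<lambda>k. axis k (- (1 / p k))) ` (-I)"
  have iq: "axis k (1 / q k) \<bullet> x \<le> 1 \<longleftrightarrow> x $ k \<le> q k" for k and x :: "real^'n"
    using pq(2)[of k] by (simp add: inner_axis' pos_divide_le_eq)
  have ip: "axis k (- (1 / p k)) \<bullet> x \<le> 1 \<longleftrightarrow> - p k \<le> x $ k" for k and x :: "real^'n"
    using pq(1)[of k] by (simp add: inner_axis' field_simps)
  have iN: "n \<bullet> coord_proj I x = n \<bullet> x" if "n \<in> N" for n x using coord_proj_inner N(2) that by blast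
  have eq: "box_join I p q P = halfs UNIV ?N"
    by (auto simp: box_join_def N(3) halfs_def iq ip iN ball_Un)
  obtain R where R: "\<And>x. x \<in> P \<Longrightarrow> norm x \<le> R" using polytope_o_bounded[OF P] by (auto simp: bounded_iff)
  have "bounded (box_join I p q P)"
    unfolding bounded_iff
  proof (intro exI ballI)
    fix x assume x: "x \<in> box_join I p q P"
    have "\<bar>x $ k\<bar> \<le> \<bar>R\<bar> + p k + q k" for k
    proof (cases "k \<in> I")
      case True
      then have "x $ k = coord_proj I x $ k" by (simp add: coord_proj_def)
      moreover have "\<bar>coord_proj I x $ k\<bar> \<le> norm (coord_proj I x)" by (rule component_le_norm_cart)
      moreover have "norm (coord_proj I x) \<le> R" using R x by (auto simp: box_join_def)
      ultimately show ?thesis using pq(1)[of k] pq(2)[of k] by linarith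
    next
      case False
      then have "- p k \<le> x $ k" "x $ k \<le> q k" using x by (auto simp: box_join_def)
      then show ?thesis using pq(1)[of k] pq(2)[of k] by linarith
    qed
    then have "(\<Sum>k\<in>UNIV. \<bar>x $ k\<bar>) \<le> (\<Sum>k\<in>UNIV. \<bar>R\<bar> + p k + q k)" by (intro sum_mono)
    then show "norm x \<le> (\<Sum>k\<in>UNIV. \<bar>R\<bar> + p k + q k)" using norm_le_l1_cart[of x] by linarith
  qed
  then show ?thesis unfolding eq using N(1) by (intro polytope_o_halfs) auto
qed

lemma box_join_valuation_on:
  fixes \<tau> :: "(real^'n) set \<Rightarrow> real" and I :: "'n set"
  assumes "valuation_on UNIV \<tau>" and pq: "\<And>k. 0 < p k" "\<And>k. 0 < q k"
  shows "valuation_on (coord_space I) (\<lambda>P. \<tau> (box_join I p q P))"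
  unfolding valuation_on_def
proof (intro allI impI)
  fix P Q :: "(real^'n) set" assume po: "polytope_o (coord_space I) P" "polytope_o (coord_space I) Q" "polytope_o (coord_space I) (P \<union> Q)" "polytope_o (coord_space I) (P \<inter> Q)"
  show "\<tau> (box_join I p q (P \<union> Q)) + \<tau> (box_join I p q (P \<inter> Q)) = \<tau> (box_join I p q P) + \<tau> (box_join I p q Q)"
    by (rule valuation_on_split[OF assms(1) polytope_o_box_join[OF po(1) pq] polytope_o_box_join[OF po(2) pq] polytope_o_box_join[OF po(3) pq]])
       (auto simp: box_join_def)
qed

text \<open>A map of determinant one that acts only on the coordinates in \<open>I\<close> can be applied to
  the factor \<open>P\<close>.\<close>
lemma box_join_linear:
  fixes g :: "real^'n \<Rightarrow> real^'n"
  assumes s: "SL_invariant \<tau>" and g: "linear g" "det (matrix g) = 1"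
    and a: "\<And>x. coord_proj I (g x) = g (coord_proj I x)" and b: "\<And>x k. k \<notin> I \<Longrightarrow> (g x) $ k = x $ k"
    and P: "polytope_o (coord_space I) P" and pq: "\<And>k. 0 < p k" "\<And>k. 0 < q k"
  shows "\<tau> (box_join I p q (g ` P)) = \<tau> (box_join I p q P)"
proof -
  have inj: "inj g" using det_nz_iff_inj[OF g(1)] g(2) by simp
  have surj: "surj g" using linear_injective_imp_surjective[OF g(1) inj] by auto
  have "box_join I p q (g ` P) = g ` box_join I p q P"
  proof (intro equalityI subsetI)
    fix y assume y: "y \<in> box_join I p q (g ` P)"
    obtain x where x: "y = g x" using surj by blast
    have "g (coord_proj I x) \<in> g ` P" using y a x by (auto simp: box_join_def)
    then have "coord_proj I x \<in> P" using inj by (auto simp: inj_image_mem_iff)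
    then have "x \<in> box_join I p q P" using y b x by (auto simp: box_join_def)
    then show "y \<in> g ` box_join I p q P" using x by blast
  qed (use a b in \<open>auto simp: box_join_def\<close>)
  then show ?thesis using s g polytope_o_box_join[OF P pq] unfolding SL_invariant_def by simp
qed

lemma roof_cong: "(\<And>y. y \<in> cylinder e K \<Longrightarrow> n \<bullet> y = n' \<bullet> y) \<Longrightarrow> roof f e n K = roof f e n' K"
proof -
  assume *: "\<And>y. y \<in> cylinder e K \<Longrightarrow> n \<bullet> y = n' \<bullet> y"
  have "cut_cylinder e n M K = cut_cylinder e n' M K" for M using * by (auto simp: cut_cylinder_def)
  moreover have "deep (cylinder e K) e n = deep (cylinder e K) e n'" using * by (simp add: deep_def fun_eq_iff)
  ultimately show ?thesis unfolding roof_def by simp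
qed

text \<open>For a facet normal \<open>e + \<sigma>\<close> with \<open>\<sigma>\<close> orthogonal to the
  axis, \<open>\<sigma>\<close> is called the slope. The roof of slope \<open>2 \<sigma>\<close>
  and a prism with oblique ends of slope \<open>\<sigma>\<close> have as their union a roof of
  slope \<open>\<sigma>\<close>; their intersection has a facet of slope \<open>2 \<sigma>\<close>
  and a floor of slope \<open>\<sigma>\<close>, and a shear turns it into a roof of slope
  \<open>\<sigma>\<close> over a horizontal floor. The prism has value zero.\<close>
lemma roof_double:
  assumes U: "subspace U" "e \<in> U" "e \<noteq> 0" and f: "valuation_on U f" "vanishes_on_prisms U f"
    and \<sigma>: "\<sigma> \<in> U" "\<sigma> \<bullet> e = 0" and K: "polytope_o (perp U e) K"
    and shear: "\<And>P w. polytope_o U P \<Longrightarrow> w \<in> U \<Longrightarrow> w \<bullet> e = 0 \<Longrightarrow> f ((\<lambda>x. x + (w \<bullet> x) *\<^sub>R e) ` P) = f P"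
  shows "roof f e (e + 2 *\<^sub>R \<sigma>) K = 2 * roof f e (e + \<sigma>) K"
proof -
  obtain A where A: "prism_base U e A" "halfs U A = cylinder e K" using polytope_o_perp_cylinder[OF U K] by metis
  have ee: "e \<bullet> e > 0" using U by simp
  have \<sigma>': "e \<bullet> \<sigma> = 0" using \<sigma> by (simp add: inner_commute)
  have n1: "0 < (e + \<sigma>) \<bullet> e" "0 < (e + 2 *\<^sub>R \<sigma>) \<bullet> e" using ee \<sigma> by (simp_all add: inner_add_left)
  obtain R where R: "\<And>x. x \<in> K \<Longrightarrow> norm x \<le> R" using polytope_o_bounded[OF K] by (auto simp: bounded_iff)
  define C where "C = norm \<sigma> * \<bar>R\<bar> + 1"
  have C0: "C > 0" unfolding C_def using mult_nonneg_nonneg[OF norm_ge_zero[of \<sigma>] abs_ge_zero[of R]] by linarith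
  have C: "\<bar>\<sigma> \<bullet> y\<bar> \<le> C" if yc: "y \<in> cylinder e K" for y
  proof -
    obtain x t where x: "x \<in> K" "y = x + t *\<^sub>R e" using yc by (rule cylE)
    have "\<sigma> \<bullet> y = \<sigma> \<bullet> x" using x \<sigma> by (simp add: inner_add_right)
    moreover have "\<bar>\<sigma> \<bullet> x\<bar> \<le> norm \<sigma> * norm x" by (rule Cauchy_Schwarz_ineq2)
    moreover have "norm \<sigma> * norm x \<le> norm \<sigma> * \<bar>R\<bar>" using R[OF x(1)] by (intro mult_left_mono) auto
    ultimately show ?thesis unfolding C_def by linarith
  qed
  define N where "N = 1 + C"
  \<comment> \<open>A plane of slope \<open>\<sigma>\<close> so high that it lies above the facet of slope
    \<open>2 \<sigma>\<close> everywhere in the cylinder; \<open>C\<close> bounds the variation of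
    \<open>\<sigma>\<close>.\<close>
  define t2 where "t2 = (1 / N) *\<^sub>R (e + \<sigma>)"
  have N0: "N > 0" using C0 by (simp add: N_def)
  have t2: "0 < t2 \<bullet> e" using n1(1) N0 by (simp add: t2_def)
  have t2i: "t2 \<bullet> y \<le> 1 \<longleftrightarrow> e \<bullet> y + \<sigma> \<bullet> y \<le> N" for y
    using N0 by (simp add: t2_def inner_add_left pos_divide_le_eq)
  obtain M1 where M1: "\<And>M. M \<ge> M1 \<Longrightarrow> deep (cylinder e K) e (e + \<sigma>) M"
    using deep_cylinder_eventually[OF U K n1(1)] unfolding eventually_at_top_linorder by blast
  obtain M2 where M2: "\<And>M. M \<ge> M2 \<Longrightarrow> deep (cylinder e K) e (e + 2 *\<^sub>R \<sigma>) M"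
    using deep_cylinder_eventually[OF U K n1(2)] unfolding eventually_at_top_linorder by blast
  obtain M3 where M3: "\<And>M. M \<ge> M3 \<Longrightarrow> deep (cylinder e K) e t2 M"
    using deep_cylinder_eventually[OF U K t2] unfolding eventually_at_top_linorder by blast
  define M where "M = Max {M1, M2, M3, C}"
  define M' where "M' = M + C"
  have M: "M1 \<le> M" "M2 \<le> M'" "M3 \<le> M'" "C \<le> M" "0 < M" "0 < M'"
    using C0 by (auto simp: M_def M'_def max_def)
  \<comment> \<open>The oblique floor, parallel to \<open>t2\<close>; it stays above the horizontal floor at depth
    \<open>M'\<close>.\<close>
  define b1 where "b1 = - ((1 / M) *\<^sub>R (e + \<sigma>))"
  have b1: "b1 \<bullet> y \<le> 1 \<longleftrightarrow> - (e \<bullet> y + \<sigma> \<bullet> y) \<le> M" for y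
    using floor_normal_iff[OF M(5), of "e + \<sigma>" y] by (simp add: b1_def floor_normal_def inner_add_left)
  let ?t1 = "e + 2 *\<^sub>R \<sigma>"
  have t1: "?t1 \<bullet> y = e \<bullet> y + 2 * (\<sigma> \<bullet> y)" for y by (simp add: inner_add_left)
  have "f (halfs U (A \<union> {t2, floor_normal e M'})) + f (halfs U (A \<union> {?t1, b1}))
      = f (halfs U (A \<union> {?t1, floor_normal e M'})) + f (halfs U (A \<union> {t2, b1}))"
  proof (rule valuation_on_halfs[OF U(1) f(1)])
    show "bounded (halfs U (A \<union> {t2, floor_normal e M'}))"
      by (rule prism_base_bounded[OF A(1) U t2 floor_normal_neg[OF M(6) U(3)]]) auto
    show "halfs U (A \<union> {?t1, floor_normal e M'}) \<union> halfs U (A \<union> {t2, b1}) = halfs U (A \<union> {t2, floor_normal e M'})"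
    proof (intro equalityI subsetI)
      fix y assume y: "y \<in> halfs U (A \<union> {?t1, floor_normal e M'}) \<union> halfs U (A \<union> {t2, b1})"
      then have yA: "y \<in> halfs U A" by (auto simp: halfs_def)
      have "\<bar>\<sigma> \<bullet> y\<bar> \<le> C" using C yA A(2) by simp
      moreover have "(e \<bullet> y + 2 * (\<sigma> \<bullet> y) \<le> 1 \<and> - (e \<bullet> y) \<le> M') \<or> (e \<bullet> y + \<sigma> \<bullet> y \<le> N \<and> - (e \<bullet> y + \<sigma> \<bullet> y) \<le> M)"
        using y unfolding halfs_def by (auto simp: t1 floor_normal_iff[OF M(6)] t2i b1)
      ultimately have "e \<bullet> y + \<sigma> \<bullet> y \<le> N \<and> - (e \<bullet> y) \<le> M'" unfolding N_def M'_def by linarith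
      then show "y \<in> halfs U (A \<union> {t2, floor_normal e M'})"
        using yA unfolding halfs_def by (auto simp: floor_normal_iff[OF M(6)] t2i)
    next
      fix y assume y: "y \<in> halfs U (A \<union> {t2, floor_normal e M'})"
      then have yA: "y \<in> halfs U A" by (auto simp: halfs_def)
      have "\<bar>\<sigma> \<bullet> y\<bar> \<le> C" using C yA A(2) by simp
      moreover have "e \<bullet> y + \<sigma> \<bullet> y \<le> N \<and> - (e \<bullet> y) \<le> M'"
        using y unfolding halfs_def by (auto simp: floor_normal_iff[OF M(6)] t2i)
      ultimately have "(e \<bullet> y + 2 * (\<sigma> \<bullet> y) \<le> 1 \<and> - (e \<bullet> y) \<le> M') \<or> (e \<bullet> y + \<sigma> \<bullet> y \<le> N \<and> - (e \<bullet> y + \<sigma> \<bullet> y) \<le> M)"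
        using M(4) by linarith
      then show "y \<in> halfs U (A \<union> {?t1, floor_normal e M'}) \<union> halfs U (A \<union> {t2, b1})"
        using yA unfolding halfs_def by (auto simp: t1 floor_normal_iff[OF M(6)] t2i b1)
    qed
    show "halfs U (A \<union> {?t1, floor_normal e M'}) \<inter> halfs U (A \<union> {t2, b1}) = halfs U (A \<union> {?t1, b1})"
    proof (intro equalityI subsetI)
      fix y assume y: "y \<in> halfs U (A \<union> {?t1, b1})"
      then have yA: "y \<in> halfs U A" by (auto simp: halfs_def)
      have "\<bar>\<sigma> \<bullet> y\<bar> \<le> C" using C yA A(2) by simp
      moreover have *: "e \<bullet> y + 2 * (\<sigma> \<bullet> y) \<le> 1 \<and> - (e \<bullet> y + \<sigma> \<bullet> y) \<le> M"
        using y unfolding halfs_def by (auto simp: t1 b1)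
      ultimately have "e \<bullet> y + \<sigma> \<bullet> y \<le> N \<and> - (e \<bullet> y) \<le> M'" unfolding N_def M'_def by linarith
      then show "y \<in> halfs U (A \<union> {?t1, floor_normal e M'}) \<inter> halfs U (A \<union> {t2, b1})"
        using yA * unfolding halfs_def by (auto simp: t1 floor_normal_iff[OF M(6)] t2i b1)
    qed (auto simp: halfs_def)
  qed (use A in \<open>auto simp: prism_base_def\<close>)
  moreover have "f (halfs U (A \<union> {t2, b1})) = 0"
    by (rule vanishes_on_prismsD[OF f(2) U(2,3) A(1) t2, of "N / M"]) (use N0 M in \<open>auto simp: b1_def t2_def\<close>)
  moreover have "f (halfs U (A \<union> {?t1, floor_normal e M'})) = roof f e ?t1 K"
    using roof_eq[OF U f K n1(2) M2[OF M(2)]] cut_cylinder_halfs[OF A(2) M(6)] by simp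
  moreover have "f (halfs U (A \<union> {t2, floor_normal e M'})) = roof f e (e + \<sigma>) K"
  proof -
    have "f (halfs U (A \<union> {t2, floor_normal e M'})) = roof f e t2 K"
      using roof_eq[OF U f K t2 M3[OF M(3)]] cut_cylinder_halfs[OF A(2) M(6)] by simp
    then show ?thesis unfolding t2_def using roof_scale[OF U f n1(1) _ K, of "1 / N"] N0 by simp
  qed
  moreover have "f (halfs U (A \<union> {?t1, b1})) = roof f e (e + \<sigma>) K"
  proof -
    \<comment> \<open>The shear along the axis that adds \<open>\<sigma>\<close> to every slope.\<close>
    define w where "w = (- 1 / (e \<bullet> e)) *\<^sub>R \<sigma>"
    have w: "w \<in> U" "w \<bullet> e = 0" using U \<sigma> by (auto simp: w_def subspace_scale subspace_neg)
    let ?S = "\<lambda>x. x + (w \<bullet> x) *\<^sub>R e"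
    have wx: "w \<bullet> x = - (\<sigma> \<bullet> x) / (e \<bullet> e)" for x by (simp add: w_def)
    have eS: "e \<bullet> ?S x = e \<bullet> x - \<sigma> \<bullet> x" "\<sigma> \<bullet> ?S x = \<sigma> \<bullet> x" for x
      using ee \<sigma> by (simp_all add: inner_add_right inner_diff_right wx)
    have "?S ` cut_cylinder e (e + \<sigma>) M K = halfs U (A \<union> {?t1, b1})"
    proof (intro equalityI subsetI)
      fix y assume "y \<in> ?S ` cut_cylinder e (e + \<sigma>) M K"
      then obtain x where x: "x \<in> cut_cylinder e (e + \<sigma>) M K" "y = ?S x" by blast
      then obtain k t where k: "k \<in> K" "x = k + t *\<^sub>R e" unfolding cut_cylinder_def by (blast elim: cylE)
      have "y \<in> cylinder e K" using k x(2) by (intro cylI[OF k(1), of _ "t + w \<bullet> x"]) (simp add: scaleR_left_distrib)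
      then have "y \<in> halfs U A" using A(2) by simp
      moreover have "e \<bullet> x + \<sigma> \<bullet> x \<le> 1" "- (e \<bullet> x) \<le> M" using x(1) by (auto simp: cut_cylinder_def inner_add_left)
      ultimately show "y \<in> halfs U (A \<union> {?t1, b1})"
        unfolding halfs_def by (auto simp: t1 b1 x(2) eS)
    next
      fix y assume y: "y \<in> halfs U (A \<union> {?t1, b1})"
      then have "y \<in> cylinder e K" using A(2) by (auto simp: halfs_def)
      then obtain k t where k: "k \<in> K" "y = k + t *\<^sub>R e" by (rule cylE)
      define x where "x = y - (w \<bullet> y) *\<^sub>R e"
      have "w \<bullet> x = w \<bullet> y" using w by (simp add: x_def inner_diff_right)
      then have yx: "y = ?S x" by (simp add: x_def)
      have "x \<in> cylinder e K" using k by (intro cylI[OF k(1), of _ "t - w \<bullet> y"]) (simp add: x_def scaleR_left_diff_distrib)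
      moreover have "?t1 \<bullet> y \<le> 1" "b1 \<bullet> y \<le> 1" using y by (auto simp: halfs_def)
      then have "e \<bullet> x + \<sigma> \<bullet> x \<le> 1 \<and> - (e \<bullet> x) \<le> M" unfolding t1 b1 yx eS by linarith
      ultimately have "x \<in> cut_cylinder e (e + \<sigma>) M K" by (auto simp: cut_cylinder_def inner_add_left)
      then show "y \<in> ?S ` cut_cylinder e (e + \<sigma>) M K" using yx by blast
    qed
    moreover have "f (?S ` cut_cylinder e (e + \<sigma>) M K) = f (cut_cylinder e (e + \<sigma>) M K)"
      by (rule shear[OF polytope_o_cut_cylinder[OF U K n1(1) M(5)] w])
    ultimately show ?thesis using roof_eq[OF U f K n1(1) M1[OF M(1)]] by simp
  qed
  ultimately show ?thesis by simp
qed

text \<open>The step from prisms to all polytopes: shear invariance makes roofs linear in the slope, and the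
  unimodular stretch converts slope into size of the base. The resulting degree \<open>m = card
  I\<close> exceeds the dimension of the base.\<close>
lemma invariant_vanish:
  fixes \<tau> :: "(real^'n) set \<Rightarrow> real"
  assumes \<tau>: "valuation_on UNIV \<tau>" "SL_invariant \<tau>" and pq: "\<And>k. 0 < p k" "\<And>k. 0 < q k"
    and I: "I \<noteq> {}" and pv: "vanishes_on_prisms (coord_space I) (\<lambda>P. \<tau> (box_join I p q P))" and P: "polytope_o (coord_space I) P"
  shows "\<tau> (box_join I p q P) = 0"
proof -
  let ?U = "coord_space I :: (real^'n) set"
  let ?f = "\<lambda>P. \<tau> (box_join I p q P)"
  define m where "m = card I"
  have U: "subspace ?U" by (rule subspace_coord_space)
  obtain k where "k \<in> I" using I by blast
  then have "axis k 1 \<in> ?U" by (auto simp: coord_space_def axis_def)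
  then have U0: "?U \<noteq> {0}" by (metis axis_eq_0_iff singletonD zero_neq_one)
  note f = box_join_valuation_on[OF \<tau>(1) pq, of I] pv
  show ?thesis
  proof (rule vanish_if_roofs_vanish[OF U U0 f _ P])
    fix e n K assume e: "e \<in> ?U" "e \<noteq> 0" and n: "0 < n \<bullet> e" and K: "polytope_o (perp ?U e) K"
    have ee: "e \<bullet> e > 0" using e by simp
    \<comment> \<open>Rescaling and projecting \<open>n\<close> brings the facet into the form \<open>e +
      \<sigma>\<close>.\<close>
    define c where "c = (e \<bullet> e) / (n \<bullet> e)"
    have c: "c > 0" using ee n by (simp add: c_def)
    define \<sigma> where "\<sigma> = coord_proj I (c *\<^sub>R n) - e"
    have ne: "coord_proj I n \<bullet> e = n \<bullet> e" by (rule coord_proj_inner'[OF e(1)])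
    have rs: "coord_proj I (c *\<^sub>R n) = c *\<^sub>R coord_proj I n" by (rule linear_scale[OF linear_coord_proj])
    have "\<sigma> \<bullet> e = c * (n \<bullet> e) - e \<bullet> e" by (simp add: \<sigma>_def rs inner_diff_left ne)
    then have \<sigma>: "\<sigma> \<in> ?U" "\<sigma> \<bullet> e = 0"
      using subspace_diff[OF U coord_proj_in e(1)] n by (simp_all add: \<sigma>_def c_def)
    have lift: "roof ?f e n L = roof ?f e (e + \<sigma>) L" if L: "polytope_o (perp ?U e) L" for L
    proof -
      have "cylinder e L \<subseteq> ?U" using polytope_o_sub[OF L] e U
        by (auto simp: cylinder_def perp_def subspace_add subspace_scale)
      then have "roof ?f e (c *\<^sub>R n) L = roof ?f e (e + \<sigma>) L"
        by (intro roof_cong) (auto simp: \<sigma>_def coord_proj_inner')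
      then show ?thesis using roof_scale[OF U e f n c L] by simp
    qed
    have n': "0 < (e + s *\<^sub>R \<sigma>) \<bullet> e" for s using ee \<sigma> by (simp add: inner_add_left)
    have double: "roof ?f e (e + (2 ^ i) *\<^sub>R \<sigma>) L = 2 ^ i * roof ?f e (e + \<sigma>) L" if L: "polytope_o (perp ?U e) L" for L i
    proof (induction i)
      case (Suc i)
      have "roof ?f e (e + 2 *\<^sub>R ((2 ^ i) *\<^sub>R \<sigma>)) L = 2 * roof ?f e (e + (2 ^ i) *\<^sub>R \<sigma>) L"
      proof (rule roof_double[OF U e f _ _ L])
        fix P w assume w: "polytope_o ?U P" "w \<in> ?U" "w \<bullet> e = 0"
        show "?f ((\<lambda>x. x + (w \<bullet> x) *\<^sub>R e) ` P) = ?f P"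
        proof (rule box_join_linear[OF \<tau>(2) linear_rank_one_update det_shear[OF w(3)] _ _ w(1) pq])
          show "coord_proj I (x + (w \<bullet> x) *\<^sub>R e) = coord_proj I x + (w \<bullet> coord_proj I x) *\<^sub>R e" for x
            by (simp add: linear_add[OF linear_coord_proj] linear_scale[OF linear_coord_proj] coord_proj_id[OF e(1)] coord_proj_inner[OF w(2)])
          show "k \<notin> I \<Longrightarrow> (x + (w \<bullet> x) *\<^sub>R e) $ k = x $ k" for x k using e by (simp add: coord_space_def)
        qed
      qed (use \<sigma> U in \<open>auto simp: subspace_scale\<close>)
      then show ?case using Suc by simp
    qed simp
    show "roof ?f e n K = 0"
    proof (rule homogeneous_vanish[OF subspace_perp[OF U] roof_valuation_on[OF U e f n] roof_translation_inv[OF U e f n] _ _ K])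
      show "dim (perp ?U e) < m" using dim_perp[OF U e] by (simp add: dim_coord_space m_def)
      fix L assume L: "polytope_o (perp ?U e) L"
      have L2: "polytope_o (perp ?U e) ((*\<^sub>R) 2 ` L)" using polytope_o_scale[OF subspace_perp[OF U] L, of 2] by simp
      define d where "d = (2::real) ^ (m - 1)"
      have d0: "d > 0" by (simp add: d_def)
      have d2: "(2::real) ^ m = 2 * d"
        using \<open>k \<in> I\<close> card_gt_0_iff[of I] by (cases m) (auto simp: d_def m_def)
      let ?n' = "(1 / d) *\<^sub>R (e + (2 ^ m) *\<^sub>R \<sigma>)"
      have n1: "0 < (e + \<sigma>) \<bullet> e" using n'[of 1] by simp
      have n2: "0 < ?n' \<bullet> e" using n'[of "2 ^ m"] d0 by simp
      obtain M1 where M1: "\<And>M. M \<ge> M1 \<Longrightarrow> deep (cylinder e ((*\<^sub>R) 2 ` L)) e (e + \<sigma>) M"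
        using deep_cylinder_eventually[OF U e L2 n1] unfolding eventually_at_top_linorder by blast
      obtain M2 where M2: "\<And>M. M \<ge> M2 \<Longrightarrow> deep (cylinder e L) e ?n' M"
        using deep_cylinder_eventually[OF U e L n2] unfolding eventually_at_top_linorder by blast
      define M where "M = max M1 (M2 / d)"
      have Md: "M \<ge> M1" "M \<ge> M2 / d" by (simp_all add: M_def)
      have MM: "M \<ge> M1" "d * M \<ge> M2"
        using Md d0 by (simp_all add: pos_divide_le_eq mult.commute)
      note MC1 = M1[OF MM(1)] and MC2 = M2[OF MM(2)]
      have M0: "M > 0" using MC1 by (simp add: deep_def)
      have e1: "e \<bullet> unimod_stretch I e x = d * (e \<bullet> x)" and s1: "\<sigma> \<bullet> unimod_stretch I e x = (1/2) * (\<sigma> \<bullet> x)" for x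
      proof -
        have z: "v \<bullet> coord_proj (-I) x = 0" if "v \<in> coord_space I" for v
          unfolding inner_vec_def by (rule sum.neutral) (use that in \<open>auto simp: coord_proj_def coord_space_def\<close>)
        show "e \<bullet> unimod_stretch I e x = d * (e \<bullet> x)"
          using ee by (simp add: unimod_stretch_def inner_add_right inner_diff_right z[OF e(1)] coord_proj_inner[OF e(1)] d_def m_def)
        show "\<sigma> \<bullet> unimod_stretch I e x = (1/2) * (\<sigma> \<bullet> x)"
          using \<sigma> by (simp add: unimod_stretch_def inner_add_right inner_diff_right z[OF \<sigma>(1)] coord_proj_inner[OF \<sigma>(1)])
      qed
      have dile: "unimod_stretch I e (2 *\<^sub>R x + t *\<^sub>R e) = x + (d * t) *\<^sub>R e" if "x \<in> perp ?U e" for x t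
      proof -
        have x: "x \<in> coord_space I" "e \<bullet> x = 0" using that by (auto simp: perp_def inner_commute)
        have y: "2 *\<^sub>R x + t *\<^sub>R e \<in> coord_space I" using x e U by (simp add: subspace_add subspace_scale)
        then have "coord_proj (-I) (2 *\<^sub>R x + t *\<^sub>R e) = 0" by (auto simp: coord_proj_def coord_space_def vec_eq_iff)
        moreover have "(e \<bullet> (2 *\<^sub>R x + t *\<^sub>R e)) / (e \<bullet> e) = t" using x ee by (simp add: inner_add_right)
        ultimately show ?thesis unfolding unimod_stretch_def coord_proj_id[OF y] by (simp add: d_def m_def)
      qed
      have "unimod_stretch I e ` cut_cylinder e (e + \<sigma>) M ((*\<^sub>R) 2 ` L) = cut_cylinder e ?n' (d * M) L"
      proof (intro equalityI subsetI)
        fix y assume "y \<in> unimod_stretch I e ` cut_cylinder e (e + \<sigma>) M ((*\<^sub>R) 2 ` L)"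
        then obtain x where x: "x \<in> cut_cylinder e (e + \<sigma>) M ((*\<^sub>R) 2 ` L)" "y = unimod_stretch I e x" by blast
        then obtain l t where l: "l \<in> L" "x = 2 *\<^sub>R l + t *\<^sub>R e" unfolding cut_cylinder_def by (blast elim: cylE)
        have "y \<in> cylinder e L"
          using dile[of l t] l x(2) polytope_o_sub[OF L] by (intro cylI[OF l(1), of _ "d * t"]) auto
        moreover have "e \<bullet> x + \<sigma> \<bullet> x \<le> 1" "- (e \<bullet> x) \<le> M" using x(1) by (auto simp: cut_cylinder_def inner_add_left)
        moreover have "?n' \<bullet> y = e \<bullet> x + \<sigma> \<bullet> x"
          unfolding x(2) inner_scaleR_left inner_add_left e1 s1 d2 using d0 by (simp add: field_simps)
        moreover have "d * (- (e \<bullet> x)) \<le> d * M"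
          using x(1) d0 by (intro mult_left_mono) (auto simp: cut_cylinder_def)
        then have "- (d * (e \<bullet> x)) \<le> d * M" by simp
        ultimately show "y \<in> cut_cylinder e ?n' (d * M) L" by (simp add: cut_cylinder_def x(2) e1 del: inner_scaleR_left)
      next
        fix y assume y: "y \<in> cut_cylinder e ?n' (d * M) L"
        then obtain l t where l: "l \<in> L" "y = l + t *\<^sub>R e" unfolding cut_cylinder_def by (blast elim: cylE)
        define x where "x = 2 *\<^sub>R l + (t / d) *\<^sub>R e"
        have yx: "y = unimod_stretch I e x"
          using dile[of l "t / d"] l polytope_o_sub[OF L] d0 by (auto simp: x_def)
        have "x \<in> cylinder e ((*\<^sub>R) 2 ` L)" unfolding x_def using l by (intro cylI) auto
        moreover have "?n' \<bullet> y = e \<bullet> x + \<sigma> \<bullet> x"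
          unfolding yx inner_scaleR_left inner_add_left e1 s1 d2 using d0 by (simp add: field_simps)
        moreover have "- (d * (e \<bullet> x)) \<le> d * M" using y by (auto simp: cut_cylinder_def yx e1)
        then have "d * (- (e \<bullet> x)) \<le> d * M" by simp
        then have "- (e \<bullet> x) \<le> M" using d0 by (simp only: mult_le_cancel_left_pos)
        moreover have "?n' \<bullet> y \<le> 1" using y unfolding cut_cylinder_def by blast
        ultimately have "x \<in> cut_cylinder e (e + \<sigma>) M ((*\<^sub>R) 2 ` L)" by (auto simp: cut_cylinder_def inner_add_left)
        then show "y \<in> unimod_stretch I e ` cut_cylinder e (e + \<sigma>) M ((*\<^sub>R) 2 ` L)" using yx by blast
      qed
      moreover have "?f (unimod_stretch I e ` cut_cylinder e (e + \<sigma>) M ((*\<^sub>R) 2 ` L)) = ?f (cut_cylinder e (e + \<sigma>) M ((*\<^sub>R) 2 ` L))"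
      proof (rule box_join_linear[OF \<tau>(2) linear_unimod_stretch det_unimod_stretch[OF e] _ _ polytope_o_cut_cylinder[OF U e L2 n1 M0] pq])
        fix x
        have rr: "coord_proj I (coord_proj I x) = coord_proj I x" "coord_proj (-I) (coord_proj I x) = 0" "coord_proj I (coord_proj (-I) x) = 0"
          by (auto simp: coord_proj_def vec_eq_iff)
        show "coord_proj I (unimod_stretch I e x) = unimod_stretch I e (coord_proj I x)"
          by (simp add: unimod_stretch_def linear_add[OF linear_coord_proj] linear_diff[OF linear_coord_proj] linear_scale[OF linear_coord_proj]
              coord_proj_id[OF e(1)] coord_proj_inner[OF e(1)] rr)
        show "k \<notin> I \<Longrightarrow> unimod_stretch I e x $ k = x $ k" for k using e by (simp add: unimod_stretch_def coord_proj_def coord_space_def)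
      qed
      ultimately have "roof ?f e (e + \<sigma>) ((*\<^sub>R) 2 ` L) = roof ?f e ?n' L"
        using roof_eq[OF U e f L2 n1 MC1] roof_eq[OF U e f L n2 MC2] by simp
      also have "\<dots> = roof ?f e (e + (2 ^ m) *\<^sub>R \<sigma>) L"
        using roof_scale[OF U e f n' _ L, of "1 / d" "2 ^ m"] d0 by simp
      also have "\<dots> = 2 ^ m * roof ?f e (e + \<sigma>) L" by (rule double[OF L])
      finally show "roof ?f e n ((*\<^sub>R) 2 ` L) = 2 ^ m * roof ?f e n L" using lift[OF L] lift[OF L2] by simp
    qed
  qed
qed

text \<open>Induction on the number of coordinates of \<open>P\<close>; without any coordinates the product
  is a box. By \<open>invariant_vanish\<close> only prisms \<open>Q\<close> have to be treated. A
  linear map straightens \<open>Q\<close>: it sends the axis of the prism to a coordinate axis and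
  the two parallel end planes to coordinate planes, so that \<open>Q\<close> becomes a polytope
  \<open>W\<close> in one coordinate less times an interval, and the induction hypothesis applies
  to the valuation composed with the inverse map.\<close>
theorem null_on_boxes_vanish:
  fixes \<tau> :: "(real^'n) set \<Rightarrow> real" and P :: "(real^'n) set"
  assumes "null_on_boxes \<tau>" "polytope_o (coord_space I) P" "\<And>k. 0 < p k" "\<And>k. 0 < q k"
  shows "\<tau> (box_join I p q P) = 0"
  using assms
proof (induction "card I" arbitrary: I \<tau> P p q rule: less_induct)
  case less
  note \<tau> = less.prems(1) and P = less.prems(2) and pq = less.prems(3,4)
  let ?U = "coord_space I :: (real^'n) set"
  show ?case
  proof (cases "I = {}")
    case True
    then have U0: "?U = {0}" by (auto simp: coord_space_def vec_eq_iff)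
    have "0 \<in> P" using polytope_o_zero[OF subspace_coord_space P] .
    then have "P = {0}" using polytope_o_sub[OF P] U0 by auto
    then have "box_join I p q P = axis_box p q"
      unfolding True by (auto simp: box_join_def axis_box_def coord_proj_def vec_eq_iff)
    then show ?thesis using \<tau> pq by (simp add: null_on_boxes_def)
  next
    case False
    have v: "valuation_on UNIV \<tau>" "SL_invariant \<tau>" using \<tau> by (auto simp: null_on_boxes_def)
    show ?thesis
    proof (rule invariant_vanish[OF v pq False _ P])
      show "vanishes_on_prisms ?U (\<lambda>P. \<tau> (box_join I p q P))"
        unfolding vanishes_on_prisms_def
      proof (intro allI impI)
        fix e n0 :: "real^'n" and A and c :: real
        assume e: "e \<in> ?U" "e \<noteq> 0" and A: "prism_base ?U e A" and n0: "0 < n0 \<bullet> e" and c: "0 < c"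
        define n where "n = coord_proj I n0"
        have nU: "n \<in> ?U" by (simp add: n_def)
        have nn: "n \<bullet> y = n0 \<bullet> y" if "y \<in> ?U" for y using coord_proj_inner'[OF that] by (simp add: n_def)
        have ne: "n \<bullet> e > 0" using nn[OF e(1)] n0 by simp
        then obtain k where k: "n $ k \<noteq> 0" by (auto simp: inner_vec_def) (metis (no_types, lifting) less_irrefl mult_zero_left sum.neutral)
        then have kI: "k \<in> I" using nU by (auto simp: coord_space_def)
        let ?I = "I - {k}"
        define Q where "Q = halfs ?U (A \<union> {n0, - (c *\<^sub>R n0)})"
        have poQ: "polytope_o ?U Q"
        proof -
          have "bounded Q" unfolding Q_def
            by (rule prism_base_bounded[OF A subspace_coord_space e n0, of "- (c *\<^sub>R n0)"]) (use n0 c in auto)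
          then show ?thesis unfolding Q_def using A by (intro polytope_o_halfs subspace_coord_space) (auto simp: prism_base_def)
        qed
        \<comment> \<open>The point \<open>x\<close> is split as \<open>y0 x + s x *\<^sub>R e\<close> with
          \<open>y0 x\<close> in the plane orthogonal to \<open>n\<close>. That plane is
          parametrised by the coordinates other than \<open>k\<close>, which is possible since
          \<open>n $ k\<close> is not zero, and \<open>g\<close> stores \<open>s x\<close> in the
          coordinate \<open>k\<close>. The inverse of \<open>g\<close> is \<open>h\<close>.\<close>
        define s where "s = (\<lambda>x. (n \<bullet> x) / (n \<bullet> e))"
        define y0 where "y0 = (\<lambda>x. x - s x *\<^sub>R e)"
        define g where "g = (\<lambda>x. y0 x + (s x - y0 x $ k) *\<^sub>R axis k 1)"
        define h where "h = (\<lambda>z. (z - (z $ k) *\<^sub>R axis k 1) - ((n \<bullet> (z - (z $ k) *\<^sub>R axis k 1)) / n $ k) *\<^sub>R axis k 1 + (z $ k) *\<^sub>R e)"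
        have ls: "s (x + y) = s x + s y" "s (r *\<^sub>R x) = r * s x" for x y r
          by (simp_all add: s_def inner_add_right add_divide_distrib)
        have ly: "y0 (x + y) = y0 x + y0 y" "y0 (r *\<^sub>R x) = r *\<^sub>R y0 x" for x y r
          by (simp_all add: y0_def ls algebra_simps)
        have lg: "linear g" unfolding g_def
          by (rule linearI) (simp_all add: ls ly algebra_simps)
        have lh: "linear h" unfolding h_def
          by (rule linearI) (simp_all add: inner_add_right inner_diff_right add_divide_distrib diff_divide_distrib algebra_simps)
        have nax: "n \<bullet> axis k 1 = n $ k" by (simp add: inner_axis)
        have ny0: "n \<bullet> y0 x = 0" for x using ne by (simp add: y0_def s_def inner_diff_right)
        have gk: "g x $ k = s x" for x by (simp add: g_def)
        have gw: "g x - (g x $ k) *\<^sub>R axis k 1 = y0 x - (y0 x $ k) *\<^sub>R axis k 1" for x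
          unfolding gk by (simp add: g_def algebra_simps)
        have hg: "h (g x) = x" for x
        proof -
          have nd: "n \<bullet> (y0 x - (y0 x $ k) *\<^sub>R axis k 1) = - (y0 x $ k * n $ k)"
            by (simp add: inner_diff_right ny0 nax)
          have "h (g x) = y0 x + s x *\<^sub>R e"
            unfolding h_def gw unfolding nd unfolding gk using k by simp
          then show ?thesis by (simp add: y0_def)
        qed
        have injg: "inj g" by (rule inj_on_inverseI[of _ h]) (rule hg)
        have surjg: "surj g" using linear_injective_imp_surjective[OF lg injg] by auto
        have gh: "g (h z) = z" for z using surjg hg by (metis surj_def)
        have injh: "inj h" by (rule inj_on_inverseI[of _ g]) (rule gh)
        \<comment> \<open>The side normals, adjusted by multiples of \<open>n\<close> to have no component in the
          coordinate \<open>k\<close>.\<close>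
        define B where "B = (\<lambda>a. a - (a $ k / n $ k) *\<^sub>R n) ` A"
        define W where "W = halfs (coord_space ?I) B"
        define p' where "p' = p(k := 1 / (c * (n \<bullet> e)))"
        define q' where "q' = q(k := 1 / (n \<bullet> e))"
        have pq': "0 < p' j" "0 < q' j" for j using pq c ne by (auto simp: p'_def q'_def)
        have iB: "(\<forall>b\<in>B. b \<bullet> (y - (y $ k) *\<^sub>R axis k 1) \<le> 1) \<longleftrightarrow> (\<forall>a\<in>A. a \<bullet> y \<le> 1)" if "n \<bullet> y = 0" for y
        proof -
          have "(a - (a $ k / n $ k) *\<^sub>R n) \<bullet> (y - (y $ k) *\<^sub>R axis k 1) = a \<bullet> y" for a
            using that k by (simp add: inner_diff_left inner_diff_right nax inner_axis)
          then show ?thesis by (simp add: B_def)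
        qed
        have Ay: "a \<bullet> y0 x = a \<bullet> x" if "a \<in> A" for a x
          using that A by (simp add: y0_def inner_diff_right prism_base_def)
        have gout: "g x $ j = x $ j" if "j \<notin> I" for x j
          using that kI e(1) by (auto simp: g_def y0_def coord_space_def axis_def)
        have rg: "coord_proj ?I (g x) = y0 (coord_proj I x) - (y0 (coord_proj I x) $ k) *\<^sub>R axis k 1" for x
        proof -
          have "s (coord_proj I x) = s x" using coord_proj_inner[OF nU] by (simp add: s_def)
          then show ?thesis
            using kI e(1) by (auto simp: vec_eq_iff coord_proj_def g_def y0_def coord_space_def axis_def)
        qed
        have mem: "x \<in> box_join I p q Q \<longleftrightarrow> g x \<in> box_join ?I p' q' W" for x
        proof -
          have sx: "s (coord_proj I x) = s x" using coord_proj_inner[OF nU] by (simp add: s_def)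
          have "coord_proj I x \<in> Q \<longleftrightarrow> (\<forall>a\<in>A. a \<bullet> coord_proj I x \<le> 1) \<and> n0 \<bullet> coord_proj I x \<le> 1 \<and> - (c * (n0 \<bullet> coord_proj I x)) \<le> 1"
            by (auto simp: Q_def halfs_def)
          also have "n0 \<bullet> coord_proj I x = s x * (n \<bullet> e)"
            using nn[of "coord_proj I x"] coord_proj_inner[OF nU, of x] ne by (simp add: s_def)
          also have "s x * (n \<bullet> e) \<le> 1 \<longleftrightarrow> g x $ k \<le> q' k" using ne by (simp add: gk q'_def pos_le_divide_eq)
          also have "- (c * (s x * (n \<bullet> e))) \<le> 1 \<longleftrightarrow> - p' k \<le> g x $ k"
            using ne c by (simp add: gk p'_def field_simps)
          also have "(\<forall>a\<in>A. a \<bullet> coord_proj I x \<le> 1) \<longleftrightarrow> coord_proj ?I (g x) \<in> W"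
          proof -
            have "coord_proj ?I (g x) \<in> W \<longleftrightarrow> (\<forall>b\<in>B. b \<bullet> coord_proj ?I (g x) \<le> 1)" by (simp add: W_def halfs_def)
            also have "\<dots> \<longleftrightarrow> (\<forall>a\<in>A. a \<bullet> y0 (coord_proj I x) \<le> 1)" unfolding rg by (rule iB[OF ny0])
            finally show ?thesis using Ay by simp
          qed
          finally have "coord_proj I x \<in> Q \<longleftrightarrow> coord_proj ?I (g x) \<in> W \<and> g x $ k \<le> q' k \<and> - p' k \<le> g x $ k" .
          moreover have "(\<forall>j. j \<notin> ?I \<longrightarrow> - p' j \<le> g x $ j \<and> g x $ j \<le> q' j) \<longleftrightarrow>
             (\<forall>j. j \<notin> I \<longrightarrow> - p j \<le> x $ j \<and> x $ j \<le> q j) \<and> - p' k \<le> g x $ k \<and> g x $ k \<le> q' k"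
            using kI gout by (auto simp: p'_def q'_def)
          ultimately show ?thesis by (auto simp: box_join_def)
        qed
        have eq: "box_join I p q Q = h ` box_join ?I p' q' W"
        proof (intro equalityI subsetI)
          fix x assume "x \<in> box_join I p q Q"
          then have "h (g x) \<in> h ` box_join ?I p' q' W" using mem by blast
          then show "x \<in> h ` box_join ?I p' q' W" by (simp add: hg)
        next
          fix x assume "x \<in> h ` box_join ?I p' q' W"
          then obtain z where "z \<in> box_join ?I p' q' W" "x = h z" by blast
          then show "x \<in> box_join I p q Q" using mem[of x] gh by simp
        qed
        have "bounded W"
        proof -
          have "W \<subseteq> g ` Q"
          proof
            fix w assume w: "w \<in> W"
            then have wU: "w \<in> coord_space ?I" by (simp add: W_def halfs_def)
            then have wk: "w $ k = 0" by (simp add: coord_space_def)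
            have "coord_proj ?I w = w" using coord_proj_id[OF wU] .
            have hw: "h w \<in> ?U"
            proof -
              have "w \<in> ?U" using wU by (auto simp: coord_space_def)
              moreover have "axis k 1 \<in> ?U" using kI by (auto simp: coord_space_def axis_def)
              ultimately show ?thesis unfolding h_def wk using e(1)
                by (intro subspace_add[OF subspace_coord_space] subspace_diff[OF subspace_coord_space] subspace_scale[OF subspace_coord_space])
            qed
            have "g (h w) \<in> box_join ?I p' q' W"
              unfolding gh box_join_def using w \<open>coord_proj ?I w = w\<close> wU pq' less_imp_le by (auto simp: coord_space_def less_imp_le)
            then have "h w \<in> box_join I p q Q" using mem by blast
            then have "h w \<in> Q" using coord_proj_id[OF hw] by (simp add: box_join_def)
            then have "g (h w) \<in> g ` Q" by (rule imageI)
            then show "w \<in> g ` Q" by (simp add: gh)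
          qed
          moreover have "bounded (g ` Q)" using bounded_linear_image[OF polytope_o_bounded[OF poQ]] lg linear_conv_bounded_linear by blast
          ultimately show ?thesis using bounded_subset by blast
        qed
        then have poW: "polytope_o (coord_space ?I) W"
          unfolding W_def using A by (intro polytope_o_halfs subspace_coord_space) (auto simp: prism_base_def B_def)
        have "card ?I < card I" using kI by (intro card_Diff1_less) auto
        from less.hyps[OF this null_on_boxes_linear[OF \<tau> lh injh] poW pq']
        show "\<tau> (box_join I p q (halfs ?U (A \<union> {n0, - (c *\<^sub>R n0)}))) = 0"
          using eq by (simp add: Q_def)
      qed
    qed
  qed
qed

section \<open>The functional equation of rectangles\<close>

lemma additive_rational:
  fixes f :: "real \<Rightarrow> real"
  assumes add: "\<And>x y. f (x + y) = f x + f y"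
  shows "f (of_rat q * x) = of_rat q * f x"
proof -
  have f0: "f 0 = 0" using add[of 0 0] by simp
  have neg: "f (- x) = - f x" for x using add[of x "-x"] f0 by simp
  have nat: "f (real n * x) = real n * f x" for n x
    by (induction n) (simp_all add: f0 add distrib_right)
  have int: "f (real_of_int i * x) = real_of_int i * f x" for i x
  proof (cases "i \<ge> 0")
    case True then show ?thesis using nat[of "nat i" x] by simp
  next
    case False then show ?thesis using nat[of "nat (- i)" x] neg[of "real_of_int i * x"] by simp
  qed
  obtain a b where q: "q = Fract a b" "b > 0" using quotient_of_unique by (metis Rat_cases)
  have r: "of_rat q = real_of_int a / real_of_int b" using q by (simp add: of_rat_rat)
  have "real_of_int b * f (of_rat q * x) = f (real_of_int b * (of_rat q * x))" using int by simp
  also have "\<dots> = f (real_of_int a * x)" unfolding r using q(2) by simp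
  also have "\<dots> = real_of_int a * f x" by (rule int)
  finally have "f (of_rat q * x) = (real_of_int a / real_of_int b) * f x"
    using q(2) by (simp add: field_simps)
  then show ?thesis unfolding r .
qed

text \<open>If the deviation \<open>g\<close> of \<open>f\<close> from the linear function \<open>x * f
  1\<close> were positive at \<open>s\<close>, it would be arbitrarily large at the multiples
  \<open>k * s\<close>; as \<open>g\<close> vanishes on the rationals, subtracting a rational
  brings these points to a null sequence without changing \<open>g\<close>, against boundedness.\<close>
lemma additive_linear:
  fixes f :: "real \<Rightarrow> real"
  assumes add: "\<And>x y. f (x + y) = f x + f y"
    and bd: "\<And>x. x \<longlonglongrightarrow> 0 \<Longrightarrow> \<exists>M. \<forall>\<^sub>F k in sequentially. f (x k) \<le> M"
  shows "f s = s * f 1"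
proof -
  have f0: "f 0 = 0" using add[of 0 0] by simp
  have neg: "f (- x) = - f x" for x using add[of x "-x"] f0 by simp
  have nat: "f (real n * x) = real n * f x" for n x
    by (induction n) (simp_all add: f0 add distrib_right)
  define g where "g = (\<lambda>x. f x - x * f 1)"
  have gneg: "g (- x) = - g x" for x by (simp add: g_def neg)
  have no: "\<not> g s > 0" for s
  proof
    assume gs: "g s > 0"
    have "\<exists>q::rat. \<bar>real k * s - of_rat q\<bar> < 1 / (real k + 1)" for k
    proof -
      have "real k * s - 1 / (real k + 1) < real k * s + 1 / (real k + 1)" by simp
      then obtain q where "real k * s - 1 / (real k + 1) < of_rat q" "of_rat q < real k * s + 1 / (real k + 1)"
        using of_rat_dense by blast
      then show ?thesis by (intro exI[of _ q]) linarith
    qed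
    then obtain q where q: "\<And>k. \<bar>real k * s - of_rat (q k)\<bar> < 1 / (real k + 1)" by metis
    define x where "x = (\<lambda>k. real k * s - of_rat (q k))"
    have xk: "\<bar>x k\<bar> \<le> 1 / (real k + 1)" for k using q[of k] by (simp add: x_def)
    have x: "x \<longlonglongrightarrow> 0"
    proof (rule Lim_null_comparison)
      show "\<forall>\<^sub>F k in sequentially. norm (x k) \<le> 1 / (real k + 1)" using xk by simp
      show "(\<lambda>k. 1 / (real k + 1)) \<longlonglongrightarrow> 0"
        using LIMSEQ_inverse_real_of_nat by (simp add: inverse_eq_divide add.commute)
    qed
    obtain M where M: "\<forall>\<^sub>F k in sequentially. f (x k) \<le> M" using bd[OF x] by blast
    have fx: "f (x k) = real k * g s + x k * f 1" for k
    proof -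
      have "f (x k) = f (real k * s) - f (of_rat (q k) * 1)"
        using add[of "x k" "of_rat (q k)"] by (simp add: x_def)
      also have "\<dots> = real k * f s - of_rat (q k) * f 1"
        unfolding nat additive_rational[of f, OF add] ..
      finally show ?thesis by (simp add: g_def x_def algebra_simps)
    qed
    have low: "f (x k) \<ge> real k * g s - \<bar>f 1\<bar>" for k
    proof -
      have "\<bar>x k * f 1\<bar> \<le> 1 * \<bar>f 1\<bar>" unfolding abs_mult
        using xk[of k] order_trans[of _ "1 / (real k + 1)" 1] by (intro mult_right_mono) auto
      then show ?thesis unfolding fx by linarith
    qed
    obtain k0 :: nat where k0: "real k0 > (M + \<bar>f 1\<bar>) / g s" using reals_Archimedean2 by blast
    have "\<forall>\<^sub>F k in sequentially. real k * g s - \<bar>f 1\<bar> > M"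
      using eventually_ge_at_top[of k0]
    proof eventually_elim
      case (elim k)
      then have "real k > (M + \<bar>f 1\<bar>) / g s" using k0 by linarith
      then show ?case using gs by (simp add: pos_divide_less_eq)
    qed
    from eventually_conj[OF this M] have "\<forall>\<^sub>F k in sequentially. False"
    proof (rule eventually_mono)
      fix k assume "real k * g s - \<bar>f 1\<bar> > M \<and> f (x k) \<le> M"
      then show False using low[of k] by linarith
    qed
    then show False by simp
  qed
  have "g s = 0" using no[of s] no[of "- s"] gneg[of s] by linarith
  then show ?thesis by (simp add: g_def)
qed

text \<open>The odd extension to all reals is additive.\<close>
lemma additive_pos_linear:
  fixes f :: "real \<Rightarrow> real"
  assumes add: "\<And>x y. 0 < x \<Longrightarrow> 0 < y \<Longrightarrow> f (x + y) = f x + f y"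
    and bd: "\<And>x. x \<longlonglongrightarrow> 1 \<Longrightarrow> (\<forall>k. 0 < x k) \<Longrightarrow> \<exists>M. \<forall>\<^sub>F k in sequentially. f (x k) \<le> M"
    and s: "0 < s"
  shows "f s = s * f 1"
proof -
  define g where "g = (\<lambda>x. if x > 0 then f x else if x = 0 then 0 else - f (- x))"
  have g_add: "g (x + y) = g x + g y" for x y
  proof -
    have a1: "g (x + y) = g x + g y" if "x \<ge> 0" "y \<ge> 0" for x y
      using that add[of x y] by (auto simp: g_def)
    have gn: "g (- x) = - g x" for x by (auto simp: g_def)
    have a2: "g (x + y) = g x + g y" if "x \<ge> 0" "y \<le> 0" for x y
    proof (cases "x + y \<ge> 0")
      case True
      have "g x = g (x + y) + g (- y)" using a1[of "x + y" "- y"] that True by simp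
      then show ?thesis using gn by simp
    next
      case False
      have "g (- y) = g (- (x + y)) + g x" using a1[of "- (x + y)" x] that False by simp
      then show ?thesis using gn[of y] gn[of "x + y"] by linarith
    qed
    have a3: "g (x + y) = g x + g y" if "x \<le> 0" "y \<le> 0" for x y
      using a1[of "- x" "- y"] that gn[of x] gn[of y] gn[of "x + y"] by simp
    show ?thesis using a1[of x y] a2[of x y] a2[of y x] a3[of x y] by (metis add.commute linear)
  qed
  have "g s = s * g 1"
  proof (rule additive_linear[OF g_add])
    fix x :: "nat \<Rightarrow> real" assume x: "x \<longlonglongrightarrow> 0"
    define z where "z = (\<lambda>k. if 1 + x k > 0 then 1 + x k else 1)"
    have ev: "\<forall>\<^sub>F k in sequentially. 1 + x k > 0"
      using order_tendstoD(1)[OF x, of "-1"] by (auto elim: eventually_mono)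
    have "(\<lambda>k. 1 + x k) \<longlonglongrightarrow> 1" using tendsto_add[OF tendsto_const x, of 1] by simp
    moreover have "\<forall>\<^sub>F k in sequentially. 1 + x k = z k" using ev by eventually_elim (simp add: z_def)
    ultimately have "z \<longlonglongrightarrow> 1" by (rule Lim_transform_eventually)
    moreover have "\<forall>k. 0 < z k" by (simp add: z_def)
    ultimately obtain M where M: "\<forall>\<^sub>F k in sequentially. f (z k) \<le> M" using bd by blast
    have "\<forall>\<^sub>F k in sequentially. g (x k) \<le> M - g 1"
      using ev M
    proof eventually_elim
      case (elim k)
      then have "f (z k) = g (1 + x k)" by (simp add: z_def g_def)
      then show ?case using g_add[of 1 "x k"] elim by simp
    qed
    then show "\<exists>M. \<forall>\<^sub>F k in sequentially. g (x k) \<le> M" by blast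
  qed
  then show ?thesis using s by (simp add: g_def)
qed

text \<open>Here \<open>\<Psi> x1 x2 x3 x4\<close> is the value of the rectangle with right, upper, left and
  lower distances \<open>x1\<close>, \<open>x2\<close>, \<open>x3\<close>, \<open>x4\<close> from
  the origin. The assumption \<open>split\<close> is the valuation property for rectangles with
  common top and bottom, \<open>cyc\<close> and \<open>diag\<close> invariance under quarter turns
  and diagonal maps, and \<open>tri\<close> the cyclic symmetry of the triangle.

  By \<open>split\<close>, \<open>\<Psi>\<close> is a sum of functions \<open>s\<close> of one
  side and functions \<open>m\<close> of two adjacent sides. Invariance under \<open>diag\<close>
  makes \<open>m\<close> a 2-cocycle on the multiplicative group of positive reals whose symmetric
  part is the coboundary of \<open>s\<close>. So \<open>\<Psi>\<close> is a sum of values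
  \<open>F\<close> at the four products of adjacent sides plus an antisymmetric biadditive form
  \<open>b\<close>. Symmetrising \<open>tri\<close> removes \<open>b\<close> and says that after
  subtracting \<open>2 c t\<close> the function \<open>u \<mapsto> F (1/u)\<close> is additive up
  to a constant. Local boundedness then kills \<open>b\<close> and makes the additive part linear.\<close>
lemma rectangle_equation:
  fixes \<Psi> :: "real \<Rightarrow> real \<Rightarrow> real \<Rightarrow> real \<Rightarrow> real" and c :: real
  assumes split: "\<And>x1 x2 x3 x4 y1 y3. \<lbrakk>0 < x1; 0 < x2; 0 < x3; 0 < x4; 0 < y1; 0 < y3\<rbrakk> \<Longrightarrow>
       \<Psi> x1 x2 x3 x4 + \<Psi> y1 x2 y3 x4 = \<Psi> x1 x2 y3 x4 + \<Psi> y1 x2 x3 x4"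
   and cyc: "\<And>x1 x2 x3 x4. \<lbrakk>0 < x1; 0 < x2; 0 < x3; 0 < x4\<rbrakk> \<Longrightarrow> \<Psi> x1 x2 x3 x4 = \<Psi> x4 x1 x2 x3"
   and diag: "\<And>x1 x2 x3 x4 l. \<lbrakk>0 < x1; 0 < x2; 0 < x3; 0 < x4; 0 < l\<rbrakk> \<Longrightarrow>
       \<Psi> (l * x1) (x2 / l) (l * x3) (x4 / l) = \<Psi> x1 x2 x3 x4"
   and tri: "\<And>x y z. \<lbrakk>0 < x; 0 < y; 0 < z\<rbrakk> \<Longrightarrow>
       \<Psi> (y + z) z x y - c * ((y + z)^2 - x^2) = \<Psi> (z + x) x y z - c * ((z + x)^2 - y^2)"
   and bd: "\<And>X1 X2 X3 X4 x1 x2 x3 x4. \<lbrakk>X1 \<longlonglongrightarrow> x1; X2 \<longlonglongrightarrow> x2; X3 \<longlonglongrightarrow> x3; X4 \<longlonglongrightarrow> x4;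
       0 < x1; 0 < x2; 0 < x3; 0 < x4; \<forall>k::nat. 0 < X1 k \<and> 0 < X2 k \<and> 0 < X3 k \<and> 0 < X4 k\<rbrakk> \<Longrightarrow>
       \<exists>M. \<forall>\<^sub>F k in sequentially. \<Psi> (X1 k) (X2 k) (X3 k) (X4 k) \<le> M"
  shows "\<exists>c0 c2. \<forall>x1 x2 x3 x4. 0 < x1 \<longrightarrow> 0 < x2 \<longrightarrow> 0 < x3 \<longrightarrow> 0 < x4 \<longrightarrow>
     \<Psi> x1 x2 x3 x4 = c0 + 2 * c * ((x1 + x3) * (x2 + x4)) + c2 * ((1/x1 + 1/x3) * (1/x2 + 1/x4))"
proof -
  define Z where "Z = \<Psi> 1 1 1 1"
  define s where "s = (\<lambda>x. \<Psi> x 1 1 1 - Z)"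
  define m where "m = (\<lambda>x y. \<Psi> x y 1 1 - \<Psi> x 1 1 1 - \<Psi> y 1 1 1 + Z)"
  have split2: "\<Psi> x1 x2 x3 x4 + \<Psi> x1 y2 x3 y4 = \<Psi> x1 x2 x3 y4 + \<Psi> x1 y2 x3 x4"
    if "0 < x1" "0 < x2" "0 < x3" "0 < x4" "0 < y2" "0 < y4" for x1 x2 x3 x4 y2 y4
    using split[of x4 x1 x2 x3 y4 y2] cyc[of x1 x2 x3 x4] cyc[of x1 y2 x3 y4] cyc[of x1 x2 x3 y4] cyc[of x1 y2 x3 x4] that
    by simp
  have expand: "\<Psi> x1 x2 x3 x4 = Z + s x1 + s x2 + s x3 + s x4 + m x1 x2 + m x2 x3 + m x3 x4 + m x4 x1"
    if p: "0 < x1" "0 < x2" "0 < x3" "0 < x4" for x1 x2 x3 x4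
  proof -
    have "\<Psi> x1 x2 x3 x4 = \<Psi> x1 x2 1 x4 + \<Psi> 1 x2 x3 x4 - \<Psi> 1 x2 1 x4"
      using split[of x1 x2 x3 x4 1 1] p by simp
    moreover have "\<Psi> x1 x2 1 x4 = \<Psi> x1 x2 1 1 + \<Psi> x1 1 1 x4 - \<Psi> x1 1 1 1"
      using split2[of x1 x2 1 x4 1 1] p by simp
    moreover have "\<Psi> 1 x2 x3 x4 = \<Psi> 1 x2 x3 1 + \<Psi> 1 1 x3 x4 - \<Psi> 1 1 x3 1"
      using split2[of 1 x2 x3 x4 1 1] p by simp
    moreover have "\<Psi> 1 x2 1 x4 = \<Psi> 1 x2 1 1 + \<Psi> 1 1 1 x4 - \<Psi> 1 1 1 1"
      using split2[of 1 x2 1 x4 1 1] p by simp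
    moreover have "\<Psi> x1 1 1 x4 = \<Psi> x4 x1 1 1" using cyc[of x1 1 1 x4] p by simp
    moreover have "\<Psi> 1 x2 x3 1 = \<Psi> x2 x3 1 1" using cyc[of x2 x3 1 1] p by simp
    moreover have "\<Psi> 1 1 x3 x4 = \<Psi> x3 x4 1 1" using cyc[of x3 x4 1 1] cyc[of 1 x3 x4 1] p by simp
    moreover have "\<Psi> 1 1 x3 1 = \<Psi> x3 1 1 1" using cyc[of x3 1 1 1] cyc[of 1 x3 1 1] p by simp
    moreover have "\<Psi> 1 x2 1 1 = \<Psi> x2 1 1 1" using cyc[of x2 1 1 1] p by simp
    moreover have "\<Psi> 1 1 1 x4 = \<Psi> x4 1 1 1" using cyc[of x4 1 1 1] cyc[of 1 x4 1 1] cyc[of 1 1 x4 1] p by simp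
    ultimately show ?thesis unfolding s_def m_def Z_def by linarith
  qed
  have s1: "s 1 = 0" by (simp add: s_def Z_def)
  have m1: "m x 1 = 0" "m 1 x = 0" if "0 < x" for x
    using cyc[of x 1 1 1] that by (simp_all add: m_def Z_def)
  \<comment> \<open>Expanding both sides of \<open>diag\<close> for four rectangles and taking the alternating
    sum.\<close>
  have cocycle: "m x y + m (x * y) z = m x (y * z) + m y z" if p: "0 < x" "0 < y" "0 < z" for x y z
  proof -
    have d: "\<Psi> (y * a) (h / y) (y * 1) (1 / y) = \<Psi> a h 1 1" if "0 < a" "0 < h" for a h
      using diag[of a h 1 1 y] that p by simp
    have "\<Psi> (y * x) z y (1 / y) = \<Psi> x (y * z) 1 1" using d[of x "y * z"] p by simp
    moreover have "\<Psi> (y * x) 1 y (1 / y) = \<Psi> x y 1 1" using d[of x y] p by simp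
    moreover have "\<Psi> y z y (1 / y) = \<Psi> 1 (y * z) 1 1" using d[of 1 "y * z"] p by simp
    moreover have "\<Psi> y 1 y (1 / y) = \<Psi> 1 y 1 1" using d[of 1 y] p by simp
    moreover have e: "\<Psi> (y * x) z y (1 / y) = Z + s (y * x) + s z + s y + s (1 / y) + m (y * x) z + m z y + m y (1 / y) + m (1 / y) (y * x)"
      "\<Psi> (y * x) 1 y (1 / y) = Z + s (y * x) + s 1 + s y + s (1 / y) + m (y * x) 1 + m 1 y + m y (1 / y) + m (1 / y) (y * x)"
      "\<Psi> y z y (1 / y) = Z + s y + s z + s y + s (1 / y) + m y z + m z y + m y (1 / y) + m (1 / y) y"
      "\<Psi> y 1 y (1 / y) = Z + s y + s 1 + s y + s (1 / y) + m y 1 + m 1 y + m y (1 / y) + m (1 / y) y"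
      "\<Psi> x (y * z) 1 1 = Z + s x + s (y * z) + s 1 + s 1 + m x (y * z) + m (y * z) 1 + m 1 1 + m 1 x"
      "\<Psi> x y 1 1 = Z + s x + s y + s 1 + s 1 + m x y + m y 1 + m 1 1 + m 1 x"
      "\<Psi> 1 (y * z) 1 1 = Z + s 1 + s (y * z) + s 1 + s 1 + m 1 (y * z) + m (y * z) 1 + m 1 1 + m 1 1"
      "\<Psi> 1 y 1 1 = Z + s 1 + s y + s 1 + s 1 + m 1 y + m y 1 + m 1 1 + m 1 1"
      by (rule expand; simp add: p)+
    moreover have "m (y * x) 1 = 0" "m 1 y = 0" "m y 1 = 0" "m (y * z) 1 = 0" "m 1 (y * z) = 0" "m 1 x = 0" "m 1 1 = 0"
      using m1 p by simp_all
    ultimately show ?thesis unfolding mult.commute[of x y] by linarith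
  qed
  have s_mult: "s (x * y) - s x - s y = m x y + m y x" if p: "0 < x" "0 < y" for x y
  proof -
    have "\<Psi> (y * x) (1 / y) y (1 / y) = \<Psi> x 1 1 1" using diag[of x 1 1 1 y] p by simp
    moreover have "\<Psi> y (1 / y) y (1 / y) = \<Psi> 1 1 1 1" using diag[of 1 1 1 1 y] p by simp
    moreover have "\<Psi> (y * x) (1 / y) y (1 / y) = Z + s (y * x) + s (1 / y) + s y + s (1 / y) + m (y * x) (1 / y) + m (1 / y) y + m y (1 / y) + m (1 / y) (y * x)"
      "\<Psi> y (1 / y) y (1 / y) = Z + s y + s (1 / y) + s y + s (1 / y) + m y (1 / y) + m (1 / y) y + m y (1 / y) + m (1 / y) y"
      by (rule expand; simp add: p)+
    moreover have "m x y + m (y * x) (1 / y) = m y (1 / y)"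
      using cocycle[of x y "1 / y"] m1[of x] p by (simp add: mult.commute)
    moreover have "m (1 / y) y = m (1 / y) (y * x) + m y x"
      using cocycle[of "1 / y" y x] m1[of x] p by simp
    moreover have "s x = \<Psi> x 1 1 1 - Z" "Z = \<Psi> 1 1 1 1" by (simp_all add: s_def Z_def)
    ultimately show ?thesis unfolding mult.commute[of x y] by linarith
  qed
  define b where "b = (\<lambda>x y. (m x y - m y x) / 2)"
  have b_anti: "b y x = - b x y" for x y by (simp add: b_def diff_divide_distrib)
  have b_mult: "b x (y * z) = b x y + b x z" if "0 < x" "0 < y" "0 < z" for x y z
  proof -
    have "m x y + m (x * y) z = m x (y * z) + m y z" using cocycle[of x y z] that by simp
    moreover have "m y x + m (x * y) z = m y (x * z) + m x z"
      using cocycle[of y x z] that by (simp add: mult.commute)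
    moreover have "m y z + m (y * z) x = m y (x * z) + m z x"
      using cocycle[of y z x] that by (simp add: mult.commute)
    ultimately show ?thesis unfolding b_def diff_divide_distrib by linarith
  qed
  define F where "F = (\<lambda>t. Z / 4 + s t / 2)"
  have form: "\<Psi> x1 x2 x3 x4 = F (x1 * x2) + F (x2 * x3) + F (x3 * x4) + F (x4 * x1)
      + (b x1 x2 + b x2 x3 + b x3 x4 + b x4 x1)"
    if p: "0 < x1" "0 < x2" "0 < x3" "0 < x4" for x1 x2 x3 x4
    unfolding expand[OF p] F_def b_def
    using s_mult[of x1 x2] s_mult[of x2 x3] s_mult[of x3 x4] s_mult[of x4 x1] p by (simp add: field_simps)
  define H where "H = (\<lambda>t. F t - 2 * c * t)"
  \<comment> \<open>Adding the triangle equation to the one with \<open>x\<close> and \<open>y\<close> exchanged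
    cancels all terms in \<open>b\<close>.\<close>
  have tri2: "H ((y + z) * z) + H ((y + z) * y) + H (x * z) = H ((z + x) * z) + H ((z + x) * x) + H (y * z)"
    if p: "0 < x" "0 < y" "0 < z" for x y z
  proof -
    have "\<Psi> (y + z) z x y - c * ((y + z)^2 - x^2) = \<Psi> (z + x) x y z - c * ((z + x)^2 - y^2)"
      using tri p by blast
    moreover have "\<Psi> (x + z) z y x - c * ((x + z)^2 - y^2) = \<Psi> (z + y) y x z - c * ((z + y)^2 - x^2)"
      using tri[of y x z] p by blast
    moreover have "\<Psi> (y + z) z x y = F ((y + z) * z) + F (z * x) + F (x * y) + F (y * (y + z)) + (b (y + z) z + b z x + b x y + b y (y + z))"
      "\<Psi> (z + x) x y z = F ((z + x) * x) + F (x * y) + F (y * z) + F (z * (z + x)) + (b (z + x) x + b x y + b y z + b z (z + x))"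
      "\<Psi> (x + z) z y x = F ((x + z) * z) + F (z * y) + F (y * x) + F (x * (x + z)) + (b (x + z) z + b z y + b y x + b x (x + z))"
      "\<Psi> (z + y) y x z = F ((z + y) * y) + F (y * x) + F (x * z) + F (z * (z + y)) + (b (z + y) y + b y x + b x z + b z (z + y))"
      using p by (auto intro!: form)
    ultimately have "2 * (F ((y + z) * z) + F (x * z) + F ((y + z) * y)) - 2 * c * ((y + z)^2 - x^2)
       = 2 * (F ((z + x) * x) + F (y * z) + F ((z + x) * z)) - 2 * c * ((z + x)^2 - y^2)"
      using b_anti[of z "y + z"] b_anti[of y "y + z"] b_anti[of z x] b_anti[of z y] b_anti[of x y] b_anti[of x "z + x"] b_anti[of z "z + x"]
      by (simp add: mult.commute add.commute)
    then show ?thesis unfolding H_def by (simp add: power2_eq_square algebra_simps)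
  qed
  \<comment> \<open>The defect \<open>C\<close> of additivity of \<open>g\<close> is evaluated at the pair
    \<open>Q\<close>; by \<open>tri2\<close> it does not change with \<open>y\<close>, and it is
    symmetric in \<open>y\<close> and \<open>z\<close>, so it is constant.\<close>
  define g where "g = (\<lambda>u. H (1 / u))"
  define C where "C = (\<lambda>u v. g u + g v - g (u + v))"
  define Q where "Q = (\<lambda>z y. C (1 / ((y + z) * y)) (1 / ((y + z) * z)))"
  have Qeq: "Q z y = H ((y + z) * y) + H ((y + z) * z) - H (y * z)" if "0 < y" "0 < z" for y z
  proof -
    have "1 / ((y + z) * y) + 1 / ((y + z) * z) = 1 / (y * z)"
      using that by (simp add: divide_simps add_pos_pos)
    then show ?thesis by (simp add: Q_def C_def g_def)
  qed
  have Qindep: "Q z y = Q z x" if "0 < x" "0 < y" "0 < z" for x y z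
    using tri2[of x y z] Qeq[of y z] Qeq[of x z] that by (simp add: add.commute)
  have Qsym: "Q z y = Q y z" if "0 < y" "0 < z" for y z
    using Qeq[of y z] Qeq[of z y] that by (simp add: add.commute mult.commute)
  have Qconst: "Q z y = Q 1 1" if "0 < y" "0 < z" for y z
    using Qindep[of 1 y z] Qsym[of 1 z] Qindep[of 1 z 1] that by simp
  define C0 where "C0 = Q 1 1"
  have CC: "g u + g v - g (u + v) = C0" if uv: "0 < u" "0 < v" for u v
  proof -
    define w where "w = u + v"
    have w: "w > 0" using uv by (simp add: w_def)
    \<comment> \<open>Every pair \<open>u\<close>, \<open>v\<close> arises from suitable \<open>y\<close> and
      \<open>z\<close>.\<close>
    define z where "z = sqrt (u / (v * w))"
    define y where "y = z * v / u"
    have zp: "z > 0" "z ^ 2 = u / (v * w)" using uv w by (simp_all add: z_def)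
    have yp: "y > 0" using zp uv by (simp add: y_def)
    have yz: "y + z = z * w / u" using uv by (simp add: y_def w_def field_simps)
    have zz: "z * z = u / (v * w)" using zp(2) by (simp add: power2_eq_square)
    have "(y + z) * z = (z * z) * w / u" using yz by simp
    also have "\<dots> = 1 / v" unfolding zz using uv w by (simp add: field_simps)
    finally have 1: "1 / ((y + z) * z) = v" by simp
    have "(y + z) * y = (z * z) * (v * w) / (u * u)" unfolding yz by (simp add: y_def)
    also have "\<dots> = 1 / u" unfolding zz using uv w by (simp add: field_simps)
    finally have 2: "1 / ((y + z) * y) = u" by simp
    have "C u v = Q z y" unfolding Q_def 1 2 ..
    then show ?thesis using Qconst[OF yp zp(1)] by (simp add: C_def C0_def)
  qed
  define f where "f = (\<lambda>u. g u - C0)"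
  have f_add: "f (u + v) = f u + f v" if "0 < u" "0 < v" for u v using CC[OF that] by (simp add: f_def)
  have Fform: "F t = C0 + 2 * c * t + f (1 / t)" for t by (simp add: f_def g_def H_def)
  have form2: "\<Psi> x1 x2 x3 x4 = 4 * C0 + 2 * c * ((x1 + x3) * (x2 + x4)) + f ((1/x1 + 1/x3) * (1/x2 + 1/x4))
      + (b x1 x2 + b x2 x3 + b x3 x4 + b x4 x1)"
    if p: "0 < x1" "0 < x2" "0 < x3" "0 < x4" for x1 x2 x3 x4
  proof -
    have "(1/x1 + 1/x3) * (1/x2 + 1/x4) = (1 / (x1 * x2) + 1 / (x2 * x3)) + (1 / (x3 * x4) + 1 / (x4 * x1))"
      by (simp add: algebra_simps)
    then have "f ((1/x1 + 1/x3) * (1/x2 + 1/x4)) = f (1 / (x1 * x2)) + f (1 / (x2 * x3)) + f (1 / (x3 * x4)) + f (1 / (x4 * x1))"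
      using p by (simp add: f_add add_pos_pos)
    then show ?thesis unfolding form[OF p] Fform by (simp add: algebra_simps)
  qed
  have b1: "b x 1 = 0" if "0 < x" for x using m1[OF that] by (simp add: b_def)
  have b0: "b x y = 0" if xy: "0 < x" "0 < y" for x y
  proof -
    define B where "B = (\<lambda>X Y. b (exp X) (exp Y))"
    have Badd: "B X (Y + Y') = B X Y + B X Y'" for X Y Y' by (simp add: B_def exp_add b_mult)
    have Banti: "B Y X = - B X Y" for X Y unfolding B_def by (rule b_anti)
    have BX: "B (X + X') Y = B X Y + B X' Y" for X X' Y
      using Badd[of Y X X'] Banti[of "X + X'" Y] Banti[of X Y] Banti[of X' Y] by linarith
    have lin: "B X Y = X * B 1 Y" for X Y
    proof (rule additive_linear[of "\<lambda>X. B X Y", OF BX])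
      fix x :: "nat \<Rightarrow> real" assume x: "x \<longlonglongrightarrow> 0"
      \<comment> \<open>With these sides the ratio of right to left is \<open>exp (x k)\<close> while \<open>1/x1
        + 1/x3\<close> is constantly 1, so that the argument of \<open>f\<close>, over which there
        is no control yet, does not move.\<close>
      let ?x1 = "\<lambda>k. 1 + exp (x k)" and ?x3 = "\<lambda>k. 1 + exp (- x k)"
      have pos: "0 < 1 + exp t" for t :: real using exp_gt_zero[of t] by linarith
      have l: "?x1 \<longlonglongrightarrow> 2" "?x3 \<longlonglongrightarrow> 2"
        using tendsto_add[OF tendsto_const tendsto_exp[OF x], of 1]
          tendsto_add[OF tendsto_const tendsto_exp[OF tendsto_minus[OF x]], of 1] by simp_all
      obtain M where M: "\<forall>\<^sub>F k in sequentially. \<Psi> (?x1 k) (exp Y) (?x3 k) 1 \<le> M"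
        using bd[OF l(1) tendsto_const l(2) tendsto_const, of "exp Y" 1] pos by auto
      have eq: "\<Psi> (?x1 k) (exp Y) (?x3 k) 1 = (4 * C0 + f (exp (- Y) + 1)) + 2 * c * ((?x1 k + ?x3 k) * (exp Y + 1)) + B (x k) Y" for k
      proof -
        have r: "?x1 k = exp (x k) * ?x3 k" by (simp add: algebra_simps exp_minus)
        have inv1: "1 / ?x1 k + 1 / ?x3 k = 1"
        proof -
          have "1 / ?x3 k = exp (x k) / ?x1 k" unfolding r using pos[of "- x k"] by simp
          then have "1 / ?x1 k + 1 / ?x3 k = 1 / ?x1 k + exp (x k) / ?x1 k" by (rule arg_cong)
          also have "\<dots> = (1 + exp (x k)) / ?x1 k" by (rule add_divide_distrib[symmetric])
          also have "\<dots> = 1" using pos[of "x k"] by (intro divide_self) simp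
          finally show ?thesis .
        qed
        have "b (?x1 k) (exp Y) = B (x k) Y + b (?x3 k) (exp Y)"
        proof -
          have "b (exp Y) (?x1 k) = b (exp Y) (exp (x k)) + b (exp Y) (?x3 k)"
            unfolding r by (rule b_mult) (use pos in auto)
          then show ?thesis using b_anti[of "exp Y"] by (simp add: B_def)
        qed
        moreover have "b (exp Y) (?x3 k) = - b (?x3 k) (exp Y)" by (rule b_anti)
        moreover have "b (?x3 k) 1 = 0" "b 1 (?x1 k) = 0" using b1 b_anti[of 1 "?x1 k"] pos by simp_all
        moreover have "(1 / ?x1 k + 1 / ?x3 k) * (1 / exp Y + 1 / 1) = exp (- Y) + 1"
          unfolding inv1 by (simp add: exp_minus inverse_eq_divide)
        ultimately show ?thesis using form2[of "?x1 k" "exp Y" "?x3 k" 1] pos by simp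
      qed
      let ?h = "\<lambda>k. 2 * c * ((?x1 k + ?x3 k) * (exp Y + 1))"
      have h: "?h \<longlonglongrightarrow> 2 * c * ((2 + 2) * (exp Y + 1))" using l by (intro tendsto_intros)
      have "\<forall>\<^sub>F k in sequentially. ?h k > 2 * c * ((2 + 2) * (exp Y + 1)) - 1"
        using order_tendstoD(1)[OF h] by simp
      then have "\<forall>\<^sub>F k in sequentially. B (x k) Y \<le> M - (4 * C0 + f (exp (- Y) + 1)) - (2 * c * ((2 + 2) * (exp Y + 1)) - 1)"
        using M
      proof eventually_elim
        case (elim k)
        then show ?case using eq[of k] by linarith
      qed
      then show "\<exists>M. \<forall>\<^sub>F k in sequentially. B (x k) Y \<le> M" by blast
    qed
    have "B 1 1 = 0" using Banti[of 1 1] by simp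
    then have "B 1 Y = 0" for Y using Banti[of 1 Y] lin[of Y 1] by simp
    then have "B (ln x) (ln y) = 0" using lin[of "ln x" "ln y"] by simp
    then show ?thesis using xy by (simp add: B_def)
  qed
  have form3: "\<Psi> x1 x2 x3 x4 = 4 * C0 + 2 * c * ((x1 + x3) * (x2 + x4)) + f ((1/x1 + 1/x3) * (1/x2 + 1/x4))"
    if p: "0 < x1" "0 < x2" "0 < x3" "0 < x4" for x1 x2 x3 x4
    unfolding form2[OF p] using b0 p by simp
  have f_lin: "f t = t * f 1" if "0 < t" for t
  proof (rule additive_pos_linear[OF f_add _ that])
    fix x :: "nat \<Rightarrow> real" assume x: "x \<longlonglongrightarrow> 1" "\<forall>k. 0 < x k"
    \<comment> \<open>The sides are chosen to make the argument of \<open>f\<close> equal to \<open>x k\<close>.\<close>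
    have l: "(\<lambda>k. 2 / x k) \<longlonglongrightarrow> 2" using tendsto_divide[OF tendsto_const x(1), of 2] by simp
    obtain M where M: "\<forall>\<^sub>F k in sequentially. \<Psi> (2 / x k) 2 (2 / x k) 2 \<le> M"
      using bd[OF l tendsto_const l tendsto_const, of 2 2] x(2) by auto
    have eq: "\<Psi> (2 / x k) 2 (2 / x k) 2 = 4 * C0 + 2 * c * ((2 / x k + 2 / x k) * 4) + f (x k)" for k
      using form3[of "2 / x k" 2 "2 / x k" 2] x(2) by simp
    have h: "(\<lambda>k. 2 * c * ((2 / x k + 2 / x k) * 4)) \<longlonglongrightarrow> 2 * c * ((2 + 2) * 4)" using l by (intro tendsto_intros)
    have "\<forall>\<^sub>F k in sequentially. 2 * c * ((2 / x k + 2 / x k) * 4) > 2 * c * ((2 + 2) * 4) - 1"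
      using order_tendstoD(1)[OF h] by simp
    then have "\<forall>\<^sub>F k in sequentially. f (x k) \<le> M - 4 * C0 - (2 * c * ((2 + 2) * 4) - 1)"
      using M
    proof eventually_elim
      case (elim k)
      then show ?case using eq[of k] by linarith
    qed
    then show "\<exists>M. \<forall>\<^sub>F k in sequentially. f (x k) \<le> M" by blast
  qed auto
  show ?thesis
  proof (rule exI[of _ "4 * C0"], rule exI[of _ "f 1"], intro allI impI)
    fix x1 x2 x3 x4 :: real assume p: "0 < x1" "0 < x2" "0 < x3" "0 < x4"
    have "0 < (1/x1 + 1/x3) * (1/x2 + 1/x4)" using p by (intro mult_pos_pos add_pos_pos) auto
    then have "f ((1/x1 + 1/x3) * (1/x2 + 1/x4)) = ((1/x1 + 1/x3) * (1/x2 + 1/x4)) * f 1" by (rule f_lin)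
    then show "\<Psi> x1 x2 x3 x4 = 4 * C0 + 2 * c * ((x1 + x3) * (x2 + x4)) + f 1 * ((1/x1 + 1/x3) * (1/x2 + 1/x4))"
      unfolding form3[OF p] by (simp only: mult.commute[of "f 1"])
  qed
qed

section \<open>Valuations in the plane\<close>

text \<open>For polytopes around the origin this is Hausdorff convergence
  (\<open>radially_converges_imp_hausdorff\<close>,
  \<open>hausdorff_imp_radially_converges\<close>), in a form that is stable under products with
  boxes and under polarity.\<close>
definition radially_converges :: "(nat \<Rightarrow> 'a::real_normed_vector set) \<Rightarrow> 'a set \<Rightarrow> bool" where
  "radially_converges X P \<longleftrightarrow> (\<forall>c>1. \<forall>\<^sub>F k in sequentially. (*\<^sub>R) (1 / c) ` P \<subseteq> X k \<and> X k \<subseteq> (*\<^sub>R) c ` P)"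

text \<open>Top edge of height \<open>a\<close> above the origin and slope \<open>s\<close>, bottom edge of
  depth \<open>b\<close> and slope \<open>-r\<close>, over the interval from \<open>-p\<close> to
  \<open>q\<close>; with these signs a shear changes \<open>s\<close> and \<open>r\<close> by
  opposite amounts. If the edges cross inside the interval the figure degenerates to a triangle or
  less, which is still covered by the definition.\<close>
definition trapezoid :: "real \<Rightarrow> real \<Rightarrow> real \<Rightarrow> real \<Rightarrow> real \<Rightarrow> real \<Rightarrow> (real \<times> real) set" where
  "trapezoid p q a s b r = {(u, v). - p \<le> u \<and> u \<le> q \<and> - (b + r * u) \<le> v \<and> v \<le> a + s * u}"

lemma affine_between:
  fixes a s p q u :: real
  assumes "0 \<le> a - p * s" "0 \<le> a + q * s" "- p \<le> u" "u \<le> q"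
  shows "0 \<le> a + s * u"
proof (cases "s \<ge> 0")
  case True
  then have "s * (- p) \<le> s * u" using assms by (intro mult_left_mono) auto
  then show ?thesis using assms by (simp add: mult.commute)
next
  case False
  then have "s * q \<le> s * u" using assms by (intro mult_left_mono_neg) auto
  then show ?thesis using assms by (simp add: mult.commute)
qed

lemma polytope_o_trapezoid:
  assumes "0 < p" "0 < q" "0 < a" "0 < b"
  shows "polytope_o UNIV (trapezoid p q a s b r)"
proof -
  let ?N = "{(- 1 / p, 0), (1 / q, 0), (- s / a, 1 / a), (- r / b, - 1 / b)}"
  have "- 1 / p * u \<le> 1 \<longleftrightarrow> - p \<le> u" "1 / q * u \<le> 1 \<longleftrightarrow> u \<le> q"
    "- s / a * u + 1 / a * v \<le> 1 \<longleftrightarrow> v \<le> a + s * u" "- r / b * u + - 1 / b * v \<le> 1 \<longleftrightarrow> - (b + r * u) \<le> v" for u v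
    using assms by (auto simp: field_simps)
  then have eq: "trapezoid p q a s b r = halfs UNIV ?N" by (auto simp: trapezoid_def halfs_def inner_prod_def)
  have "trapezoid p q a s b r \<subseteq> {- p..q} \<times> {- (b + \<bar>r\<bar> * (p + q)) .. a + \<bar>s\<bar> * (p + q)}"
  proof
    fix y assume "y \<in> trapezoid p q a s b r"
    then obtain u v where y: "y = (u, v)" and *: "- p \<le> u" "u \<le> q" "- (b + r * u) \<le> v" "v \<le> a + s * u"
      by (auto simp: trapezoid_def)
    have "\<bar>u\<bar> \<le> p + q" using * assms by linarith
    then have "\<bar>s * u\<bar> \<le> \<bar>s\<bar> * (p + q)" "\<bar>r * u\<bar> \<le> \<bar>r\<bar> * (p + q)" by (auto simp: abs_mult intro!: mult_left_mono)
    then have "- (b + \<bar>r\<bar> * (p + q)) \<le> v" "v \<le> a + \<bar>s\<bar> * (p + q)" using * by linarith+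
    then show "y \<in> {- p..q} \<times> {- (b + \<bar>r\<bar> * (p + q)) .. a + \<bar>s\<bar> * (p + q)}" using * y by simp
  qed
  moreover have "bounded ({- p..q} \<times> {- (b + \<bar>r\<bar> * (p + q)) .. a + \<bar>s\<bar> * (p + q)})"
    by (intro bounded_Times bounded_closed_interval)
  ultimately have "bounded (halfs UNIV ?N)" unfolding eq[symmetric] using bounded_subset by blast
  then show ?thesis unfolding eq by (intro polytope_o_halfs) auto
qed

definition plane_map :: "real \<Rightarrow> real \<Rightarrow> real \<Rightarrow> real \<Rightarrow> real \<times> real \<Rightarrow> real \<times> real" where
  "plane_map a b c d = (\<lambda>(u, v). (a * u + b * v, c * u + d * v))"

lemma linear_plane_map: "linear (plane_map a b c d)"
  by (rule linearI) (auto simp: plane_map_def algebra_simps)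

lemma plane_map_comp: "plane_map a b c d (plane_map a' b' c' d' x) = plane_map (a * a' + b * c') (a * b' + b * d') (c * a' + d * c') (c * b' + d * d') x"
  by (cases x) (simp add: plane_map_def algebra_simps)

lemma plane_map_inverse:
  assumes "a * d - b * c = 1"
  shows "plane_map d (- b) (- c) a (plane_map a b c d x) = x" "plane_map a b c d (plane_map d (- b) (- c) a x) = x"
proof -
  have e: "d * (a * u + b * v) + - b * (c * u + d * v) = (a * d - b * c) * u"
    "- c * (a * u + b * v) + a * (c * u + d * v) = (a * d - b * c) * v"
    "a * (d * u + - b * v) + b * (- c * u + a * v) = (a * d - b * c) * u"
    "c * (d * u + - b * v) + d * (- c * u + a * v) = (a * d - b * c) * v" for u v
    by (simp_all add: algebra_simps)
  obtain u v where "x = (u, v)" by fastforce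
  then show "plane_map d (- b) (- c) a (plane_map a b c d x) = x" "plane_map a b c d (plane_map d (- b) (- c) a x) = x"
    unfolding plane_map_def by (simp_all only: prod.case e assms mult_1)
qed

lemma polytope_o_plane_map: "a * d - b * c = 1 \<Longrightarrow> polytope_o UNIV P \<Longrightarrow> polytope_o UNIV (plane_map a b c d ` P)"
  by (rule polytope_o_linear_image[OF linear_plane_map inj_on_inverseI[of _ "plane_map d (- b) (- c) a"]]) (rule plane_map_inverse)

lemma plane_map_image:
  assumes "a * d - b * c = 1"
    "\<And>u v. (u, v) \<in> P \<longleftrightarrow> (a * u + b * v, c * u + d * v) \<in> Q"
  shows "plane_map a b c d ` P = Q"
proof (intro equalityI subsetI)
  fix y assume y: "y \<in> Q"
  obtain u v where uv: "plane_map d (- b) (- c) a y = (u, v)" by fastforce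
  have "plane_map a b c d (u, v) = y" using plane_map_inverse(2)[OF assms(1), of y] uv by simp
  moreover from this have "(u, v) \<in> P" using assms(2)[of u v] y by (simp add: plane_map_def)
  ultimately show "y \<in> plane_map a b c d ` P" by (metis imageI)
qed (use assms(2) in \<open>auto simp: plane_map_def\<close>)

lemma trapezoid_radially_converges:
  assumes l: "P \<longlonglongrightarrow> p" "Q \<longlonglongrightarrow> q" "A \<longlonglongrightarrow> a" "S \<longlonglongrightarrow> 0" "B \<longlonglongrightarrow> b"
    and pos: "0 < p" "0 < q" "0 < a" "0 < b"
  shows "radially_converges (\<lambda>k. trapezoid (P k) (Q k) (A k) (S k) (B k) 0) (trapezoid p q a 0 b 0)"
  unfolding radially_converges_def
proof (intro allI impI)
  fix c :: real assume c: "c > 1"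
  have lt: "x / c < x" "x < c * x" if "0 < x" for x using that c by (simp_all add: divide_less_eq)
  define d1 where "d1 = a - a / c"
  define d2 where "d2 = c * a - a"
  have d: "d1 > 0" "d2 > 0" using lt[OF pos(3)] by (simp_all add: d1_def d2_def)
  define \<delta> where "\<delta> = min d1 d2 / 2"
  have "\<delta> > 0" "\<delta> < d1" "\<delta> < d2" using d by (auto simp: \<delta>_def min_def)
  then have \<delta>: "\<delta> > 0" "a / c < a - \<delta>" "a + \<delta> < c * a" by (simp_all add: d1_def d2_def)
  define \<eta> where "\<eta> = \<delta> / (c * (p + q))"
  have \<eta>: "\<eta> > 0" "\<eta> * (c * (p + q)) = \<delta>" using \<delta> pos c by (auto simp: \<eta>_def)
  have "\<forall>\<^sub>F k in sequentially. p / c < P k \<and> P k < c * p \<and> q / c < Q k \<and> Q k < c * q \<and>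
     b / c < B k \<and> B k < c * b \<and> a - \<delta> / 2 < A k \<and> A k < a + \<delta> / 2 \<and> - \<eta> / 2 < S k \<and> S k < \<eta> / 2"
    using l lt pos \<delta>(1) \<eta>(1) by (intro eventually_conj order_tendstoD) auto
  then show "\<forall>\<^sub>F k in sequentially. (*\<^sub>R) (1 / c) ` trapezoid p q a 0 b 0 \<subseteq> trapezoid (P k) (Q k) (A k) (S k) (B k) 0 \<and>
      trapezoid (P k) (Q k) (A k) (S k) (B k) 0 \<subseteq> (*\<^sub>R) c ` trapezoid p q a 0 b 0"
  proof eventually_elim
    case (elim k)
    have su: "\<bar>S k * u\<bar> \<le> \<delta> / 2" if "- (c * p) \<le> u" "u \<le> c * q" for u
    proof -
      have "\<bar>u\<bar> \<le> c * (p + q)" using that pos c by (auto simp: abs_le_iff algebra_simps) (smt (verit) mult_nonneg_nonneg)+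
      then have "\<bar>S k\<bar> * \<bar>u\<bar> \<le> (\<eta> / 2) * (c * (p + q))" using elim \<eta> by (intro mult_mono) auto
      then show ?thesis using \<eta>(2) by (simp add: abs_mult)
    qed
    have cp: "p / c > 0" "q / c > 0" "b / c > 0" "a / c > 0" using pos c by auto
    show ?case
    proof (intro conjI subsetI)
      fix y assume "y \<in> (*\<^sub>R) (1 / c) ` trapezoid p q a 0 b 0"
      then obtain u v where uv: "(u, v) \<in> trapezoid p q a 0 b 0" "y = (u / c, v / c)" by auto
      have "- p / c \<le> u / c" "u / c \<le> q / c" "- b / c \<le> v / c" "v / c \<le> a / c"
        using uv(1) c divide_right_mono[of "- p" u c] divide_right_mono[of "- b" v c]
        by (auto simp: trapezoid_def intro: divide_right_mono)
      moreover have "- (c * p) \<le> u / c" "u / c \<le> c * q"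
        using calculation lt pos by (smt (verit) minus_divide_left)+
      then have "\<bar>S k * (u / c)\<bar> \<le> \<delta> / 2" by (rule su)
      ultimately have "- P k \<le> u / c" "u / c \<le> Q k" "- (B k + 0 * (u / c)) \<le> v / c" "v / c \<le> A k + S k * (u / c)"
        using elim \<delta> by linarith+
      then show "y \<in> trapezoid (P k) (Q k) (A k) (S k) (B k) 0" by (simp add: uv(2) trapezoid_def)
    next
      fix y assume y: "y \<in> trapezoid (P k) (Q k) (A k) (S k) (B k) 0"
      obtain u v where uv: "y = (u, v)" by fastforce
      have "- (c * p) \<le> u" "u \<le> c * q" using y elim by (auto simp: trapezoid_def uv)
      then have "\<bar>S k * u\<bar> \<le> \<delta> / 2" by (rule su)
      then have "- (c * p) \<le> u" "u \<le> c * q" "- (c * b) \<le> v" "v \<le> c * a"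
        using y elim \<delta> by (auto simp: trapezoid_def uv)
      then have "(u / c, v / c) \<in> trapezoid p q a 0 b 0" using c by (auto simp: trapezoid_def field_simps)
      then have "c *\<^sub>R (u / c, v / c) \<in> (*\<^sub>R) c ` trapezoid p q a 0 b 0" by (rule imageI)
      then show "y \<in> (*\<^sub>R) c ` trapezoid p q a 0 b 0" using c by (simp add: uv)
    qed
  qed
qed

text \<open>Vanishing of the mixed difference for nested pairs, the case that a union of rectangles
  provides, implies it for all pairs.\<close>
lemma mixed_difference_all:
  fixes h :: "real \<Rightarrow> real \<Rightarrow> real"
  assumes le: "\<And>p q p' q'. 0 < p \<Longrightarrow> 0 < q \<Longrightarrow> p \<le> p' \<Longrightarrow> q \<le> q' \<Longrightarrow> h p q + h p' q' = h p q' + h p' q"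
    and pos: "0 < p" "0 < q" "0 < p'" "0 < q'"
  shows "h p q + h p' q' = h p q' + h p' q"
proof -
  show ?thesis
  proof (cases "p \<le> p'")
    case True
    show ?thesis
    proof (cases "q \<le> q'")
      case True
      show ?thesis by (rule le[OF pos(1,2) \<open>p \<le> p'\<close> True])
    next
      case False
      then have "h p q' + h p' q = h p q + h p' q'"
        by (intro le[OF pos(1,4) True]) simp
      then show ?thesis by simp
    qed
  next
    case pp: False
    then have pp: "p' \<le> p" by simp
    show ?thesis
    proof (cases "q \<le> q'")
      case True
      have "h p' q + h p q' = h p' q' + h p q"
        by (rule le[OF pos(3,2) pp True])
      then show ?thesis by simp
    next
      case False
      then have "h p' q' + h p q = h p' q + h p q'"
        by (intro le[OF pos(3,4) pp]) simp
      then show ?thesis by simp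
    qed
  qed
qed

text \<open>The structure that \<open>\<mu>\<close> induces on each coordinate plane. Shears in both
  coordinate directions generate \<open>SL(2)\<close>.\<close>
locale plane_valuation =
  fixes \<kappa> :: "(real \<times> real) set \<Rightarrow> real"
  assumes val: "valuation_on UNIV \<kappa>"
    and shear1: "\<And>s P. polytope_o UNIV P \<Longrightarrow> \<kappa> (plane_map 1 0 s 1 ` P) = \<kappa> P"
    and shear2: "\<And>s P. polytope_o UNIV P \<Longrightarrow> \<kappa> (plane_map 1 s 0 1 ` P) = \<kappa> P"
    and bound: "\<And>X P. \<forall>k. polytope_o UNIV (X k) \<Longrightarrow> polytope_o UNIV P \<Longrightarrow> radially_converges X P \<Longrightarrow>
       \<exists>M. \<forall>\<^sub>F k in sequentially. \<kappa> (X k) \<le> M"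
begin

text \<open>For \<open>c \<noteq> 0\<close> a matrix of determinant one is a product of three shears.\<close>
lemma unimodular_invariant:
  assumes "a * d - b * c = 1" "c \<noteq> 0" "polytope_o UNIV P"
  shows "\<kappa> (plane_map a b c d ` P) = \<kappa> P"
proof -
  have e: "(a - 1) / c * c = a - 1" "c * ((d - 1) / c) = d - 1" using assms by auto
  have "plane_map a b c d x = plane_map 1 ((a - 1) / c) 0 1 (plane_map 1 0 c 1 (plane_map 1 ((d - 1) / c) 0 1 x))" for x
  proof -
    have "b = (d - 1) / c + (a - 1) / c * (c * ((d - 1) / c) + 1)"
    proof -
      have "c * ((d - 1) / c + (a - 1) / c * (c * ((d - 1) / c) + 1)) = (d - 1) + (a - 1) * d"
        using assms(2) by (simp add: field_simps)
      also have "\<dots> = c * b" using assms(1) by (simp add: algebra_simps)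
      finally show ?thesis using assms(2) by simp
    qed
    then show ?thesis unfolding plane_map_comp using e by simp
  qed
  then have "plane_map a b c d ` P = plane_map 1 ((a - 1) / c) 0 1 ` plane_map 1 0 c 1 ` plane_map 1 ((d - 1) / c) 0 1 ` P"
    by (simp add: image_image)
  then show ?thesis using assms(3) by (simp add: shear1 shear2 polytope_o_plane_map)
qed

text \<open>A quarter turn composed with a diagonal map has \<open>c \<noteq> 0\<close>; so does the quarter
  turn itself.\<close>
lemma diagonal:
  assumes "l \<noteq> 0" "polytope_o UNIV P"
  shows "\<kappa> (plane_map l 0 0 (1 / l) ` P) = \<kappa> P"
proof -
  have "plane_map l 0 0 (1 / l) ` P = plane_map 0 (- 1) 1 0 ` plane_map 0 (1 / l) (- l) 0 ` P"
    by (simp add: image_image plane_map_comp)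
  then show ?thesis using assms by (simp add: unimodular_invariant polytope_o_plane_map)
qed

definition \<Phi> :: "real \<Rightarrow> real \<Rightarrow> real \<Rightarrow> real \<Rightarrow> real" where
  "\<Phi> p q a b = \<kappa> (trapezoid p q a 0 b 0)"

lemma trapezoid_shear:
  assumes "0 < p" "0 < q" "0 < a" "0 < b"
  shows "\<kappa> (trapezoid p q a (s + t) b (r - t)) = \<kappa> (trapezoid p q a s b r)"
proof -
  have "plane_map 1 0 t 1 ` trapezoid p q a s b r = trapezoid p q a (s + t) b (r - t)"
    by (rule plane_map_image) (auto simp: trapezoid_def algebra_simps)
  then show ?thesis using shear1[OF polytope_o_trapezoid[OF assms], of t s r] by simp
qed

text \<open>Here the first top lies below the second one and the first bottom above the second one. Pairing
  the lower top with the lower bottom and the higher top with the higher bottom gives two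
  trapezoids whose union is the outer and whose intersection is the inner trapezoid; there is no
  gap in the union because the inner edges do not cross.\<close>
lemma trapezoid_nested:
  assumes pos: "0 < p" "0 < q" "0 < a" "0 < b" "0 < a'" "0 < b'"
    and le: "a - p * s \<le> a' - p * s'" "a + q * s \<le> a' + q * s'"
      "b - p * r \<le> b' - p * r'" "b + q * r \<le> b' + q * r'"
    and ad: "0 \<le> (a + b) - p * (s + r)" "0 \<le> (a + b) + q * (s + r)"
  shows "\<kappa> (trapezoid p q a s b r) + \<kappa> (trapezoid p q a' s' b' r') = \<kappa> (trapezoid p q a s b' r') + \<kappa> (trapezoid p q a' s' b r)"
proof -
  have t: "a + s * u \<le> a' + s' * u" "b + r * u \<le> b' + r' * u" "- (b + r * u) \<le> a + s * u"
    if "- p \<le> u" "u \<le> q" for u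
    using affine_between[of "a' - a" p "s' - s" q u] affine_between[of "b' - b" p "r' - r" q u]
      affine_between[of "a + b" p "s + r" q u] that le ad by (simp_all add: algebra_simps)
  have "\<kappa> (trapezoid p q a' s' b' r') + \<kappa> (trapezoid p q a s b r) = \<kappa> (trapezoid p q a s b' r') + \<kappa> (trapezoid p q a' s' b r)"
  proof (rule valuation_on_split[OF val])
    show "trapezoid p q a s b' r' \<union> trapezoid p q a' s' b r = trapezoid p q a' s' b' r'"
      unfolding trapezoid_def using t by (auto; smt (verit))
    show "trapezoid p q a s b' r' \<inter> trapezoid p q a' s' b r = trapezoid p q a s b r"
      unfolding trapezoid_def using t by (auto; smt (verit))
  qed (use pos polytope_o_trapezoid in auto)
  then show ?thesis by simp
qed

text \<open>Top and bottom contribute independently. Two tops need not be comparable, so all four trapezoids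
  are compared with a rectangle large enough to contain them.\<close>
lemma trapezoid_separate:
  assumes pos: "0 < p" "0 < q" "0 < a" "0 < b" "0 < a'" "0 < b'"
    and ad: "0 \<le> (a + b) - p * (s + r)" "0 \<le> (a + b) + q * (s + r)"
      "0 \<le> (a + b') - p * (s + r')" "0 \<le> (a + b') + q * (s + r')"
      "0 \<le> (a' + b) - p * (s' + r)" "0 \<le> (a' + b) + q * (s' + r)"
      "0 \<le> (a' + b') - p * (s' + r')" "0 \<le> (a' + b') + q * (s' + r')"
  shows "\<kappa> (trapezoid p q a s b r) + \<kappa> (trapezoid p q a' s' b' r') = \<kappa> (trapezoid p q a s b' r') + \<kappa> (trapezoid p q a' s' b r)"
proof -
  define N where "N = a + a' + b + b' + (p + q) * (\<bar>s\<bar> + \<bar>s'\<bar> + \<bar>r\<bar> + \<bar>r'\<bar>)"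
  have big: "z - p * t \<le> N - p * 0" "z + q * t \<le> N + q * 0"
    if "z \<in> {a, a', b, b'}" "t \<in> {s, s', r, r'}" for z t
  proof -
    have "z \<le> a + a' + b + b'" using that pos by auto
    moreover have "p * \<bar>t\<bar> \<le> (p + q) * (\<bar>s\<bar> + \<bar>s'\<bar> + \<bar>r\<bar> + \<bar>r'\<bar>)" "q * \<bar>t\<bar> \<le> (p + q) * (\<bar>s\<bar> + \<bar>s'\<bar> + \<bar>r\<bar> + \<bar>r'\<bar>)"
      using that pos by (auto intro!: mult_mono)
    moreover have "- (p * t) \<le> p * \<bar>t\<bar>" "q * t \<le> q * \<bar>t\<bar>"
      using pos mult_left_mono[of "- t" "\<bar>t\<bar>" p] mult_left_mono[of t "\<bar>t\<bar>" q] by auto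
    ultimately show "z - p * t \<le> N - p * 0" "z + q * t \<le> N + q * 0" unfolding N_def by linarith+
  qed
  have N0: "0 < N"
  proof -
    have "0 \<le> (p + q) * (\<bar>s\<bar> + \<bar>s'\<bar> + \<bar>r\<bar> + \<bar>r'\<bar>)" using pos by (intro mult_nonneg_nonneg) auto
    then show ?thesis unfolding N_def using pos by linarith
  qed
  have "\<kappa> (trapezoid p q a s b r) + \<kappa> (trapezoid p q N 0 N 0) = \<kappa> (trapezoid p q a s N 0) + \<kappa> (trapezoid p q N 0 b r)"
    "\<kappa> (trapezoid p q a s b' r') + \<kappa> (trapezoid p q N 0 N 0) = \<kappa> (trapezoid p q a s N 0) + \<kappa> (trapezoid p q N 0 b' r')"
    "\<kappa> (trapezoid p q a' s' b r) + \<kappa> (trapezoid p q N 0 N 0) = \<kappa> (trapezoid p q a' s' N 0) + \<kappa> (trapezoid p q N 0 b r)"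
    "\<kappa> (trapezoid p q a' s' b' r') + \<kappa> (trapezoid p q N 0 N 0) = \<kappa> (trapezoid p q a' s' N 0) + \<kappa> (trapezoid p q N 0 b' r')"
    by (rule trapezoid_nested; ((rule big; simp; fail) | (use pos N0 ad in \<open>simp; fail\<close>)))+
  then show ?thesis by linarith
qed

text \<open>The effect of tilting the top edge by \<open>s\<close>. It is measured at a height at which the
  edges do not cross, and \<open>trapezoid_value\<close> shows that it is the same at all heights.\<close>
definition slope :: "real \<Rightarrow> real \<Rightarrow> real \<Rightarrow> real" where
  "slope p q s = \<kappa> (trapezoid p q (1 + \<bar>s\<bar> * (p + q)) s (1 + \<bar>s\<bar> * (p + q)) 0)
      - \<Phi> p q (1 + \<bar>s\<bar> * (p + q)) (1 + \<bar>s\<bar> * (p + q))"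

text \<open>The edges of a trapezoid do not cross strictly inside the base interval, if \<open>a\<close> is
  the length of its vertical section through the origin and \<open>s\<close> the slope of the top
  relative to the bottom.\<close>
definition admissible :: "real \<Rightarrow> real \<Rightarrow> real \<Rightarrow> real \<Rightarrow> bool" where
  "admissible p q a s \<longleftrightarrow> 0 \<le> a - p * s \<and> 0 \<le> a + q * s"

lemma admissible_abs: "0 < p \<Longrightarrow> 0 < q \<Longrightarrow> \<bar>s\<bar> * (p + q) \<le> N \<Longrightarrow> admissible p q N s"
proof -
  assume *: "0 < p" "0 < q" "\<bar>s\<bar> * (p + q) \<le> N"
  have "p * s \<le> p * \<bar>s\<bar>" "- (q * s) \<le> q * \<bar>s\<bar>" using * mult_left_mono[of s "\<bar>s\<bar>" p] mult_left_mono[of "- s" "\<bar>s\<bar>" q] by auto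
  moreover have "0 \<le> p * \<bar>s\<bar>" "0 \<le> q * \<bar>s\<bar>" using * by auto
  moreover have "\<bar>s\<bar> * (p + q) = p * \<bar>s\<bar> + q * \<bar>s\<bar>" by (simp add: algebra_simps)
  ultimately show ?thesis using * unfolding admissible_def by (intro conjI; linarith)
qed

text \<open>Compare with the parallelogram whose top and bottom edges both have slope \<open>s\<close>,
  which a shear turns into a rectangle. The depth of the bottom is free, so the effect of the
  slope does not change with it.\<close>
lemma slope_flip:
  assumes pos: "0 < p" "0 < q" "0 < a" "0 < b" "0 < b'" and ad: "admissible p q (a + b) s" "admissible p q (a + b') (- s)"
  shows "\<kappa> (trapezoid p q a s b 0) - \<Phi> p q a b = - (\<kappa> (trapezoid p q a (- s) b' 0) - \<Phi> p q a b')"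
proof -
  have "\<kappa> (trapezoid p q a s b 0) + \<kappa> (trapezoid p q a 0 b' (- s)) = \<kappa> (trapezoid p q a s b' (- s)) + \<kappa> (trapezoid p q a 0 b 0)"
    by (rule trapezoid_separate) (use pos ad in \<open>auto simp: admissible_def\<close>)
  moreover have "\<kappa> (trapezoid p q a 0 b' (- s)) = \<kappa> (trapezoid p q a (- s) b' 0)"
    using trapezoid_shear[of p q a b' 0 "- s" "- s"] pos by simp
  moreover have "\<kappa> (trapezoid p q a s b' (- s)) = \<Phi> p q a b'"
    using trapezoid_shear[of p q a b' 0 s 0] pos by (simp add: \<Phi>_def)
  ultimately show ?thesis unfolding \<Phi>_def by linarith
qed

text \<open>The same comparison with the parallelogram whose height varies at the top.\<close>
lemma slope_flip2:
  assumes pos: "0 < p" "0 < q" "0 < a" "0 < b" "0 < a'" and ad: "admissible p q (a + b) s" "admissible p q (a' + b) (- s)"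
  shows "\<kappa> (trapezoid p q a s b 0) - \<Phi> p q a b = - (\<kappa> (trapezoid p q a' (- s) b 0) - \<Phi> p q a' b)"
proof -
  have "\<kappa> (trapezoid p q a 0 b s) + \<kappa> (trapezoid p q a' (- s) b 0) = \<kappa> (trapezoid p q a 0 b 0) + \<kappa> (trapezoid p q a' (- s) b s)"
    by (rule trapezoid_separate) (use pos ad in \<open>auto simp: admissible_def\<close>)
  moreover have "\<kappa> (trapezoid p q a 0 b s) = \<kappa> (trapezoid p q a s b 0)"
    using trapezoid_shear[of p q a b 0 s s] pos by simp
  moreover have "\<kappa> (trapezoid p q a' (- s) b s) = \<Phi> p q a' b"
    using trapezoid_shear[of p q a' b 0 "- s" 0] pos by (simp add: \<Phi>_def)
  ultimately show ?thesis unfolding \<Phi>_def by linarith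
qed

lemma trapezoid_value:
  assumes pos: "0 < p" "0 < q" "0 < a" "0 < b" and ad: "admissible p q (a + b) s"
  shows "\<kappa> (trapezoid p q a s b 0) = \<Phi> p q a b + slope p q s"
proof -
  let ?N = "1 + \<bar>s\<bar> * (p + q)"
  have N: "?N > 0" using pos by (simp add: add_pos_nonneg)
  have 1: "\<kappa> (trapezoid p q a s b 0) - \<Phi> p q a b = - (\<kappa> (trapezoid p q a (- s) ?N 0) - \<Phi> p q a ?N)"
    by (rule slope_flip) (use pos N ad admissible_abs[of p q "-s" "a + ?N"] in auto)
  have 2: "\<kappa> (trapezoid p q a (- s) ?N 0) - \<Phi> p q a ?N = - (\<kappa> (trapezoid p q ?N (- (- s)) ?N 0) - \<Phi> p q ?N ?N)"
    by (rule slope_flip2) (use pos N admissible_abs[of p q "-s" "a + ?N"] admissible_abs[of p q s "?N + ?N"] in auto)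
  show ?thesis using 1 2 by (simp add: slope_def)
qed

text \<open>By separation the effects of a tilted top and a tilted bottom add up, and a shear collects both
  slopes at the top.\<close>
lemma slope_add:
  assumes pos: "0 < p" "0 < q"
  shows "slope p q (s + t) = slope p q s + slope p q t"
proof -
  define N where "N = 1 + (\<bar>s\<bar> + \<bar>t\<bar>) * (p + q)"
  have N: "N > 0" using pos unfolding N_def by (simp add: add_pos_nonneg)
  have "\<bar>s + t\<bar> * (p + q) \<le> (\<bar>s\<bar> + \<bar>t\<bar>) * (p + q)" "\<bar>s\<bar> * (p + q) \<le> (\<bar>s\<bar> + \<bar>t\<bar>) * (p + q)" "\<bar>t\<bar> * (p + q) \<le> (\<bar>s\<bar> + \<bar>t\<bar>) * (p + q)"
    using pos by (auto intro!: mult_right_mono)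
  then have "\<bar>s + t\<bar> * (p + q) \<le> N + N" "\<bar>s\<bar> * (p + q) \<le> N + N" "\<bar>t\<bar> * (p + q) \<le> N + N"
    using N unfolding N_def by linarith+
  then have ad: "admissible p q (N + N) (s + t)" "admissible p q (N + N) s" "admissible p q (N + N) t"
    using pos by (auto intro!: admissible_abs)
  have "\<kappa> (trapezoid p q N s N t) + \<kappa> (trapezoid p q N 0 N 0) = \<kappa> (trapezoid p q N s N 0) + \<kappa> (trapezoid p q N 0 N t)"
    by (rule trapezoid_separate) (use pos N ad in \<open>auto simp: admissible_def\<close>)
  moreover have "\<kappa> (trapezoid p q N s N t) = \<kappa> (trapezoid p q N (s + t) N 0)"
    using trapezoid_shear[OF pos N N, of s t t] by simp
  moreover have "\<kappa> (trapezoid p q N 0 N t) = \<kappa> (trapezoid p q N t N 0)"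
    using trapezoid_shear[OF pos N N, of 0 t t] by simp
  ultimately show ?thesis
    using trapezoid_value[OF pos N N ad(1)] trapezoid_value[OF pos N N ad(2)] trapezoid_value[OF pos N N ad(3)] by (simp add: \<Phi>_def)
qed

lemma slope_linear:
  assumes pos: "0 < p" "0 < q"
  shows "slope p q s = s * slope p q 1"
proof (rule additive_linear[of "slope p q", OF slope_add[OF pos]])
  fix x :: "nat \<Rightarrow> real" assume x: "x \<longlonglongrightarrow> 0"
  let ?N = "1 + (p + q)"
  have N: "?N > 0" using pos by simp
  let ?X = "\<lambda>k. trapezoid p q ?N (x k) ?N 0"
  have "radially_converges ?X (trapezoid p q ?N 0 ?N 0)" by (rule trapezoid_radially_converges) (use x pos in auto)
  then obtain M where M: "\<forall>\<^sub>F k in sequentially. \<kappa> (?X k) \<le> M"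
    using bound[of ?X "trapezoid p q ?N 0 ?N 0"] polytope_o_trapezoid[OF pos N N] by blast
  have "\<forall>\<^sub>F k in sequentially. \<bar>x k\<bar> < 1" using order_tendstoD(2)[OF tendsto_rabs[OF x], of 1] by simp
  then have "\<forall>\<^sub>F k in sequentially. slope p q (x k) \<le> M - \<Phi> p q ?N ?N"
    using M
  proof eventually_elim
    case (elim k)
    have "\<bar>x k\<bar> * (p + q) \<le> 1 * (p + q)" using elim pos by (intro mult_right_mono) auto
    also have "\<dots> \<le> ?N + ?N" using pos by simp
    finally have "admissible p q (?N + ?N) (x k)" by (rule admissible_abs[OF pos])
    then show ?case using trapezoid_value[OF pos N N] elim by force
  qed
  then show "\<exists>M. \<forall>\<^sub>F k in sequentially. slope p q (x k) \<le> M" by blast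
qed

lemma slope_split:
  assumes pos: "0 < p" "0 < q" "p \<le> p'" "q \<le> q'"
  shows "slope p q 1 + slope p' q' 1 = slope p q' 1 + slope p' q 1"
proof -
  let ?N = "1 + (p' + q')"
  have N: "?N > 0" and pos': "0 < p'" "0 < q'" using pos by auto
  have v: "\<kappa> (trapezoid p q ?N t ?N 0) + \<kappa> (trapezoid p' q' ?N t ?N 0) = \<kappa> (trapezoid p q' ?N t ?N 0) + \<kappa> (trapezoid p' q ?N t ?N 0)" for t
  proof -
    have "\<kappa> (trapezoid p' q' ?N t ?N 0) + \<kappa> (trapezoid p q ?N t ?N 0) = \<kappa> (trapezoid p q' ?N t ?N 0) + \<kappa> (trapezoid p' q ?N t ?N 0)"
      by (rule valuation_on_split[OF val polytope_o_trapezoid[OF pos(1) pos'(2) N N] polytope_o_trapezoid[OF pos'(1) pos(2) N N] polytope_o_trapezoid[OF pos' N N]])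
         (use pos in \<open>auto simp: trapezoid_def\<close>)
    then show ?thesis by simp
  qed
  have ad: "admissible p q (?N + ?N) 1" "admissible p' q' (?N + ?N) 1" "admissible p q' (?N + ?N) 1" "admissible p' q (?N + ?N) 1"
    using pos pos' by (auto simp: admissible_def)
  show ?thesis
    using v[of 1] v[of 0] trapezoid_value[OF pos(1,2) N N ad(1)] trapezoid_value[OF pos' N N ad(2)]
      trapezoid_value[OF pos(1) pos'(2) N N ad(3)] trapezoid_value[OF pos'(1) pos(2) N N ad(4)]
    unfolding \<Phi>_def by linarith
qed

lemma trapezoid_diagonal:
  assumes l: "0 < l"
  shows "plane_map l 0 0 (1 / l) ` trapezoid p q a (l^2 * t) b 0 = trapezoid (l * p) (l * q) (a / l) t (b / l) 0"
proof (rule plane_map_image)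
  show "l * (1 / l) - 0 * 0 = 1" using l by simp
  fix u v
  have "- (l * p) \<le> l * u + 0 * v \<longleftrightarrow> - p \<le> u" "l * u + 0 * v \<le> l * q \<longleftrightarrow> u \<le> q"
    using l mult_le_cancel_left_pos[OF l, of "- p" u] by auto
  moreover have "- (b / l + 0 * (l * u + 0 * v)) \<le> 0 * u + 1 / l * v \<longleftrightarrow> - (b + 0 * u) \<le> v"
    using l by (simp add: minus_divide_left divide_le_cancel del: minus_divide_left[symmetric])
  moreover have "0 * u + 1 / l * v \<le> a / l + t * (l * u + 0 * v) \<longleftrightarrow> v \<le> a + l^2 * t * u"
  proof -
    have "a / l + t * (l * u + 0 * v) = (a + l^2 * t * u) / l"
      using l by (simp add: add_divide_distrib power2_eq_square)
    then show ?thesis using l by (simp add: divide_le_cancel)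
  qed
  ultimately show "(u, v) \<in> trapezoid p q a (l^2 * t) b 0 \<longleftrightarrow>
     (l * u + 0 * v, 0 * u + 1 / l * v) \<in> trapezoid (l * p) (l * q) (a / l) t (b / l) 0"
    by (simp only: trapezoid_def mem_Collect_eq prod.case)
qed

text \<open>The diagonal map with entries \<open>l\<close> and \<open>1/l\<close> multiplies slopes by
  \<open>1/l^2\<close>.\<close>
lemma slope_scale:
  assumes pos: "0 < p" "0 < q" "0 < l"
  shows "slope (l * p) (l * q) 1 = l^2 * slope p q 1"
proof -
  define N where "N = 1 + l^2 * (p + q)"
  have N: "N > 0" "N / l > 0" using pos by (auto simp: N_def add_pos_nonneg)
  have pos': "0 < l * p" "0 < l * q" using pos by auto
  have k: "\<kappa> (trapezoid (l * p) (l * q) (N / l) t (N / l) 0) = \<kappa> (trapezoid p q N (l^2 * t) N 0)" for t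
    unfolding trapezoid_diagonal[OF pos(3), symmetric] by (rule diagonal) (use pos polytope_o_trapezoid N in auto)
  have "0 \<le> l^2 * (p + q)" using pos by simp
  moreover have "\<bar>l^2\<bar> * (p + q) = l^2 * (p + q)" by simp
  ultimately have "\<bar>l^2\<bar> * (p + q) \<le> N + N" unfolding N_def by linarith
  then have 1: "admissible p q (N + N) (l^2)" by (rule admissible_abs[OF pos(1,2)])
  have 2: "admissible (l * p) (l * q) (N / l + N / l) 1"
  proof (rule admissible_abs[OF pos'])
    have "\<bar>1\<bar> * (l * p + l * q) = l * (p + q)" by (simp add: distrib_left)
    also have "\<dots> = (l^2 * (p + q)) / l" using pos(3) by (simp add: power2_eq_square)
    also have "\<dots> \<le> (N + N) / l" using pos N(1) by (intro divide_right_mono) (simp_all add: N_def)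
    finally show "\<bar>1\<bar> * (l * p + l * q) \<le> N / l + N / l" by (simp add: add_divide_distrib)
  qed
  have "slope (l * p) (l * q) 1 = slope p q (l^2)"
    using k[of 1] k[of 0] trapezoid_value[OF pos(1,2) N(1) N(1) 1] trapezoid_value[OF pos' N(2) N(2) 2] by (simp add: \<Phi>_def)
  then show ?thesis using slope_linear[OF pos(1,2), of "l^2"] by simp
qed

text \<open>Half a turn exchanges left and right as well as top and bottom.\<close>
lemma slope_rotate:
  assumes pos: "0 < p" "0 < q"
  shows "slope q p 1 = - slope p q 1"
proof -
  let ?N = "1 + (p + q)"
  have N: "?N > 0" using pos by simp
  have im: "plane_map (- 1) 0 0 (- 1) ` trapezoid p q ?N t ?N 0 = trapezoid q p ?N 0 ?N (- t)" for t
    by (rule plane_map_image) (auto simp: trapezoid_def algebra_simps)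
  have k: "\<kappa> (trapezoid q p ?N 0 ?N (- t)) = \<kappa> (trapezoid p q ?N t ?N 0)" for t
    unfolding im[symmetric] using diagonal[of "-1" "trapezoid p q ?N t ?N 0"] polytope_o_trapezoid[OF pos N N] by simp
  have s: "\<kappa> (trapezoid q p ?N 0 ?N (- t)) = \<kappa> (trapezoid q p ?N (- t) ?N 0)" for t
    using trapezoid_shear[of q p ?N ?N 0 "- t" "- t"] pos N by simp
  have "admissible p q (?N + ?N) 1" "admissible q p (?N + ?N) (- 1)" using pos by (auto simp: admissible_def)
  then have "slope q p (- 1) = slope p q 1"
    using k[of 1] k[of 0] s[of 1] trapezoid_value[OF pos N N] trapezoid_value[OF pos(2,1) N N] by (simp add: \<Phi>_def)
  then show ?thesis using slope_linear[of q p "- 1"] pos by simp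
qed

text \<open>The effect of the slope separates into a right part and a left part, \<open>x q - x p\<close>,
  and by \<open>slope_scale\<close> the function \<open>x\<close> satisfies \<open>x (l * q) = x l
  + l^2 * x q\<close>. Comparing this for the pairs \<open>(2, q)\<close> and \<open>(q,
  2)\<close> gives \<open>x\<close> explicitly.\<close>
lemma slope_formula: "\<exists>c. \<forall>p q. 0 < p \<longrightarrow> 0 < q \<longrightarrow> slope p q 1 = c * (q^2 - p^2)"
proof -
  define x where "x = (\<lambda>q. slope 1 q 1)"
  have x1: "x 1 = 0" using slope_rotate[of 1 1] by (simp add: x_def)
  have split: "slope p q 1 + slope p' q' 1 = slope p q' 1 + slope p' q 1"
    if "0 < p" "0 < q" "0 < p'" "0 < q'" for p q p' q'
    using mixed_difference_all[of "\<lambda>p q. slope p q 1", OF slope_split] that by blast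
  have form: "slope p q 1 = x q - x p" if "0 < p" "0 < q" for p q
    using split[of p q 1 1] slope_rotate[of 1 p] that x1 by (simp add: x_def)
  have xs: "x (l * q) = x l + l^2 * x q" if "0 < l" "0 < q" for l q
    using slope_scale[of 1 q l] form[of l "l * q"] form[of 1 q] that x1 by simp
  have xq: "x q = x 2 / 3 * (q^2 - 1)" if "0 < q" for q
    using xs[of 2 q] xs[of q 2] that by (simp add: mult.commute field_simps)
  have "slope p q 1 = x 2 / 3 * (q^2 - p^2)" if "0 < p" "0 < q" for p q
  proof -
    have "slope p q 1 = x 2 / 3 * (q^2 - 1) - x 2 / 3 * (p^2 - 1)"
      using form[OF that] xq[OF that(1)] xq[OF that(2)] by linarith
    also have "\<dots> = x 2 / 3 * ((q^2 - 1) - (p^2 - 1))" by (rule right_diff_distrib[symmetric])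
    finally show ?thesis by simp
  qed
  then show ?thesis by blast
qed

lemma \<Phi>_split:
  assumes "0 < p" "0 < q" "0 < p'" "0 < q'" "0 < a" "0 < b"
  shows "\<Phi> p q a b + \<Phi> p' q' a b = \<Phi> p q' a b + \<Phi> p' q a b"
proof -
  have le: "\<Phi> p q a b + \<Phi> p' q' a b = \<Phi> p q' a b + \<Phi> p' q a b"
    if "0 < p" "0 < q" "p \<le> p'" "q \<le> q'" for p q p' q'
  proof -
    have "\<kappa> (trapezoid p' q' a 0 b 0) + \<kappa> (trapezoid p q a 0 b 0) = \<kappa> (trapezoid p q' a 0 b 0) + \<kappa> (trapezoid p' q a 0 b 0)"
    proof (rule valuation_on_split[OF val])
      show "polytope_o UNIV (trapezoid p q' a 0 b 0)" "polytope_o UNIV (trapezoid p' q a 0 b 0)" "polytope_o UNIV (trapezoid p' q' a 0 b 0)"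
        by (rule polytope_o_trapezoid; use that assms(5,6) in simp)+
    qed (use that in \<open>auto simp: trapezoid_def\<close>)
    then show ?thesis by (simp add: \<Phi>_def)
  qed
  show ?thesis using mixed_difference_all[of "\<lambda>p q. \<Phi> p q a b", OF le] assms by blast
qed

text \<open>The triangle \<open>-x \<le> u\<close>, \<open>-y \<le> v\<close>, \<open>u + v \<le> z\<close>
  is a trapezoid of slope \<open>-1\<close> whose edges meet at the right end, and a map of
  determinant one permutes its three sides cyclically. This is the equation \<open>tri\<close>.\<close>
theorem rectangle_values:
  "\<exists>c0 c1 c2. \<forall>p q a b. 0 < p \<longrightarrow> 0 < q \<longrightarrow> 0 < a \<longrightarrow> 0 < b \<longrightarrow>
     \<kappa> (trapezoid p q a 0 b 0) = c0 + c1 * ((p + q) * (a + b)) + c2 * ((1/p + 1/q) * (1/a + 1/b))"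
proof -
  obtain c where c: "\<And>p q. 0 < p \<Longrightarrow> 0 < q \<Longrightarrow> slope p q 1 = c * (q^2 - p^2)" using slope_formula by blast
  define \<Psi> where "\<Psi> = (\<lambda>x1 x2 x3 x4. \<Phi> x3 x1 x2 x4)"
  have "\<exists>c0 c2. \<forall>x1 x2 x3 x4. 0 < x1 \<longrightarrow> 0 < x2 \<longrightarrow> 0 < x3 \<longrightarrow> 0 < x4 \<longrightarrow>
     \<Psi> x1 x2 x3 x4 = c0 + 2 * c * ((x1 + x3) * (x2 + x4)) + c2 * ((1/x1 + 1/x3) * (1/x2 + 1/x4))"
  proof (rule rectangle_equation)
    fix x1 x2 x3 x4 :: real assume pos: "0 < x1" "0 < x2" "0 < x3" "0 < x4"
    show "\<Psi> x1 x2 x3 x4 + \<Psi> y1 x2 y3 x4 = \<Psi> x1 x2 y3 x4 + \<Psi> y1 x2 x3 x4" if "0 < y1" "0 < y3" for y1 y3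
      using \<Phi>_split[of x3 x1 y3 y1 x2 x4] pos that by (simp add: \<Psi>_def)
    show "\<Psi> x1 x2 x3 x4 = \<Psi> x4 x1 x2 x3"
    proof -
      have "plane_map 0 (- 1) 1 0 ` trapezoid x3 x1 x2 0 x4 0 = trapezoid x2 x4 x1 0 x3 0"
        by (rule plane_map_image) (auto simp: trapezoid_def)
      then show ?thesis
        using unimodular_invariant[of 0 0 "- 1" 1 "trapezoid x3 x1 x2 0 x4 0"] polytope_o_trapezoid[OF pos(3,1,2,4)] by (simp add: \<Psi>_def \<Phi>_def)
    qed
    show "\<Psi> (l * x1) (x2 / l) (l * x3) (x4 / l) = \<Psi> x1 x2 x3 x4" if l: "0 < l" for l
    proof -
      have "plane_map l 0 0 (1 / l) ` trapezoid x3 x1 x2 0 x4 0 = trapezoid (l * x3) (l * x1) (x2 / l) 0 (x4 / l) 0"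
        using trapezoid_diagonal[OF l, of x3 x1 x2 0 x4] by simp
      then show ?thesis
        using diagonal[of l "trapezoid x3 x1 x2 0 x4 0"] l polytope_o_trapezoid[OF pos(3,1,2,4)] by (simp add: \<Psi>_def \<Phi>_def)
    qed
  next
    fix x y z :: real assume pos: "0 < x" "0 < y" "0 < z"
    have t: "\<kappa> (trapezoid x (y + z) z (- 1) y 0) = \<Psi> (y + z) z x y - c * ((y + z)^2 - x^2)"
      if "0 < x" "0 < y" "0 < z" for x y z
    proof -
      have "admissible x (y + z) (z + y) (- 1)" using that by (simp add: admissible_def)
      then have "\<kappa> (trapezoid x (y + z) z (- 1) y 0) = \<Phi> x (y + z) z y + slope x (y + z) (- 1)"
        using trapezoid_value[of x "y + z" z y "- 1"] that by simp
      moreover have "slope x (y + z) (- 1) = - c * ((y + z)^2 - x^2)"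
        using slope_linear[of x "y + z" "- 1"] c[of x "y + z"] that by simp
      ultimately show ?thesis by (simp add: \<Psi>_def)
    qed
    have tz: "trapezoid x (y + z) z (- 1) y 0 = {(u, v). - x \<le> u \<and> - y \<le> v \<and> u + v \<le> z}" for x y z :: real
      by (auto simp: trapezoid_def)
    have "plane_map 0 1 (- 1) (- 1) ` trapezoid x (y + z) z (- 1) y 0 = trapezoid y (z + x) x (- 1) z 0"
      unfolding tz by (rule plane_map_image) auto
    then have "\<kappa> (trapezoid y (z + x) x (- 1) z 0) = \<kappa> (trapezoid x (y + z) z (- 1) y 0)"
      using unimodular_invariant[of 0 "- 1" 1 "- 1" "trapezoid x (y + z) z (- 1) y 0"] polytope_o_trapezoid[of x "y + z" z y] pos by simp
    then show "\<Psi> (y + z) z x y - c * ((y + z)^2 - x^2) = \<Psi> (z + x) x y z - c * ((z + x)^2 - y^2)"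
      using t[OF pos] t[OF pos(2,3,1)] by simp
  next
    fix X1 X2 X3 X4 :: "nat \<Rightarrow> real" and x1 x2 x3 x4 :: real
    assume l: "X1 \<longlonglongrightarrow> x1" "X2 \<longlonglongrightarrow> x2" "X3 \<longlonglongrightarrow> x3" "X4 \<longlonglongrightarrow> x4" and pos: "0 < x1" "0 < x2" "0 < x3" "0 < x4"
      and p: "\<forall>k. 0 < X1 k \<and> 0 < X2 k \<and> 0 < X3 k \<and> 0 < X4 k"
    have "radially_converges (\<lambda>k. trapezoid (X3 k) (X1 k) (X2 k) 0 (X4 k) 0) (trapezoid x3 x1 x2 0 x4 0)"
      by (rule trapezoid_radially_converges) (use l pos in auto)
    then show "\<exists>M. \<forall>\<^sub>F k in sequentially. \<Psi> (X1 k) (X2 k) (X3 k) (X4 k) \<le> M"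
      unfolding \<Psi>_def \<Phi>_def by (intro bound) (use p pos polytope_o_trapezoid in auto)
  qed
  then obtain c0 c2 where cc: "\<And>x1 x2 x3 x4. 0 < x1 \<Longrightarrow> 0 < x2 \<Longrightarrow> 0 < x3 \<Longrightarrow> 0 < x4 \<Longrightarrow>
     \<Psi> x1 x2 x3 x4 = c0 + 2 * c * ((x1 + x3) * (x2 + x4)) + c2 * ((1/x1 + 1/x3) * (1/x2 + 1/x4))"
    by blast
  show ?thesis
  proof (rule exI[of _ c0], rule exI[of _ "2 * c"], rule exI[of _ c2], intro allI impI)
    fix p q a b :: real assume "0 < p" "0 < q" "0 < a" "0 < b"
    then show "\<kappa> (trapezoid p q a 0 b 0) = c0 + 2 * c * ((p + q) * (a + b)) + c2 * ((1/p + 1/q) * (1/a + 1/b))"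
      using cc[of q a p b] unfolding \<Psi>_def \<Phi>_def by (simp add: add.commute)
  qed
qed

end

section \<open>Volume and polar volume\<close>

lemma abs_det_swap:
  fixes m n :: "'n::finite"
  shows "\<bar>det (matrix (\<lambda>x::real^'n. \<chi> i. x $ Transposition.transpose m n i))\<bar> = 1"
proof -
  let ?h = "\<lambda>x::real^'n. \<chi> i. x $ Transposition.transpose m n i"
  have lin: "linear ?h" by (rule linearI) (simp_all add: vec_eq_iff)
  have "?h \<circ> ?h = id" by (simp add: fun_eq_iff vec_eq_iff)
  then have "det (matrix ?h) * det (matrix ?h) = 1"
    using det_comp[OF lin lin] by (simp add: matrix_id_mat_1)
  then show ?thesis by (metis abs_1 abs_mult_self_eq abs_of_nonneg abs_ge_zero real_sqrt_abs2 real_sqrt_one)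
qed

lemma measure_swap_box:
  fixes m n :: "'n::finite"
  shows "measure lebesgue ((\<lambda>x::real^'n. \<chi> i. x $ Transposition.transpose m n i) ` cbox a b) = measure lebesgue (cbox a b)"
proof -
  let ?t = "Transposition.transpose m n"
  let ?h = "\<lambda>x::real^'n. \<chi> i. x $ ?t i"
  have inv: "?h (?h x) = x" for x by (simp add: vec_eq_iff)
  have all: "(\<forall>i. Q (?t i)) \<longleftrightarrow> (\<forall>i. Q i)" for Q
    by (metis transpose_involutory)
  have mem: "?h x \<in> cbox (?h a) (?h b) \<longleftrightarrow> x \<in> cbox a b" for x a b
    using all[of "\<lambda>i. a $ i \<le> x $ i \<and> x $ i \<le> b $ i"] by (simp add: mem_box_cart)
  have im: "?h ` cbox a b = cbox (?h a) (?h b)"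
  proof (intro equalityI subsetI)
    fix y assume "y \<in> cbox (?h a) (?h b)"
    then have "?h y \<in> cbox a b" using mem[of "?h y" a b] inv by simp
    then show "y \<in> ?h ` cbox a b" using image_eqI[of y ?h "?h y" "cbox a b"] inv[of y] by (simp only:)
  next
    fix y assume "y \<in> ?h ` cbox a b"
    then obtain x where "y = ?h x" "x \<in> cbox a b" by (rule imageE)
    then show "y \<in> cbox (?h a) (?h b)" using mem[of x a b] by (simp only:)
  qed
  have "(\<Prod>i\<in>UNIV. b $ ?t i - a $ ?t i) = (\<Prod>i\<in>UNIV. b $ i - a $ i)"
    by (rule prod.reindex_bij_betw[of ?t UNIV UNIV "\<lambda>i. b $ i - a $ i"]) simp
  moreover have "cbox (?h a) (?h b) = {} \<longleftrightarrow> cbox a b = {}" unfolding im[symmetric] by (rule image_is_empty)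
  ultimately show ?thesis unfolding im by (simp add: content_cbox_if_cart)
qed

lemma measure_shear_box:
  fixes m n :: "'n::finite" and a b :: "real^'n"
  assumes mn: "m \<noteq> n"
  shows "measure lebesgue ((\<lambda>x::real^'n. \<chi> i. if i = m then x $ m + x $ n else x $ i) ` cbox a b)
    = measure lebesgue (cbox a b)"
proof (cases "cbox a b = {}")
  case False
  let ?h = "\<lambda>x::real^'n. \<chi> i. if i = m then x $ m + x $ n else x $ i"
  \<comment> \<open>The image of a box under this map is accessible when its lower bound in the added coordinate
    is not negative; a translation achieves this.\<close>
  define c where "c = axis n (- (a $ n))"
  have h: "?h (c + x) = ?h c + ?h x" for x by (simp add: vec_eq_iff)
  have im: "?h ` cbox (c + a) (c + b) = (+) (?h c) ` ?h ` cbox a b"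
    unfolding cbox_translation image_image h ..
  have "measure lebesgue (?h ` cbox a b) = measure lebesgue (?h ` cbox (c + a) (c + b))"
    unfolding im by (rule measure_translation[symmetric])
  also have "\<dots> = measure lebesgue (cbox (c + a) (c + b))"
    by (rule measure_shear_interval[OF mn]) (use False in \<open>simp_all add: c_def cbox_translation\<close>)
  also have "\<dots> = measure lebesgue (cbox a b)"
    unfolding cbox_translation by (rule measure_translation)
  finally show ?thesis .
qed simp

text \<open>Every linear map is a product of maps that are singular, diagonal, swap two coordinates or add
  one coordinate to another. The index type is only assumed to be finite; without an order on the
  coordinates the matrix of an elementary shear is not triangular in any evident sense, and its
  determinant comes from \<open>det_shear\<close>.\<close>
theorem volume_linear_image:
  fixes f :: "real^'n \<Rightarrow> real^'n"
  assumes "linear f"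
  shows "\<forall>S\<in>lmeasurable. f ` S \<in> lmeasurable \<and>
    measure lebesgue (f ` S) = \<bar>det (matrix f)\<bar> * measure lebesgue S" (is "?Q f")
proof -
  have boxes: "?Q h" if "linear h" "\<bar>det (matrix h)\<bar> = 1"
      "\<And>a b. measure lebesgue (h ` cbox a b) = measure lebesgue (cbox a b)" for h :: "real^'n \<Rightarrow> real^'n"
  proof
    fix S :: "(real^'n) set" assume "S \<in> lmeasurable"
    from measure_linear_sufficient[OF that(1) this, of 1] that
    show "h ` S \<in> lmeasurable \<and> measure lebesgue (h ` S) = \<bar>det (matrix h)\<bar> * measure lebesgue S"
      by simp
  qed
  show ?thesis using assms
  proof (rule induct_linear_elementary)
    fix f g :: "real^'n \<Rightarrow> real^'n" assume fg: "linear f" "linear g" "?Q f" "?Q g"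
    have im: "(f \<circ> g) ` S = f ` g ` S" for S by auto
    show "?Q (f \<circ> g)" unfolding im det_comp[OF fg(2,1)] using fg(3,4) by (simp add: abs_mult)
  next
    fix f :: "real^'n \<Rightarrow> real^'n" and i
    assume f: "linear f" "\<And>x. f x $ i = 0"
    have ni: "\<not> inj f"
    proof
      assume "inj f"
      then obtain x where "f x = axis i 1" using linear_injective_imp_surjective[OF f(1)] by (metis surjD)
      then show False using f(2)[of x] by simp
    qed
    then have "det (matrix f) = 0" using det_nz_iff_inj[OF f(1)] by blast
    moreover have "negligible (f ` S)" for S by (rule negligible_linear_singular_image[OF f(1) ni])
    ultimately show "?Q f" by (simp add: negligible_iff_measure)
  next
    fix c
    show "?Q (\<lambda>x. \<chi> i. c i * x $ i)"
      using measurable_stretch[of _ c] measure_stretch[of _ c] det_diag_map[of c] by (simp add: diag_map_def[abs_def])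
  next
    fix m n :: 'n assume "m \<noteq> n"
    show "?Q (\<lambda>x. \<chi> i. x $ Transposition.transpose m n i)"
      by (rule boxes[OF _ abs_det_swap measure_swap_box]) (rule linearI, simp_all add: vec_eq_iff)
  next
    fix m n :: 'n assume mn: "m \<noteq> n"
    let ?h = "\<lambda>x::real^'n. \<chi> i. if i = m then x $ m + x $ n else x $ i"
    have "axis m (1::real) $ i = (if i = m then 1 else 0)" for i by (simp add: axis_def)
    then have eq: "?h = (\<lambda>x. x + (axis n 1 \<bullet> x) *\<^sub>R axis m 1)"
      by (simp add: fun_eq_iff vec_eq_iff inner_axis')
    have "axis n (1::real) \<bullet> axis m 1 = 0" using mn by (simp add: inner_axis_axis)
    then have "\<bar>det (matrix ?h)\<bar> = 1" unfolding eq using det_shear[of "axis n 1" "axis m 1"] by simp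
    then show "?Q ?h"
      by (intro boxes measure_shear_box[OF mn]) (simp_all add: eq linear_rank_one_update)
  qed
qed

lemma volume_scale:
  fixes S :: "(real^'n) set"
  assumes "compact S" "0 < c"
  shows "measure lebesgue ((*\<^sub>R) c ` S) = c ^ CARD('n) * measure lebesgue S"
proof -
  have "linear ((*\<^sub>R) c :: real^'n \<Rightarrow> _)" by (simp add: linear_scale_self)
  from volume_linear_image[OF this] show ?thesis
    using assms by (simp add: lmeasurable_compact det_matrix_scaleR)
qed

lemma volume_tendsto:
  fixes X :: "nat \<Rightarrow> (real^'n) set"
  assumes cX: "\<And>k. compact (X k)" and cP: "compact P" and "radially_converges X P"
  shows "(\<lambda>k. measure lebesgue (X k)) \<longlonglongrightarrow> measure lebesgue P"
proof (rule order_tendstoI)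
  let ?V = "measure lebesgue P"
  have sub: "\<forall>\<^sub>F k in sequentially. (1 / c) ^ CARD('n) * ?V \<le> measure lebesgue (X k) \<and>
      measure lebesgue (X k) \<le> c ^ CARD('n) * ?V" if c: "c > 1" for c
  proof -
    have ev: "\<forall>\<^sub>F k in sequentially. (*\<^sub>R) (1 / c) ` P \<subseteq> X k \<and> X k \<subseteq> (*\<^sub>R) c ` P"
      using assms(3) c by (simp add: radially_converges_def)
    have m: "(*\<^sub>R) d ` P \<in> lmeasurable" for d by (intro lmeasurable_compact compact_scaling cP)
    have X: "X k \<in> lmeasurable" for k by (intro lmeasurable_compact cX)
    show ?thesis
      using ev
    proof eventually_elim
      case (elim k)
      have "measure lebesgue ((*\<^sub>R) (1 / c) ` P) \<le> measure lebesgue (X k)"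
        "measure lebesgue (X k) \<le> measure lebesgue ((*\<^sub>R) c ` P)"
        by (rule measure_mono_fmeasurable; use elim m X in \<open>simp add: fmeasurableD\<close>)+
      moreover have "measure lebesgue ((*\<^sub>R) (1 / c) ` P) = (1 / c) ^ CARD('n) * ?V"
        "measure lebesgue ((*\<^sub>R) c ` P) = c ^ CARD('n) * ?V"
        using c by (intro volume_scale cP; simp)+
      ultimately show ?case by simp
    qed
  qed
  have ex: "\<exists>c>1. Q c" if "eventually Q (at_right (1::real))" for Q
  proof -
    have "eventually (\<lambda>c. 1 < c \<and> Q c) (at_right (1::real))"
      using that eventually_at_right_less[of 1] by eventually_elim simp
    then show ?thesis using eventually_happens'[OF trivial_limit_at_right_real] by blast
  qed
  have l1: "((\<lambda>c. (1 / c) ^ CARD('n) * ?V) \<longlongrightarrow> ?V) (at_right 1)"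
    by (rule tendsto_eq_intros refl | simp)+
  have l2: "((\<lambda>c. c ^ CARD('n) * ?V) \<longlongrightarrow> ?V) (at_right 1)"
    by (rule tendsto_eq_intros refl | simp)+
  show "\<forall>\<^sub>F k in sequentially. a < measure lebesgue (X k)" if a: "a < ?V" for a
  proof -
    obtain c where "c > 1" "a < (1 / c) ^ CARD('n) * ?V" using ex[OF order_tendstoD(1)[OF l1 a]] by blast
    with sub[of c] show ?thesis by (auto elim: eventually_mono)
  qed
  show "\<forall>\<^sub>F k in sequentially. measure lebesgue (X k) < a" if a: "?V < a" for a
  proof -
    obtain c where "c > 1" "c ^ CARD('n) * ?V < a" using ex[OF order_tendstoD(2)[OF l2 a]] by blast
    with sub[of c] show ?thesis by (auto elim: eventually_mono)
  qed
qed

lemma hausdorff_bound: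
  assumes "bounded A" "bounded B" "A \<noteq> {}" "B \<noteq> {}"
  shows "x \<in> A \<Longrightarrow> infdist x B \<le> hausdorff_distance A B" "y \<in> B \<Longrightarrow> infdist y A \<le> hausdorff_distance A B"
proof -
  have bdd: "bdd_above ((\<lambda>x. infdist x B) ` A)" if AB: "bounded A" "B \<noteq> {}" for A B :: "'a set"
  proof -
    obtain b where b: "b \<in> B" using AB by blast
    obtain e where "\<And>x. x \<in> A \<Longrightarrow> dist b x \<le> e" using AB(1) bounded_any_center[of A b] by blast
    then have "infdist x B \<le> e" if "x \<in> A" for x
      using infdist_le[OF b, of x] that by (metis dist_commute order_trans)
    then show ?thesis by (rule bdd_aboveI2)
  qed
  show "infdist x B \<le> hausdorff_distance A B" if "x \<in> A"
    using cSUP_upper[OF that bdd[OF assms(1,4)]] by (simp add: hausdorff_distance_def)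
  show "infdist y A \<le> hausdorff_distance A B" if "y \<in> B"
    using cSUP_upper[OF that bdd[OF assms(2,3)]] by (simp add: hausdorff_distance_def)
qed

lemma polytope_o_nonempty: "polytope_o UNIV P \<Longrightarrow> P \<noteq> {}"
  using polytope_o_zero[OF subspace_UNIV] by blast

lemma radially_converges_imp_hausdorff:
  fixes P :: "'a::euclidean_space set"
  assumes X: "\<And>k. polytope_o UNIV (X k)" and P: "polytope_o UNIV P" and "radially_converges X P"
  shows "hausdorff_converges X P"
  unfolding hausdorff_converges_def LIMSEQ_def
proof (intro allI impI)
  fix \<epsilon> :: real assume e: "0 < \<epsilon>"
  obtain R where R: "R > 0" "\<And>x. x \<in> P \<Longrightarrow> norm x \<le> R" using polytope_o_bounded[OF P] bounded_pos by blast
  define c where "c = 1 + \<epsilon> / (2 * R)"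
  have c: "c > 1" "(c - 1) * R = \<epsilon> / 2" using e R by (simp_all add: c_def)
  have "\<forall>\<^sub>F k in sequentially. (*\<^sub>R) (1 / c) ` P \<subseteq> X k \<and> X k \<subseteq> (*\<^sub>R) c ` P"
    using assms(3) c by (simp add: radially_converges_def)
  then have "\<forall>\<^sub>F k in sequentially. dist (hausdorff_distance (X k) P) 0 < \<epsilon>"
  proof eventually_elim
    case (elim k)
    have 1: "infdist x P \<le> \<epsilon> / 2" if x: "x \<in> X k" for x
    proof -
      obtain y where y: "x = c *\<^sub>R y" "y \<in> P" using elim x by blast
      have "x - y = (c - 1) *\<^sub>R y" by (simp add: y scaleR_diff_left)
      then have "dist x y \<le> (c - 1) * R" using R(2)[OF y(2)] c by (simp add: dist_norm mult_left_mono)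
      then show ?thesis using infdist_le[OF y(2), of x] c by simp
    qed
    have 2: "infdist y (X k) \<le> \<epsilon> / 2" if y: "y \<in> P" for y
    proof -
      have "y - (1 / c) *\<^sub>R y = (1 - 1 / c) *\<^sub>R y" by (simp add: scaleR_diff_left)
      moreover have "0 \<le> 1 - 1 / c" "1 - 1 / c \<le> c - 1"
        using c(1) divide_left_mono[of 1 c "c - 1"] by (simp_all add: diff_divide_distrib)
      ultimately have "dist y ((1 / c) *\<^sub>R y) \<le> (c - 1) * R"
        using R(2)[OF y] by (simp add: dist_norm mult_mono)
      moreover have "(1 / c) *\<^sub>R y \<in> X k" using elim y by blast
      ultimately show ?thesis using infdist_le[of "(1 / c) *\<^sub>R y" "X k" y] c by simp
    qed
    have ne: "X k \<noteq> {}" "P \<noteq> {}" using polytope_o_nonempty X P by auto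
    have "hausdorff_distance (X k) P \<le> \<epsilon> / 2"
      unfolding hausdorff_distance_def by (intro max.boundedI cSUP_least ne 1 2)
    moreover have "0 \<le> hausdorff_distance (X k) P"
      using hausdorff_bound(1)[OF polytope_o_bounded[OF X] polytope_o_bounded[OF P] ne polytope_o_zero[OF subspace_UNIV X]] infdist_nonneg
      by (rule order_trans[rotated])
    ultimately show ?case using e by simp
  qed
  then show "\<exists>N. \<forall>k\<ge>N. dist (hausdorff_distance (X k) P) 0 < \<epsilon>" by (simp add: eventually_sequentially)
qed

text \<open>Each point of \<open>X\<close> is \<open>p + (c - 1) w\<close> with \<open>p\<close> the nearest
  point of \<open>P\<close> and \<open>w\<close> in the ball inside \<open>P\<close>, and division
  by \<open>c\<close> makes this a convex combination.\<close>
lemma close_imp_subset_scale: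
  fixes P :: "'a::euclidean_space set"
  assumes P: "convex P" "closed P" and r: "ball 0 r \<subseteq> P" "0 < r" and c: "1 < c"
    and X: "\<And>x. x \<in> X \<Longrightarrow> infdist x P < (c - 1) * r"
  shows "X \<subseteq> (*\<^sub>R) c ` P"
proof
  fix x assume x: "x \<in> X"
  have "P \<noteq> {}" using r by force
  then obtain p where p: "p \<in> P" "infdist x P = dist x p" using infdist_attains_inf[OF P(2)] by metis
  have d: "norm (x - p) < (c - 1) * r" using X[OF x] p by (simp add: dist_norm)
  define w where "w = (1 / (c - 1)) *\<^sub>R (x - p)"
  have "norm w < r" using d c by (simp add: w_def pos_divide_less_eq mult.commute)
  then have w: "w \<in> P" using r by auto
  have xw: "x = p + (c - 1) *\<^sub>R w" using c by (simp add: w_def)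
  have "(1 / c) *\<^sub>R p + ((c - 1) / c) *\<^sub>R w \<in> P"
    using c by (intro convexD[OF P(1) p(1) w]) (simp_all add: add_divide_distrib[symmetric])
  moreover have "x = c *\<^sub>R ((1 / c) *\<^sub>R p + ((c - 1) / c) *\<^sub>R w)" using c by (simp add: xw scaleR_add_right)
  ultimately show "x \<in> (*\<^sub>R) c ` P" by blast
qed

text \<open>If a point \<open>z\<close> of the smaller ball were outside \<open>X\<close>, a separating
  hyperplane would leave a point of the larger ball, the one opposite to the normal, too far from
  \<open>X\<close>.\<close>
lemma ball_inside_close_body:
  fixes X :: "'a::euclidean_space set"
  assumes X: "convex X" "closed X" "X \<noteq> {}" and r: "0 < r"
    and near: "\<And>w. norm w < r \<Longrightarrow> infdist w X < r / 2"
  shows "ball 0 (r / 2) \<subseteq> X"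
proof (rule ccontr)
  assume "\<not> ball 0 (r / 2) \<subseteq> X"
  then obtain z where "z \<in> ball 0 (r / 2)" "z \<notin> X" by blast
  then have z: "norm z < r / 2" "z \<notin> X" by simp_all
  obtain a b where ab: "a \<bullet> z < b" "\<And>x. x \<in> X \<Longrightarrow> b < a \<bullet> x"
    using separating_hyperplane_closed_point[OF X(1,2) z(2)] by blast
  have a: "a \<noteq> 0" using ab X(3) by force
  define s where "s = r / 2 + norm z"
  define w where "w = - ((s / norm a) *\<^sub>R a)"
  have s: "0 < s" "s < r" using z r by (simp_all add: s_def add_pos_nonneg)
  have "norm w = s" using a s by (simp add: w_def)
  then have "infdist w X < r / 2" using near s by simp
  then obtain x where x: "x \<in> X" "dist w x < r / 2" using infdist_attains_inf[OF X(2,3)] by metis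
  have aw: "a \<bullet> w = - (norm a * s)" using a by (simp add: w_def dot_square_norm power2_eq_square)
  have "a \<bullet> (x - w) \<le> norm a * norm (x - w)" by (rule norm_cauchy_schwarz)
  also have "\<dots> \<le> norm a * (r / 2)" using x(2) by (intro mult_left_mono) (simp_all add: dist_norm norm_minus_commute)
  finally have "a \<bullet> x \<le> norm a * (r / 2) - norm a * s" using aw by (simp add: inner_diff_right)
  also have "\<dots> = - (norm a * norm z)" by (simp add: s_def algebra_simps)
  also have "\<dots> \<le> a \<bullet> z" using Cauchy_Schwarz_ineq2[of a z] by linarith
  finally show False using ab(1) ab(2)[OF x(1)] by linarith
qed

text \<open>Both inclusions come from \<open>close_imp_subset_scale\<close>. For the lower one the roles of
  \<open>X k\<close> and \<open>P\<close> are exchanged, which requires a ball inside \<open>X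
  k\<close> of a size that does not shrink with \<open>k\<close>.\<close>
lemma hausdorff_imp_radially_converges:
  fixes P :: "'a::euclidean_space set"
  assumes X: "\<And>k. polytope_o UNIV (X k)" and P: "polytope_o UNIV P" and "hausdorff_converges X P"
  shows "radially_converges X P"
  unfolding radially_converges_def
proof (intro allI impI)
  fix c :: real assume c: "c > 1"
  obtain r where r: "r > 0" "ball 0 r \<subseteq> P" using P by (auto simp: polytope_o_def)
  have clo: "closed (X k)" "closed P" for k using X P polytope_o_compact compact_imp_closed by blast+
  have "\<forall>\<^sub>F k in sequentially. hausdorff_distance (X k) P < min (r / 2) ((c - 1) * (r / 2))"
    using assms(3) r c unfolding hausdorff_converges_def by (intro order_tendstoD(2)) auto
  then show "\<forall>\<^sub>F k in sequentially. (*\<^sub>R) (1 / c) ` P \<subseteq> X k \<and> X k \<subseteq> (*\<^sub>R) c ` P"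
  proof eventually_elim
    case (elim k)
    have ne: "X k \<noteq> {}" "P \<noteq> {}" using polytope_o_nonempty X P by auto
    note hd = hausdorff_bound[OF polytope_o_bounded[OF X[of k]] polytope_o_bounded[OF P] ne]
    have near1: "infdist x P < (c - 1) * (r / 2)" if "x \<in> X k" for x using hd(1)[OF that] elim by linarith
    have near2: "infdist y (X k) < (c - 1) * (r / 2)" "infdist y (X k) < r / 2" if "y \<in> P" for y
      using hd(2)[OF that] elim by linarith+
    have ball: "ball 0 (r / 2) \<subseteq> X k"
      by (rule ball_inside_close_body[OF polytope_o_convex[OF X] clo(1) ne(1) r(1) near2(2)]) (use r in auto)
    have "P \<subseteq> (*\<^sub>R) c ` X k"
      by (rule close_imp_subset_scale[OF polytope_o_convex[OF X] clo(1) ball _ c near2(1)]) (use r in auto)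
    then have "(*\<^sub>R) (1 / c) ` P \<subseteq> (*\<^sub>R) (1 / c) ` (*\<^sub>R) c ` X k" by (rule image_mono)
    also have "\<dots> = X k" using c by (simp add: image_image)
    finally have "(*\<^sub>R) (1 / c) ` P \<subseteq> X k" .
    moreover have "ball 0 (r / 2) \<subseteq> P" using r by auto
    then have "X k \<subseteq> (*\<^sub>R) c ` P"
      by (rule close_imp_subset_scale[OF polytope_o_convex[OF P] clo(2) _ _ c near1]) (use r in auto)
    ultimately show ?case by blast
  qed
qed

lemma polar_mono: "P \<subseteq> Q \<Longrightarrow> polar_body Q \<subseteq> polar_body P"
  by (auto simp: polar_body_def)

lemma polar_scale:
  assumes "0 < c"
  shows "polar_body ((*\<^sub>R) c ` P) = (*\<^sub>R) (1 / c) ` polar_body P"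
proof (intro equalityI subsetI)
  fix x assume "x \<in> polar_body ((*\<^sub>R) c ` P)"
  then have "c *\<^sub>R x \<in> polar_body P" by (simp add: polar_body_def)
  moreover have "x = (1 / c) *\<^sub>R (c *\<^sub>R x)" using assms by simp
  ultimately show "x \<in> (*\<^sub>R) (1 / c) ` polar_body P" by blast
qed (use assms in \<open>auto simp: polar_body_def\<close>)

lemma polar_compact:
  fixes P :: "'a::euclidean_space set"
  assumes "polytope_o UNIV P"
  shows "compact (polar_body P)"
proof -
  obtain e where e: "e > 0" "ball 0 e \<subseteq> P" using assms by (auto simp: polytope_o_def)
  have "norm x \<le> 2 / e" if x: "x \<in> polar_body P" for x
  proof (cases "x = 0")
    case False
    have "(e / 2 / norm x) *\<^sub>R x \<in> P" using e False by (intro subsetD[OF e(2)]) simp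
    then have "x \<bullet> ((e / 2 / norm x) *\<^sub>R x) \<le> 1" using x by (simp only: polar_body_def mem_Collect_eq)
    moreover have "x \<bullet> ((e / 2 / norm x) *\<^sub>R x) = e / 2 * norm x"
      using False by (simp add: dot_square_norm power2_eq_square)
    ultimately have "e / 2 * norm x \<le> 1" by (simp only:)
    then show ?thesis using e by (simp add: field_simps)
  qed (use e in simp)
  then have "bounded (polar_body P)" by (auto simp: bounded_iff)
  moreover have "polar_body P = (\<Inter>y\<in>P. {x. y \<bullet> x \<le> 1})" by (auto simp: polar_body_def inner_commute)
  then have "closed (polar_body P)" by (auto intro!: closed_INT closed_halfspace_le)
  ultimately show ?thesis by (simp add: compact_eq_bounded_closed)
qed

lemma polar_radially_converges: "radially_converges X P \<Longrightarrow> radially_converges (\<lambda>k. polar_body (X k)) (polar_body P)"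
  unfolding radially_converges_def
proof (intro allI impI)
  fix c :: real assume *: "\<forall>c>1. \<forall>\<^sub>F k in sequentially. (*\<^sub>R) (1 / c) ` P \<subseteq> X k \<and> X k \<subseteq> (*\<^sub>R) c ` P" and c: "1 < c"
  then have "\<forall>\<^sub>F k in sequentially. (*\<^sub>R) (1 / c) ` P \<subseteq> X k \<and> X k \<subseteq> (*\<^sub>R) c ` P" by blast
  then show "\<forall>\<^sub>F k in sequentially. (*\<^sub>R) (1 / c) ` polar_body P \<subseteq> polar_body (X k) \<and>
      polar_body (X k) \<subseteq> (*\<^sub>R) c ` polar_body P"
  proof eventually_elim
    case (elim k)
    have "polar_body ((*\<^sub>R) (1 / c) ` P) = (*\<^sub>R) c ` polar_body P" using polar_scale[of "1 / c" P] c by simp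
    moreover have "polar_body ((*\<^sub>R) c ` P) = (*\<^sub>R) (1 / c) ` polar_body P" using polar_scale[of c P] c by simp
    ultimately show ?case using polar_mono[of "(*\<^sub>R) (1 / c) ` P" "X k"] polar_mono[of "X k" "(*\<^sub>R) c ` P"] elim by simp
  qed
qed

text \<open>If \<open>x\<close> is in neither polar, it exceeds 1 at a point of \<open>P\<close> and at a
  point of \<open>Q\<close>, hence on the whole segment between them. The segment lies in \<open>P
  \<union> Q\<close>, so by connectedness it meets \<open>P \<inter> Q\<close>.\<close>
lemma polar_Int:
  fixes P Q :: "'a::real_inner set"
  assumes "closed P" "closed Q" "convex (P \<union> Q)"
  shows "polar_body (P \<inter> Q) = polar_body P \<union> polar_body Q"
proof (rule ccontr)
  assume "polar_body (P \<inter> Q) \<noteq> polar_body P \<union> polar_body Q"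
  then obtain x where x: "x \<in> polar_body (P \<inter> Q)" "x \<notin> polar_body P" "x \<notin> polar_body Q"
    by (auto simp: polar_body_def)
  then obtain y z where yz: "y \<in> P" "x \<bullet> y > 1" "z \<in> Q" "x \<bullet> z > 1"
    by (auto simp: polar_body_def not_le)
  have "closed_segment y z \<subseteq> P \<union> Q" using yz assms(3) by (intro closed_segment_subset) auto
  moreover have "closed_segment y z \<subseteq> {w. x \<bullet> w > 1}"
    using yz by (intro closed_segment_subset convex_halfspace_gt) auto
  moreover have "P \<inter> closed_segment y z \<noteq> {}" "Q \<inter> closed_segment y z \<noteq> {}" using yz by auto
  ultimately obtain w where "w \<in> P \<inter> Q" "x \<bullet> w > 1"
    using connected_closedD[OF connected_segment(1)[of y z] _ _ assms(1,2)] by blast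
  then show False using x(1) by (force simp: polar_body_def)
qed

lemma polar_linear_preimage:
  fixes g :: "real^'n \<Rightarrow> real^'n"
  assumes g: "linear g" "det (matrix g) = 1"
  shows "polar_body P = adjoint g ` polar_body (g ` P)" "linear (adjoint g)" "det (matrix (adjoint g)) = 1"
proof -
  show lin: "linear (adjoint g)" by (rule adjoint_linear[OF g(1)])
  show det: "det (matrix (adjoint g)) = 1" using g matrix_adjoint[OF g(1)] by (simp add: det_transpose)
  have "inj (adjoint g)" using det_nz_iff_inj[OF lin] det by simp
  then have "surj (adjoint g)" using linear_injective_imp_surjective[OF lin] by simp
  moreover have "x \<in> polar_body (g ` P) \<longleftrightarrow> adjoint g x \<in> polar_body P" for x
    by (simp add: polar_body_def adjoint_clauses(2)[OF g(1)])
  then have "polar_body (g ` P) = adjoint g -` polar_body P" by blast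
  ultimately show "polar_body P = adjoint g ` polar_body (g ` P)" by (simp add: surj_image_vimage_eq)
qed

section \<open>Values on boxes\<close>

lemma polytopes_o_iff: "P \<in> polytopes_o \<longleftrightarrow> polytope_o UNIV P"
  by (simp add: polytopes_o_def polytope_o_def mem_interior)

lemma valuation_o_iff: "valuation_o \<mu> \<longleftrightarrow> valuation_on UNIV \<mu>"
  unfolding valuation_o_def valuation_on_def polytopes_o_iff by blast

lemma SL_invariant_o_iff: "SL_invariant_o \<mu> \<longleftrightarrow> SL_invariant \<mu>"
proof
  assume *: "SL_invariant_o \<mu>"
  show "SL_invariant \<mu>"
    unfolding SL_invariant_def
  proof (intro allI impI)
    fix g :: "real^'a \<Rightarrow> real^'a" and P :: "(real^'a) set" assume g: "linear g" "det (matrix g) = 1" "polytope_o UNIV P"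
    have eq: "(*v) (matrix g) = g" using matrix_vector_mul(2)[OF g(1)] by simp
    have "\<mu> ((*v) (matrix g) ` P) = \<mu> P" using * g(2,3) polytopes_o_iff[of P] unfolding SL_invariant_o_def by blast
    then show "\<mu> (g ` P) = \<mu> P" unfolding eq .
  qed
next
  assume *: "SL_invariant \<mu>"
  show "SL_invariant_o \<mu>"
    unfolding SL_invariant_o_def
  proof (intro allI ballI impI)
    fix A :: "real^'a^'a" and P :: "(real^'a) set" assume "P \<in> polytopes_o" "det A = 1"
    then show "\<mu> ((\<lambda>x. A *v x) ` P) = \<mu> P"
      using * matrix_vector_mul_linear[of A] by (simp add: SL_invariant_def polytopes_o_iff)
  qed
qed

text \<open>What remains of upper semicontinuity in the proof of the classification.\<close>
definition locally_bounded_above :: "((real^'n) set \<Rightarrow> real) \<Rightarrow> bool" where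
  "locally_bounded_above \<mu> \<longleftrightarrow> (\<forall>X P. (\<forall>k. polytope_o UNIV (X k)) \<longrightarrow> polytope_o UNIV P \<longrightarrow> radially_converges X P \<longrightarrow>
     (\<exists>M. \<forall>\<^sub>F k in sequentially. \<mu> (X k) \<le> M))"

lemma usc_imp_locally_bounded_above:
  assumes "upper_semicontinuous_o \<mu>"
  shows "locally_bounded_above \<mu>"
  unfolding locally_bounded_above_def
proof (intro allI impI)
  fix X :: "nat \<Rightarrow> (real^'a) set" and P assume X: "\<forall>k. polytope_o UNIV (X k)" and P: "polytope_o UNIV P" and c: "radially_converges X P"
  have "hausdorff_converges X P" using X by (intro radially_converges_imp_hausdorff[OF _ P c]) simp
  then have "limsup (\<lambda>k. ereal (\<mu> (X k))) \<le> ereal (\<mu> P)"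
    using assms X P by (simp add: upper_semicontinuous_o_def polytopes_o_iff)
  also have "\<dots> < ereal (\<mu> P + 1)" by simp
  finally have "\<forall>\<^sub>F k in sequentially. ereal (\<mu> (X k)) < ereal (\<mu> P + 1)" by (rule Limsup_lessD)
  then show "\<exists>M. \<forall>\<^sub>F k in sequentially. \<mu> (X k) \<le> M"
    by (intro exI[of _ "\<mu> P + 1"]) (auto elim: eventually_mono)
qed

lemma axis_nth_if: "axis a s $ i = (if i = a then s else 0)"
  by (simp add: axis_def)

lemma scale_subset_iff:
  fixes A B :: "'a::real_vector set"
  assumes "0 < c"
  shows "(*\<^sub>R) (1 / c) ` A \<subseteq> B \<longleftrightarrow> A \<subseteq> (*\<^sub>R) c ` B"
proof
  assume "(*\<^sub>R) (1 / c) ` A \<subseteq> B"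
  then have "(*\<^sub>R) c ` (*\<^sub>R) (1 / c) ` A \<subseteq> (*\<^sub>R) c ` B" by (rule image_mono)
  then show "A \<subseteq> (*\<^sub>R) c ` B" using assms by (simp add: image_image)
next
  assume "A \<subseteq> (*\<^sub>R) c ` B"
  then have "(*\<^sub>R) (1 / c) ` A \<subseteq> (*\<^sub>R) (1 / c) ` (*\<^sub>R) c ` B" by (rule image_mono)
  then show "(*\<^sub>R) (1 / c) ` A \<subseteq> B" using assms by (simp add: image_image)
qed

lemma box_join_scale:
  fixes P :: "(real^'n) set"
  assumes "(*\<^sub>R) (1 / c) ` P \<subseteq> Q" "1 < c" and pq: "\<And>k. 0 < p k" "\<And>k. 0 < q k"
  shows "(*\<^sub>R) (1 / c) ` box_join I p q P \<subseteq> box_join I p q Q"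
proof
  fix y assume "y \<in> (*\<^sub>R) (1 / c) ` box_join I p q P"
  then obtain x where y: "y = (1 / c) *\<^sub>R x" and x: "x \<in> box_join I p q P" by blast
  have "coord_proj I y = (1 / c) *\<^sub>R coord_proj I x" by (simp add: y coord_proj_def vec_eq_iff)
  moreover have "coord_proj I x \<in> P" using x by (simp add: box_join_def)
  ultimately have "coord_proj I y \<in> Q" using assms(1) by auto
  moreover have "- p k \<le> y $ k \<and> y $ k \<le> q k" if "k \<notin> I" for k
  proof -
    have b: "- p k \<le> x $ k" "x $ k \<le> q k" using x that by (auto simp: box_join_def)
    have "q k / c \<le> q k" "p k / c \<le> p k" using assms(2) pq[of k] by (simp_all add: pos_divide_le_eq)
    moreover have "- (p k / c) \<le> x $ k / c" "x $ k / c \<le> q k / c"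
      using divide_right_mono[OF b(1), of c] divide_right_mono[OF b(2), of c] assms(2) by simp_all
    moreover have "y $ k = x $ k / c" by (simp add: y)
    ultimately show ?thesis by linarith
  qed
  ultimately show "y \<in> box_join I p q Q" by (simp add: box_join_def)
qed

definition plane_embed :: "'n \<Rightarrow> 'n \<Rightarrow> real \<times> real \<Rightarrow> real^'n" where
  "plane_embed i j y = axis i (fst y) + axis j (snd y)"

lemma linear_plane_embed: "linear (plane_embed i j)"
  by (rule linearI) (simp_all add: plane_embed_def vec_eq_iff axis_def algebra_simps)

lemma plane_embed_nth: "i \<noteq> j \<Longrightarrow> plane_embed i j y $ k = (if k = i then fst y else if k = j then snd y else 0)"
  by (simp add: plane_embed_def axis_def)

lemma inj_plane_embed: "i \<noteq> j \<Longrightarrow> inj (plane_embed i j)"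
proof (rule injI)
  fix x y assume ij: "i \<noteq> j" and e: "plane_embed i j x = plane_embed i j y"
  have "plane_embed i j x $ i = plane_embed i j y $ i" "plane_embed i j x $ j = plane_embed i j y $ j" using e by auto
  then show "x = y" using ij by (simp add: plane_embed_nth prod_eq_iff)
qed

lemma norm_plane_embed: "i \<noteq> j \<Longrightarrow> norm (plane_embed i j y) = norm y"
  by (simp add: norm_eq_sqrt_inner plane_embed_def inner_add_left inner_add_right inner_axis_axis inner_prod_def)

lemma plane_embed_coord_space: "i \<noteq> j \<Longrightarrow> x \<in> coord_space {i, j} \<Longrightarrow> plane_embed i j (x $ i, x $ j) = x"
  by (simp add: vec_eq_iff plane_embed_nth coord_space_def)

lemma polytope_o_plane_embed:
  assumes ij: "i \<noteq> j" and "polytope_o UNIV S"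
  shows "polytope_o (coord_space {i, j}) (plane_embed i j ` S)"
proof -
  obtain e where e: "e > 0" "ball 0 e \<subseteq> S" and S: "polytope S" using assms by (auto simp: polytope_o_def)
  have "x \<in> plane_embed i j ` S" if x: "x \<in> ball 0 e \<inter> coord_space {i, j}" for x
  proof -
    have eq: "plane_embed i j (x $ i, x $ j) = x" using plane_embed_coord_space[OF ij] x by blast
    then have "norm (x $ i, x $ j) = norm x" using norm_plane_embed[OF ij] by metis
    then have "(x $ i, x $ j) \<in> S" using e x by (intro subsetD[OF e(2)]) simp
    then show ?thesis using eq by (metis imageI)
  qed
  moreover have "plane_embed i j ` S \<subseteq> coord_space {i, j}" using ij by (auto simp: coord_space_def plane_embed_nth)
  ultimately show ?thesis
    unfolding polytope_o_def using polytope_linear_image[OF linear_plane_embed S] e(1) by blast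
qed

lemma box_join_shear:
  fixes P :: "(real^'n) set"
  assumes s: "SL_invariant \<mu>" and ab: "a \<in> I" "b \<in> I" "a \<noteq> b" and P: "polytope_o (coord_space I) P"
    and pq: "\<And>k. 0 < p k" "\<And>k. 0 < q k"
  shows "\<mu> (box_join I p q ((\<lambda>x. x + (axis a s \<bullet> x) *\<^sub>R axis b 1) ` P)) = \<mu> (box_join I p q P)"
proof (rule box_join_linear[OF s linear_rank_one_update _ _ _ P pq])
  show "det (matrix (\<lambda>x::real^'n. x + (axis a s \<bullet> x) *\<^sub>R axis b 1)) = 1"
    using ab by (intro det_shear) (simp add: inner_axis_axis)
qed (use ab in \<open>auto simp: coord_proj_def vec_eq_iff inner_axis' axis_nth_if\<close>)

text \<open>Restricting to boxes in all but two coordinates yields the planar situation.\<close>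
lemma plane_section:
  fixes \<mu> :: "(real^'n) set \<Rightarrow> real"
  assumes v: "valuation_on UNIV \<mu>" and s: "SL_invariant \<mu>" and bd: "locally_bounded_above \<mu>" and ij: "i \<noteq> j"
    and pq: "\<And>k. 0 < p k" "\<And>k. 0 < q k"
  shows "plane_valuation (\<lambda>S. \<mu> (box_join {i, j} p q (plane_embed i j ` S)))"
proof
  show "valuation_on UNIV (\<lambda>S. \<mu> (box_join {i, j} p q (plane_embed i j ` S)))"
    unfolding valuation_on_def
  proof (intro allI impI)
    fix P Q :: "(real \<times> real) set"
    assume po: "polytope_o UNIV P" "polytope_o UNIV Q" "polytope_o UNIV (P \<union> Q)" "polytope_o UNIV (P \<inter> Q)"
    show "\<mu> (box_join {i, j} p q (plane_embed i j ` (P \<union> Q))) + \<mu> (box_join {i, j} p q (plane_embed i j ` (P \<inter> Q)))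
       = \<mu> (box_join {i, j} p q (plane_embed i j ` P)) + \<mu> (box_join {i, j} p q (plane_embed i j ` Q))"
      by (rule valuation_on_split[OF box_join_valuation_on[OF v pq] polytope_o_plane_embed[OF ij po(1)] polytope_o_plane_embed[OF ij po(2)] polytope_o_plane_embed[OF ij po(3)]])
         (simp_all add: image_Un image_Int[OF inj_plane_embed[OF ij]])
  qed
next
  fix t :: real and P :: "(real \<times> real) set" assume P: "polytope_o UNIV P"
  have "plane_embed i j ` plane_map 1 0 t 1 ` P = (\<lambda>x. x + (axis i t \<bullet> x) *\<^sub>R axis j 1) ` plane_embed i j ` P"
    unfolding image_image
    by (rule image_cong) (use ij in \<open>auto simp: vec_eq_iff plane_embed_nth plane_map_def inner_axis' axis_nth_if\<close>)
  then show "\<mu> (box_join {i, j} p q (plane_embed i j ` plane_map 1 0 t 1 ` P)) = \<mu> (box_join {i, j} p q (plane_embed i j ` P))"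
    using box_join_shear[OF s _ _ ij polytope_o_plane_embed[OF ij P] pq] by simp
  have "plane_embed i j ` plane_map 1 t 0 1 ` P = (\<lambda>x. x + (axis j t \<bullet> x) *\<^sub>R axis i 1) ` plane_embed i j ` P"
    unfolding image_image
    by (rule image_cong) (use ij in \<open>auto simp: vec_eq_iff plane_embed_nth plane_map_def inner_axis' axis_nth_if\<close>)
  then show "\<mu> (box_join {i, j} p q (plane_embed i j ` plane_map 1 t 0 1 ` P)) = \<mu> (box_join {i, j} p q (plane_embed i j ` P))"
    using box_join_shear[OF s _ _ ij[symmetric] polytope_o_plane_embed[OF ij P] pq] by simp
next
  fix X :: "nat \<Rightarrow> (real \<times> real) set" and P
  assume X: "\<forall>k. polytope_o UNIV (X k)" and P: "polytope_o UNIV P" and c: "radially_converges X P"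
  have sc: "plane_embed i j ` (*\<^sub>R) d ` S = (*\<^sub>R) d ` plane_embed i j ` S" for d S
    unfolding image_image by (rule image_cong) (simp_all add: linear_scale[OF linear_plane_embed])
  have "radially_converges (\<lambda>k. box_join {i, j} p q (plane_embed i j ` X k)) (box_join {i, j} p q (plane_embed i j ` P))"
    unfolding radially_converges_def
  proof (intro allI impI)
    fix d :: real assume d: "1 < d"
    then have "\<forall>\<^sub>F k in sequentially. (*\<^sub>R) (1 / d) ` P \<subseteq> X k \<and> X k \<subseteq> (*\<^sub>R) d ` P" using c by (simp add: radially_converges_def)
    then show "\<forall>\<^sub>F k in sequentially. (*\<^sub>R) (1 / d) ` box_join {i, j} p q (plane_embed i j ` P) \<subseteq> box_join {i, j} p q (plane_embed i j ` X k)
       \<and> box_join {i, j} p q (plane_embed i j ` X k) \<subseteq> (*\<^sub>R) d ` box_join {i, j} p q (plane_embed i j ` P)"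
    proof eventually_elim
      case (elim k)
      then have "(*\<^sub>R) (1 / d) ` P \<subseteq> X k" "(*\<^sub>R) (1 / d) ` X k \<subseteq> P" using d scale_subset_iff[of d "X k" P] by auto
      then have e: "(*\<^sub>R) (1 / d) ` plane_embed i j ` P \<subseteq> plane_embed i j ` X k" "(*\<^sub>R) (1 / d) ` plane_embed i j ` X k \<subseteq> plane_embed i j ` P"
        unfolding sc[symmetric] by (simp_all only: image_mono)
      have js: "(*\<^sub>R) (1 / d) ` box_join {i, j} p q S \<subseteq> box_join {i, j} p q T" if "(*\<^sub>R) (1 / d) ` S \<subseteq> T" for S T
        by (rule box_join_scale[OF that d pq])
      have "box_join {i, j} p q (plane_embed i j ` X k) \<subseteq> (*\<^sub>R) d ` box_join {i, j} p q (plane_embed i j ` P)"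
        using js[OF e(2)] d by (subst (asm) scale_subset_iff) simp_all
      then show ?case using js[OF e(1)] by blast
    qed
  qed
  moreover have "polytope_o UNIV (box_join {i, j} p q (plane_embed i j ` S))" if "polytope_o UNIV S" for S
    by (rule polytope_o_box_join[OF polytope_o_plane_embed[OF ij that] pq])
  ultimately show "\<exists>M. \<forall>\<^sub>F k in sequentially. \<mu> (box_join {i, j} p q (plane_embed i j ` X k)) \<le> M"
    using bd[unfolded locally_bounded_above_def, rule_format, of "\<lambda>k. box_join {i, j} p q (plane_embed i j ` X k)" "box_join {i, j} p q (plane_embed i j ` P)"] X P by simp
qed

lemma box_join_rectangle:
  fixes p q :: "'n::finite \<Rightarrow> real"
  assumes ij: "i \<noteq> j"
  shows "box_join {i, j} p q (plane_embed i j ` trapezoid x y a 0 b 0) = axis_box (p(i := x, j := b)) (q(i := y, j := a))"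
proof -
  have "coord_proj {i, j} z \<in> plane_embed i j ` S \<longleftrightarrow> (z $ i, z $ j) \<in> S" for z S
  proof -
    have "coord_proj {i, j} z = plane_embed i j (z $ i, z $ j)" using ij by (simp add: vec_eq_iff coord_proj_def plane_embed_nth)
    then show ?thesis using inj_image_mem_iff[OF inj_plane_embed[OF ij]] by simp
  qed
  then show ?thesis using ij by (auto simp: box_join_def axis_box_def trapezoid_def)
qed

lemma box_values_two_coordinates:
  fixes \<mu> :: "(real^'n) set \<Rightarrow> real"
  assumes v: "valuation_on UNIV \<mu>" and s: "SL_invariant \<mu>" and bd: "locally_bounded_above \<mu>" and ij: "i \<noteq> j"
    and pq: "\<And>k. 0 < p k" "\<And>k. 0 < q k"
  shows "\<exists>c0 c1 c2. \<forall>x y a b. 0 < x \<longrightarrow> 0 < y \<longrightarrow> 0 < a \<longrightarrow> 0 < b \<longrightarrow>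
     \<mu> (axis_box (p(i := x, j := b)) (q(i := y, j := a)))
       = c0 + c1 * ((x + y) * (a + b)) + c2 * ((1/x + 1/y) * (1/a + 1/b))"
  using plane_valuation.rectangle_values[OF plane_section[OF v s bd ij pq]] by (simp add: box_join_rectangle[OF ij])

text \<open>Two arguments are joined by changing one coordinate at a time.\<close>
lemma update_invariant_constant:
  fixes G :: "('n::finite \<Rightarrow> real) \<Rightarrow> ('n \<Rightarrow> real) \<Rightarrow> real"
  assumes inv: "\<And>p q i a b. (\<And>k. 0 < p k) \<Longrightarrow> (\<And>k. 0 < q k) \<Longrightarrow> 0 < a \<Longrightarrow> 0 < b \<Longrightarrow>
      G (p(i := a)) (q(i := b)) = G p q"
    and pos: "\<And>k. 0 < p k" "\<And>k. 0 < q k" "\<And>k. 0 < p' k" "\<And>k. 0 < q' k"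
  shows "G p' q' = G p q"
proof -
  have "G (\<lambda>k. if k \<in> S then p' k else p k) (\<lambda>k. if k \<in> S then q' k else q k) = G p q" for S
  proof (induct S rule: finite_induct[OF finite])
    case 2
    fix i :: 'n and S
    assume IH: "G (\<lambda>k. if k \<in> S then p' k else p k) (\<lambda>k. if k \<in> S then q' k else q k) = G p q"
    have "(\<lambda>k. if k \<in> insert i S then f' k else f k) = (\<lambda>k. if k \<in> S then f' k else f k)(i := f' i)"
      for f f' :: "'n \<Rightarrow> real" by auto
    then show "G (\<lambda>k. if k \<in> insert i S then p' k else p k) (\<lambda>k. if k \<in> insert i S then q' k else q k) = G p q"
      using inv[of "\<lambda>k. if k \<in> S then p' k else p k" "\<lambda>k. if k \<in> S then q' k else q k" "p' i" "q' i" i] pos IH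
      by simp
  qed simp
  from this[of UNIV] show ?thesis by simp
qed

text \<open>Fix a coordinate \<open>j\<close>. By the planar case, \<open>\<mu>\<close> of a box is an
  affine combination \<open>A + B * (p j + q j) + C * (1/p j + 1/q j)\<close>, whose coefficients
  can be recovered from three values. Varying another coordinate \<open>i\<close> together with
  \<open>j\<close> shows that \<open>A\<close>, \<open>B / \<Prod>(p k + q k)\<close> and \<open>C
  / \<Prod>(1/p k + 1/q k)\<close>, products over \<open>k \<noteq> j\<close>, do not change. So
  they are constants.\<close>
theorem box_values:
  fixes \<mu> :: "(real^'n) set \<Rightarrow> real"
  assumes v: "valuation_on UNIV \<mu>" and s: "SL_invariant \<mu>" and bd: "locally_bounded_above \<mu>" and card: "CARD('n) \<ge> 2"
  shows "\<exists>c0 c1 c2. \<forall>p q. (\<forall>k. 0 < p k) \<longrightarrow> (\<forall>k. 0 < q k) \<longrightarrow>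
     \<mu> (axis_box p q) = c0 + c1 * (\<Prod>k\<in>UNIV. p k + q k) + c2 * (\<Prod>k\<in>UNIV. 1 / p k + 1 / q k)"
proof -
  obtain i0 j :: 'n where i0: "i0 \<noteq> j" using card card_le_Suc0_iff_eq[of "UNIV :: 'n set"] by force
  \<comment> \<open>The three sample boxes have \<open>p j = q j = t\<close> with \<open>t = 1, 2, 1/2\<close>,
    and solving for the coefficients gives the following combinations.\<close>
  define D where "D p q t = \<mu> (axis_box (p(j := t)) (q(j := t)))" for p q t
  define B where "B p q = (2 * D p q 2 + D p q (1/2) - 3 * D p q 1) / 3" for p q
  define C where "C p q = (D p q 2 + 2 * D p q (1/2) - 3 * D p q 1) / 3" for p q
  define A where "A p q = D p q 1 - 2 * B p q - 2 * C p q" for p q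
  define W where "W h p q = (\<Prod>k\<in>- {j}. h (p k) (q k))" for h :: "real \<Rightarrow> real \<Rightarrow> real" and p q
  define L where "L p q i c0 c1 c2 \<longleftrightarrow> (\<forall>x y. 0 < x \<longrightarrow> 0 < y \<longrightarrow>
      A (p(i := x)) (q(i := y)) = c0 \<and> B (p(i := x)) (q(i := y)) = c1 * (x + y) \<and>
      C (p(i := x)) (q(i := y)) = c2 * (1/x + 1/y) \<and>
      (\<forall>a b. 0 < a \<longrightarrow> 0 < b \<longrightarrow> \<mu> (axis_box (p(i := x, j := b)) (q(i := y, j := a)))
         = c0 + c1 * (x + y) * (a + b) + c2 * (1/x + 1/y) * (1/a + 1/b)))" for p q i c0 c1 c2
  have loc: "\<exists>c0 c1 c2. L p q i c0 c1 c2"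
    if pq: "\<And>k. 0 < p k" "\<And>k. 0 < q k" and i: "i \<noteq> j" for p q i
  proof -
    obtain c0 c1 c2 where c: "\<And>x y a b. 0 < x \<Longrightarrow> 0 < y \<Longrightarrow> 0 < a \<Longrightarrow> 0 < b \<Longrightarrow>
       \<mu> (axis_box (p(i := x, j := b)) (q(i := y, j := a)))
         = c0 + c1 * ((x + y) * (a + b)) + c2 * ((1/x + 1/y) * (1/a + 1/b))"
      using box_values_two_coordinates[OF v s bd i, of p q] pq by blast
    have "A (p(i := x)) (q(i := y)) = c0 \<and> B (p(i := x)) (q(i := y)) = c1 * (x + y) \<and>
      C (p(i := x)) (q(i := y)) = c2 * (1/x + 1/y) \<and>
      (\<forall>a b. 0 < a \<longrightarrow> 0 < b \<longrightarrow> \<mu> (axis_box (p(i := x, j := b)) (q(i := y, j := a)))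
         = c0 + c1 * (x + y) * (a + b) + c2 * (1/x + 1/y) * (1/a + 1/b))" if xy: "0 < x" "0 < y" for x y
    proof -
      have m: "c1 * ((x + y) * t) = (c1 * (x + y)) * t" "c2 * ((1/x + 1/y) * t) = (c2 * (1/x + 1/y)) * t" for t
        by (simp_all only: mult.assoc)
      define \<beta> where "\<beta> = c1 * (x + y)"
      define \<gamma> where "\<gamma> = c2 * (1/x + 1/y)"
      have c': "\<mu> (axis_box (p(i := x, j := b)) (q(i := y, j := a))) = c0 + \<beta> * (a + b) + \<gamma> * (1/a + 1/b)"
        if "0 < a" "0 < b" for a b using c[OF xy that] unfolding m \<beta>_def[symmetric] \<gamma>_def[symmetric] .
      have d: "D (p(i := x)) (q(i := y)) t = c0 + \<beta> * (t + t) + \<gamma> * (1/t + 1/t)" if "0 < t" for t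
        unfolding D_def by (rule c'[OF that that])
      have B: "B (p(i := x)) (q(i := y)) = \<beta>" unfolding B_def by (simp add: d)
      have C: "C (p(i := x)) (q(i := y)) = \<gamma>" unfolding C_def by (simp add: d)
      have A: "A (p(i := x)) (q(i := y)) = c0" unfolding A_def by (simp add: B C d)
      show ?thesis using A B C c' unfolding \<beta>_def[symmetric] \<gamma>_def[symmetric] by blast
    qed
    then show ?thesis unfolding L_def by blast
  qed
  have updj: "A (p(j := x)) (q(j := y)) = A p q" "B (p(j := x)) (q(j := y)) = B p q"
      "C (p(j := x)) (q(j := y)) = C p q" "W h (p(j := x)) (q(j := y)) = W h p q" for p q x y h
    by (simp_all add: A_def B_def C_def D_def W_def)
  have W: "W h (p(i := x)) (q(i := y)) = h x y * (\<Prod>k\<in>- {j} - {i}. h (p k) (q k))" if "i \<noteq> j" for h p q i x y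
    using that unfolding W_def by (subst prod.remove[of _ i]) auto
  have quot: "T (p(i := x)) (q(i := y)) / W h (p(i := x)) (q(i := y)) = T p q / W h p q"
    if c: "\<And>x y. 0 < x \<Longrightarrow> 0 < y \<Longrightarrow> T (p(i := x)) (q(i := y)) = c * h x y"
      and h: "\<And>x y. 0 < x \<Longrightarrow> 0 < y \<Longrightarrow> 0 < h x y" and pq: "0 < p i" "0 < q i" and xy: "0 < x" "0 < y"
      and i: "i \<noteq> j" for T p q i x y c h
  proof -
    have "T (p(i := x)) (q(i := y)) / W h (p(i := x)) (q(i := y)) = c / (\<Prod>k\<in>- {j} - {i}. h (p k) (q k))"
      if "0 < x" "0 < y" for x y
      using c[OF that] h[OF that] by (simp add: W[OF i])
    from this[OF xy] this[OF pq] show ?thesis by simp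
  qed
  let ?one = "\<lambda>k::'n. 1::real"
  have A: "A p q = A ?one ?one" if "\<And>k. 0 < p k" "\<And>k. 0 < q k" for p q
  proof (rule update_invariant_constant[where G=A])
    show "A (p(i := a)) (q(i := b)) = A p q" if pos: "\<And>k. 0 < p k" "\<And>k. 0 < q k" "0 < a" "0 < b" for p q i a b
    proof (cases "i = j")
      case False
      obtain c0 c1 c2 where c: "L p q i c0 c1 c2" using loc[of p q i, OF pos(1,2) False] by blast
      have "A (p(i := x)) (q(i := y)) = c0" if "0 < x" "0 < y" for x y using c that by (simp add: L_def)
      from this[of a b] this[of "p i" "q i"] pos show ?thesis by simp
    qed (simp add: updj)
  qed (use that in auto)
  have B: "B p q / W (+) p q = B ?one ?one / W (+) ?one ?one" if "\<And>k. 0 < p k" "\<And>k. 0 < q k" for p q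
  proof (rule update_invariant_constant[where G="\<lambda>p q. B p q / W (+) p q"])
    show "B (p(i := a)) (q(i := b)) / W (+) (p(i := a)) (q(i := b)) = B p q / W (+) p q"
      if pos: "\<And>k. 0 < p k" "\<And>k. 0 < q k" "0 < a" "0 < b" for p q i a b
    proof (cases "i = j")
      case False
      obtain c0 c1 c2 where c: "L p q i c0 c1 c2" using loc[of p q i, OF pos(1,2) False] by blast
      have "B (p(i := x)) (q(i := y)) = c1 * (x + y)" if "0 < x" "0 < y" for x y using c that by (simp add: L_def)
      then show ?thesis by (rule quot) (use pos False in auto)
    qed (simp add: updj)
  qed (use that in auto)
  let ?h = "\<lambda>x y. 1 / x + 1 / y :: real"
  have C: "C p q / W ?h p q = C ?one ?one / W ?h ?one ?one" if "\<And>k. 0 < p k" "\<And>k. 0 < q k" for p q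
  proof (rule update_invariant_constant[where G="\<lambda>p q. C p q / W ?h p q"])
    show "C (p(i := a)) (q(i := b)) / W ?h (p(i := a)) (q(i := b)) = C p q / W ?h p q"
      if pos: "\<And>k. 0 < p k" "\<And>k. 0 < q k" "0 < a" "0 < b" for p q i a b
    proof (cases "i = j")
      case False
      obtain c0 c1 c2 where c: "L p q i c0 c1 c2" using loc[of p q i, OF pos(1,2) False] by blast
      have "C (p(i := x)) (q(i := y)) = c2 * (1/x + 1/y)" if "0 < x" "0 < y" for x y using c that by (simp add: L_def)
      then show ?thesis by (rule quot) (use pos False in \<open>auto intro!: add_pos_pos\<close>)
    qed (simp add: updj)
  qed (use that in auto)
  show ?thesis
  proof (rule exI[of _ "A ?one ?one"], rule exI[of _ "B ?one ?one / W (+) ?one ?one"],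
      rule exI[of _ "C ?one ?one / W ?h ?one ?one"], intro allI impI)
    fix p q :: "'n \<Rightarrow> real" assume pq: "\<forall>k. 0 < p k" "\<forall>k. 0 < q k"
    obtain c0 c1 c2 where "L p q i0 c0 c1 c2" using loc[of p q i0] i0 pq by blast
    note l = this[unfolded L_def, THEN spec, of "p i0", THEN spec, of "q i0"]
    have c: "A p q = c0" "B p q = c1 * (p i0 + q i0)" "C p q = c2 * (1/p i0 + 1/q i0)"
      using l pq by simp_all
    have "\<mu> (axis_box (p(j := b)) (q(j := a))) = c0 + c1 * (p i0 + q i0) * (a + b) + c2 * (1/p i0 + 1/q i0) * (1/a + 1/b)"
      if "0 < a" "0 < b" for a b using l pq that by simp
    from this[of "q j" "p j"] have c4: "\<mu> (axis_box p q)
        = c0 + c1 * (p i0 + q i0) * (q j + p j) + c2 * (1/p i0 + 1/q i0) * (1/q j + 1/p j)" using pq by simp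
    have 1: "\<mu> (axis_box p q) = A p q + B p q * (p j + q j) + C p q * (1/p j + 1/q j)"
      using c4 unfolding c by (simp only: add.commute)
    have "W (+) p q > 0" "W ?h p q > 0" using pq by (auto simp: W_def intro!: prod_pos add_pos_pos)
    then have 2: "B p q = B ?one ?one / W (+) ?one ?one * W (+) p q" "C p q = C ?one ?one / W ?h ?one ?one * W ?h p q"
      using B[of p q] C[of p q] pq by (simp_all add: nonzero_divide_eq_eq)
    have 3: "(\<Prod>k\<in>UNIV. h (p k) (q k)) = W h p q * h (p j) (q j)" for h
      unfolding W_def Compl_eq_Diff_UNIV by (subst prod.remove[of UNIV j]) simp_all
    show "\<mu> (axis_box p q) = A ?one ?one + B ?one ?one / W (+) ?one ?one * (\<Prod>k\<in>UNIV. p k + q k)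
        + C ?one ?one / W ?h ?one ?one * (\<Prod>k\<in>UNIV. 1 / p k + 1 / q k)"
      using 1 3[of "(+)"] 3[of ?h] A[of p q] 2 pq by (simp only: mult.assoc)
  qed
qed

section \<open>The classification\<close>

definition continuous_o :: "((real^'n) set \<Rightarrow> real) \<Rightarrow> bool" where
  "continuous_o \<mu> \<longleftrightarrow> (\<forall>X P. (\<forall>k. polytope_o UNIV (X k)) \<longrightarrow> polytope_o UNIV P \<longrightarrow> radially_converges X P \<longrightarrow> (\<lambda>k. \<mu> (X k)) \<longlonglongrightarrow> \<mu> P)"

lemma continuous_o_imp_locally_bounded_above:
  assumes "continuous_o \<mu>"
  shows "locally_bounded_above \<mu>"
  unfolding locally_bounded_above_def
proof (intro allI impI)
  fix X :: "nat \<Rightarrow> (real^'a) set" and P assume "\<forall>k. polytope_o UNIV (X k)" "polytope_o UNIV P" "radially_converges X P"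
  then have "(\<lambda>k. \<mu> (X k)) \<longlonglongrightarrow> \<mu> P" using assms by (simp add: continuous_o_def)
  then have "\<forall>\<^sub>F k in sequentially. \<mu> (X k) < \<mu> P + 1" by (rule order_tendstoD) simp
  then show "\<exists>M. \<forall>\<^sub>F k in sequentially. \<mu> (X k) \<le> M"
    by (intro exI[of _ "\<mu> P + 1"]) (auto elim: eventually_mono)
qed

lemma vol_valuation_on: "valuation_on UNIV (vol_n :: (real^'n) set \<Rightarrow> real)"
  unfolding valuation_on_def
proof (intro allI impI)
  fix P Q :: "(real^'n) set" assume "polytope_o UNIV P" "polytope_o UNIV Q"
  then have "P \<in> lmeasurable" "Q \<in> lmeasurable" by (auto intro: lmeasurable_compact polytope_o_compact)
  then show "vol_n (P \<union> Q) + vol_n (P \<inter> Q) = vol_n P + vol_n Q"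
    using measure_Un3[of P lebesgue Q] by (simp add: vol_n_def)
qed

lemma vol_SL_invariant: "SL_invariant (vol_n :: (real^'n) set \<Rightarrow> real)"
  unfolding SL_invariant_def vol_n_def
  using volume_linear_image lmeasurable_compact[OF polytope_o_compact] by fastforce

lemma vol_continuous_o: "continuous_o (vol_n :: (real^'n) set \<Rightarrow> real)"
  unfolding continuous_o_def vol_n_def by (auto intro: volume_tendsto polytope_o_compact)

abbreviation vol_polar :: "(real^'n) set \<Rightarrow> real" where
  "vol_polar P \<equiv> vol_n (polar_body P)"

lemma vol_polar_valuation_on: "valuation_on UNIV (vol_polar :: (real^'n) set \<Rightarrow> real)"
  unfolding valuation_on_def
proof (intro allI impI)
  fix P Q :: "(real^'n) set" assume po: "polytope_o UNIV P" "polytope_o UNIV Q" "polytope_o UNIV (P \<union> Q)"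
  have "polar_body (P \<union> Q) = polar_body P \<inter> polar_body Q" by (auto simp: polar_body_def)
  moreover have "polar_body (P \<inter> Q) = polar_body P \<union> polar_body Q"
    using po by (intro polar_Int compact_imp_closed polytope_o_compact polytope_o_convex)
  moreover have "polar_body P \<in> lmeasurable" "polar_body Q \<in> lmeasurable"
    using po polar_compact by (auto intro: lmeasurable_compact)
  ultimately show "vol_polar (P \<union> Q) + vol_polar (P \<inter> Q) = vol_polar P + vol_polar Q"
    using measure_Un3[of "polar_body P" lebesgue "polar_body Q"] by (simp add: vol_n_def)
qed

lemma vol_polar_SL_invariant: "SL_invariant (vol_polar :: (real^'n) set \<Rightarrow> real)"
  unfolding SL_invariant_def
proof (intro allI impI)
  fix g :: "real^'n \<Rightarrow> real^'n" and P :: "(real^'n) set"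
  assume g: "linear g" "det (matrix g) = 1" and P: "polytope_o UNIV P"
  have "inj g" using det_nz_iff_inj[OF g(1)] g(2) by simp
  then have "polar_body (g ` P) \<in> lmeasurable"
    by (intro lmeasurable_compact polar_compact polytope_o_linear_image g P)
  then have "measure lebesgue (adjoint g ` polar_body (g ` P)) = measure lebesgue (polar_body (g ` P))"
    using volume_linear_image[OF polar_linear_preimage(2)[OF g]] polar_linear_preimage(3)[OF g] by simp
  then show "vol_polar (g ` P) = vol_polar P" 
    unfolding vol_n_def polar_linear_preimage(1)[OF g, of P, symmetric] by simp
qed

lemma vol_polar_continuous_o: "continuous_o (vol_polar :: (real^'n) set \<Rightarrow> real)"
  unfolding continuous_o_def vol_n_def by (auto intro!: volume_tendsto polar_compact polar_radially_converges)

lemma vol_axis_box: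
  fixes p q :: "'n::finite \<Rightarrow> real"
  assumes "\<And>k. 0 < p k" "\<And>k. 0 < q k"
  shows "vol_n (axis_box p q) = (\<Prod>k\<in>UNIV. p k + q k)"
proof -
  have "- p k \<le> q k" for k using assms[of k] by linarith
  then have "cbox (\<chi> k. - p k) (\<chi> k. q k) \<noteq> {}" by (simp add: interval_ne_empty_cart)
  then show ?thesis by (simp add: vol_n_def axis_box_cbox content_cbox_cart add.commute)
qed

text \<open>The functions \<open>1\<close>, \<open>t\<close> and \<open>1/t\<close> are linearly independent
  already on three points \<open>1\<close>, \<open>N\<close>, \<open>N * N\<close>.\<close>
lemma homogeneous_coefficients:
  fixes a b c N :: real
  assumes N: "1 < N" and t: "\<And>t. t \<in> {N, N * N} \<Longrightarrow> a + b / t + c * t = t * (a + b + c)"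
  shows "a = 0" "b = 0"
proof -
  have e: "a * t + b * (1 + t) = 0" if "t \<in> {N, N * N}" for t
  proof -
    have t1: "1 < t" using that N less_1_mult[of N N] by auto
    have "t * (a + b / t + c * t) = t * (t * (a + b + c))" using t[OF that] by simp
    then have "a * t + b + c * t * t = t * t * a + t * t * b + t * t * c"
      using t1 by (simp add: algebra_simps)
    then have "(t - 1) * (a * t + b * (1 + t)) = 0" by (simp add: algebra_simps)
    then show ?thesis using t1 by simp
  qed
  have "N * (a * N + b * (1 + N)) - (a * (N * N) + b * (1 + N * N)) = b * (N - 1)"
    by (simp add: algebra_simps)
  then have "b * (N - 1) = 0" using e[of N] e[of "N * N"] by simp
  then show "b = 0" using N by simp
  then show "a = 0" using e[of N] N by simp
qed

text \<open>The general form of the values on boxes applies to the polar volume itself. Its homogeneity of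
  degree \<open>-n\<close> leaves only the third term, and the coefficient of that term is not
  zero because the polar body contains a ball.\<close>
lemma vol_polar_axis_box:
  assumes card: "CARD('n) \<ge> 2"
  shows "\<exists>w. w \<noteq> 0 \<and> (\<forall>p q :: 'n::finite \<Rightarrow> real. (\<forall>k. 0 < p k) \<longrightarrow> (\<forall>k. 0 < q k) \<longrightarrow>
    vol_polar (axis_box p q) = w * (\<Prod>k\<in>UNIV. 1 / p k + 1 / q k))"
proof -
  let ?n = "CARD('n)"
  obtain c0 c1 c2 where c: "\<And>p q :: 'n \<Rightarrow> real. \<forall>k. 0 < p k \<Longrightarrow> \<forall>k. 0 < q k \<Longrightarrow>
     vol_polar (axis_box p q) = c0 + c1 * (\<Prod>k\<in>UNIV. p k + q k) + c2 * (\<Prod>k\<in>UNIV. 1 / p k + 1 / q k)"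
    using box_values[OF vol_polar_valuation_on vol_polar_SL_invariant continuous_o_imp_locally_bounded_above[OF vol_polar_continuous_o] card] by blast
  define Q where "Q l = axis_box (\<lambda>k::'n. l) (\<lambda>k. l)" for l :: real
  have po: "polytope_o UNIV (Q l)" if "0 < l" for l using polytope_o_axis_box[of "\<lambda>_. l" "\<lambda>_. l"] that by (simp add: Q_def)
  have cQ: "vol_polar (Q (1 / l)) = c0 + (c1 * 2 ^ ?n) / l ^ ?n + (c2 * 2 ^ ?n) * l ^ ?n" if "0 < l" for l
  proof -
    have "1 / l + 1 / l = 2 / l" "l + l = 2 * l" by simp_all
    then show ?thesis using c[of "\<lambda>_. 1 / l" "\<lambda>_. 1 / l"] that
      by (simp add: Q_def power_divide power_mult_distrib)
  qed
  have hom: "vol_polar (Q (1 / l)) = l ^ ?n * vol_polar (Q 1)" if l: "0 < l" for l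
  proof -
    have "Q (1 / l) = (*\<^sub>R) (1 / l) ` Q 1"
    proof (intro equalityI subsetI)
      fix x assume "x \<in> Q (1 / l)"
      then have "l *\<^sub>R x \<in> Q 1" using l by (simp add: Q_def axis_box_def field_simps)
      moreover have "x = (1 / l) *\<^sub>R (l *\<^sub>R x)" using l by simp
      ultimately show "x \<in> (*\<^sub>R) (1 / l) ` Q 1" by blast
    qed (use l in \<open>auto simp: Q_def axis_box_def field_simps\<close>)
    then have "polar_body (Q (1 / l)) = (*\<^sub>R) l ` polar_body (Q 1)" using polar_scale[of "1 / l" "Q 1"] l by simp
    then show ?thesis using volume_scale[OF polar_compact[OF po[of 1]] l] by (simp add: vol_n_def)
  qed
  define N :: real where "N = 2 ^ ?n"
  have N: "1 < N" using card by (simp add: N_def)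
  have "c0 + (c1 * 2 ^ ?n) / t + (c2 * 2 ^ ?n) * t = t * (c0 + c1 * 2 ^ ?n + c2 * 2 ^ ?n)" if "t \<in> {N, N * N}" for t
  proof -
    have "t = 2 ^ ?n \<or> t = 4 ^ ?n" using that by (auto simp: N_def power_mult_distrib[symmetric])
    then obtain l :: real where l: "0 < l" "t = l ^ ?n" using zero_less_numeral by blast
    show ?thesis using cQ[OF l(1)] hom[OF l(1)] cQ[of 1] unfolding l(2) by simp
  qed
  note z = homogeneous_coefficients[OF N this]
  have c0: "c0 = 0" and c1: "c1 = 0" using z by simp_all
  obtain R where R: "0 < R" "\<And>x. x \<in> Q 1 \<Longrightarrow> norm x \<le> R" using polytope_o_bounded[OF po[of 1]] bounded_pos[of "Q 1"] by auto
  have "ball 0 (1 / R) \<subseteq> polar_body (Q 1)"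
  proof
    fix x :: "real^'n" assume x: "x \<in> ball 0 (1 / R)"
    have "x \<bullet> y \<le> 1" if "y \<in> Q 1" for y
    proof -
      have "x \<bullet> y \<le> norm x * norm y" by (rule norm_cauchy_schwarz)
      also have "\<dots> \<le> (1 / R) * R" using x R(2)[OF that] R(1) by (intro mult_mono) auto
      finally show ?thesis using R(1) by simp
    qed
    then show "x \<in> polar_body (Q 1)" by (simp add: polar_body_def)
  qed
  then have "measure lebesgue (ball 0 (1 / R) :: (real^'n) set) \<le> vol_polar (Q 1)"
    unfolding vol_n_def using polar_compact[OF po[of 1]]
    by (intro measure_mono_fmeasurable) (auto intro: lmeasurable_compact)
  moreover have "0 < measure lebesgue (ball 0 (1 / R) :: (real^'n) set)"
    using R(1) content_ball_pos[of "1 / R" "0 :: real^'n"] by simp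
  ultimately have "vol_polar (Q 1) \<noteq> 0" by linarith
  then have "c2 \<noteq> 0" using cQ[of 1] c0 c1 by auto
  then show ?thesis using c c0 c1 by (intro exI[of _ c2]) auto
qed

text \<open>Subtract the combination of the three functions that agrees with \<open>\<mu>\<close> on boxes.\<close>
lemma classification:
  fixes \<mu> :: "(real^'n) set \<Rightarrow> real"
  assumes v: "valuation_on UNIV \<mu>" and s: "SL_invariant \<mu>" and bd: "locally_bounded_above \<mu>" and card: "CARD('n) \<ge> 2"
  shows "\<exists>c0 c1 c2. \<forall>P. polytope_o UNIV P \<longrightarrow> \<mu> P = c0 + c1 * vol_n P + c2 * vol_polar P"
proof -
  obtain c0 c1 c2 where c: "\<And>p q. \<forall>k. 0 < p k \<Longrightarrow> \<forall>k. 0 < q k \<Longrightarrow>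
     \<mu> (axis_box p q) = c0 + c1 * (\<Prod>k\<in>UNIV. p k + q k) + c2 * (\<Prod>k\<in>UNIV. 1 / p k + 1 / q k)"
    using box_values[OF assms] by blast
  obtain w where w: "w \<noteq> 0" "\<And>p q :: 'n \<Rightarrow> real. \<forall>k. 0 < p k \<Longrightarrow> \<forall>k. 0 < q k \<Longrightarrow>
    vol_polar (axis_box p q) = w * (\<Prod>k\<in>UNIV. 1 / p k + 1 / q k)"
    using vol_polar_axis_box[OF card] by blast
  define \<tau> where "\<tau> P = \<mu> P - (c0 + c1 * vol_n P + c2 / w * vol_polar P)" for P
  have "null_on_boxes \<tau>"
    unfolding null_on_boxes_def
  proof (intro conjI allI impI)
    show "valuation_on UNIV \<tau>"
      unfolding valuation_on_def
    proof (intro allI impI)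
      fix P Q :: "(real^'n) set" assume po: "polytope_o UNIV P" "polytope_o UNIV Q" "polytope_o UNIV (P \<union> Q)" "polytope_o UNIV (P \<inter> Q)"
      note e = valuation_on_split[OF _ po(1-3) refl refl]
      have "c1 * (vol_n (P \<union> Q) + vol_n (P \<inter> Q)) = c1 * (vol_n P + vol_n Q)"
        "c2 / w * (vol_polar (P \<union> Q) + vol_polar (P \<inter> Q)) = c2 / w * (vol_polar P + vol_polar Q)"
        using e[OF vol_valuation_on] e[OF vol_polar_valuation_on] by simp_all
      then show "\<tau> (P \<union> Q) + \<tau> (P \<inter> Q) = \<tau> P + \<tau> Q"
        using e[OF v] unfolding \<tau>_def distrib_left by linarith
    qed
    show "SL_invariant \<tau>"
      unfolding SL_invariant_def
    proof (intro allI impI)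
      fix g :: "real^'n \<Rightarrow> real^'n" and P :: "(real^'n) set"
      assume "linear g" "det (matrix g) = 1" "polytope_o UNIV P"
      then have "\<mu> (g ` P) = \<mu> P" "vol_n (g ` P) = vol_n P" "vol_polar (g ` P) = vol_polar P"
        using s vol_SL_invariant vol_polar_SL_invariant unfolding SL_invariant_def by blast+
      then show "\<tau> (g ` P) = \<tau> P" by (simp add: \<tau>_def)
    qed
    show "\<tau> (axis_box p q) = 0" if "\<forall>k. 0 < p k" "\<forall>k. 0 < q k" for p q
      using c[OF that] w(2)[OF that] vol_axis_box[of p q] that w(1) by (simp add: \<tau>_def)
  qed
  moreover have "box_join UNIV (\<lambda>_. 1) (\<lambda>_. 1) P = P" for P :: "(real^'n) set"
    by (auto simp: box_join_def coord_proj_def)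
  moreover have "coord_space UNIV = (UNIV :: (real^'n) set)" by (simp add: coord_space_def)
  ultimately have "\<tau> P = 0" if "polytope_o UNIV P" for P
    using null_on_boxes_vanish[of \<tau> UNIV P "\<lambda>_. 1" "\<lambda>_. 1"] that by simp
  then show ?thesis
    by (intro exI[of _ c0] exI[of _ c1] exI[of _ "c2 / w"]) (simp add: \<tau>_def)
qed

theorem theorem1p3:
  fixes \<mu> :: "(real^'n) set \<Rightarrow> real"
  assumes "CARD('n) \<ge> 2"
  shows "(upper_semicontinuous_o \<mu> \<and> SL_invariant_o \<mu> \<and> valuation_o \<mu>) \<longleftrightarrow>
    (\<exists>c\<^sub>0 c\<^sub>1 c\<^sub>2 :: real. \<forall>P \<in> polytopes_o.
       \<mu> P = c\<^sub>0 * euler_characteristic P + c\<^sub>1 * vol_n P + c\<^sub>2 * vol_n (polar_body P))"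
proof -
  have euler: "euler_characteristic P = 1" if "polytope_o UNIV P" for P :: "(real^'n) set"
    by (rule euler_characteristic_convex[OF polytope_o_convex[OF that] polytope_o_nonempty[OF that]])
  show ?thesis
  proof
    assume "upper_semicontinuous_o \<mu> \<and> SL_invariant_o \<mu> \<and> valuation_o \<mu>"
    then obtain c0 c1 c2 where "\<forall>P. polytope_o UNIV P \<longrightarrow> \<mu> P = c0 + c1 * vol_n P + c2 * vol_polar P"
      using classification[OF _ _ _ assms] usc_imp_locally_bounded_above unfolding valuation_o_iff SL_invariant_o_iff by blast
    then show "\<exists>c\<^sub>0 c\<^sub>1 c\<^sub>2. \<forall>P\<in>polytopes_o. \<mu> P = c\<^sub>0 * euler_characteristic P + c\<^sub>1 * vol_n P + c\<^sub>2 * vol_n (polar_body P)"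
      by (intro exI[of _ c0] exI[of _ c1] exI[of _ c2]) (simp add: polytopes_o_iff euler)
  next
    assume "\<exists>c\<^sub>0 c\<^sub>1 c\<^sub>2. \<forall>P\<in>polytopes_o. \<mu> P = c\<^sub>0 * euler_characteristic P + c\<^sub>1 * vol_n P + c\<^sub>2 * vol_n (polar_body P)"
    then obtain c0 c1 c2 where "\<forall>P\<in>polytopes_o. \<mu> P = c0 * euler_characteristic P + c1 * vol_n P + c2 * vol_n (polar_body P)"
      by blast
    then have eq: "\<mu> P = c0 + c1 * vol_n P + c2 * vol_polar P" if "polytope_o UNIV P" for P
      using that by (simp add: polytopes_o_iff euler)
    have "valuation_o \<mu>"
      unfolding valuation_o_iff valuation_on_def
    proof (intro allI impI)
      fix P Q :: "(real^'n) set" assume po: "polytope_o UNIV P" "polytope_o UNIV Q" "polytope_o UNIV (P \<union> Q)" "polytope_o UNIV (P \<inter> Q)"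
      note e = valuation_on_split[OF _ po(1-3) refl refl]
      have "c1 * (vol_n (P \<union> Q) + vol_n (P \<inter> Q)) = c1 * (vol_n P + vol_n Q)"
        "c2 * (vol_polar (P \<union> Q) + vol_polar (P \<inter> Q)) = c2 * (vol_polar P + vol_polar Q)"
        using e[OF vol_valuation_on] e[OF vol_polar_valuation_on] by simp_all
      then show "\<mu> (P \<union> Q) + \<mu> (P \<inter> Q) = \<mu> P + \<mu> Q"
        unfolding po[THEN eq] distrib_left by linarith
    qed
    moreover have "SL_invariant_o \<mu>"
      unfolding SL_invariant_o_iff SL_invariant_def
    proof (intro allI impI)
      fix g :: "real^'n \<Rightarrow> real^'n" and P :: "(real^'n) set"
      assume g: "linear g" "det (matrix g) = 1" and P: "polytope_o UNIV P"
      have "inj g" using det_nz_iff_inj[OF g(1)] g(2) by simp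
      then have "polytope_o UNIV (g ` P)" by (intro polytope_o_linear_image g P)
      moreover have "vol_n (g ` P) = vol_n P" "vol_polar (g ` P) = vol_polar P"
        using vol_SL_invariant vol_polar_SL_invariant g P by (auto simp: SL_invariant_def)
      ultimately show "\<mu> (g ` P) = \<mu> P" by (simp add: eq P)
    qed
    moreover have "upper_semicontinuous_o \<mu>"
      unfolding upper_semicontinuous_o_def polytopes_o_iff
    proof (intro allI impI, elim conjE)
      fix X :: "nat \<Rightarrow> (real^'n) set" and P
      assume X: "\<forall>k. polytope_o UNIV (X k)" and P: "polytope_o UNIV P" and "hausdorff_converges X P"
      then have c: "radially_converges X P" using hausdorff_imp_radially_converges by blast
      have "(\<lambda>k. vol_n (X k)) \<longlonglongrightarrow> vol_n P" "(\<lambda>k. vol_polar (X k)) \<longlonglongrightarrow> vol_polar P"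
        using vol_continuous_o vol_polar_continuous_o X P c by (auto simp: continuous_o_def)
      then have "(\<lambda>k. \<mu> (X k)) \<longlonglongrightarrow> \<mu> P"
        unfolding eq[OF X[rule_format]] eq[OF P] by (intro tendsto_intros)
      then have "(\<lambda>k. ereal (\<mu> (X k))) \<longlonglongrightarrow> ereal (\<mu> P)" by simp
      then show "limsup (\<lambda>k. ereal (\<mu> (X k))) \<le> ereal (\<mu> P)"
        by (rule lim_imp_Limsup[OF sequentially_bot, THEN eq_refl])
    qed
    ultimately show "upper_semicontinuous_o \<mu> \<and> SL_invariant_o \<mu> \<and> valuation_o \<mu>" by blast
  qed
qed

end
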